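(* There is an absolute constant $C$ such that for any ideal marking $\mathcal I=(I_1,\dots,I_p)$ of $\mathbb D$ with $p\ge4$, $$\mathbf W(\mathbb D,\mathcal I)-Cp\ \le\ 2\sum_{\{m,n\}}\mathcal W_{mn}\ \le\ \mathbf W(\mathbb D,\mathcal I),$$ where the sum is over unordered pairs $\{m,n\}$ of non-adjacent indices.
   Context: An ideal marking of $\mathbb D$ of cardinality $p$ is a tiling of the unit circle $\mathbb T$ into closed arcs $I_1,\dots,I_p$ in cyclic order, indices in $\mathbb Z/p\mathbb Z$; $m,n$ are non-adjacent if $|m-n|>1$ in $\mathbb Z/p\mathbb Z$. Widths are extremal widths (reciprocals of extremal lengths) of path families in $\mathbb D$. $\overline{\mathcal W}_{mn}$ is the width of the family of paths in $\mathbb D$ joining $I_m$ to $I_n$, and $\mathcal W_{mn}=\max(\overline{\mathcal W}_{mn}-2,0)$. $\overline{\mathcal W}_n$ is the width of the family of paths in $\mathbb D$ joining $I_n$ to the union of all intervals non-adjacent to $I_n$ (i.e. to $\mathbb T\setminus(I_{n-1}\cup I_n\cup I_{n+1})$), the local weight is $\mathcal W_n=\max(\overline{\mathcal W}_n-2,0)$, and the total weight is $\mathbf W(\mathbb D,\mathcal I)=\sum_{n}\mathcal W_n$. *)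

theory Defs
  imports "HOL-Analysis.Analysis"
begin

text \<open>An ideal marking of the unit disk of cardinality p: p closed arcs of the unit
circle in cyclic order, given by angles theta 0 < theta 1 < ... < theta p = theta 0 + 2 pi.
Arc k (k < p) is the image of [theta k, theta (k+1)] under cis.\<close>

definition ideal_marking :: "nat \<Rightarrow> (nat \<Rightarrow> real) \<Rightarrow> bool" where
  "ideal_marking p \<theta> \<longleftrightarrow> (\<forall>k<p. \<theta> k < \<theta> (Suc k)) \<and> \<theta> p = \<theta> 0 + 2 * pi"

definition marking_arc :: "(nat \<Rightarrow> real) \<Rightarrow> nat \<Rightarrow> complex set" where
  "marking_arc \<theta> k = cis ` {\<theta> k .. \<theta> (Suc k)}"

definition nonadjacent :: "nat \<Rightarrow> nat \<Rightarrow> nat \<Rightarrow> bool" where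
  "nonadjacent p m n \<longleftrightarrow> m < p \<and> n < p \<and> m \<noteq> n \<and> Suc m mod p \<noteq> n \<and> Suc n mod p \<noteq> m"

text \<open>Paths in the disk joining A to B: interior points lie in the open unit disk,
endpoints in A and B respectively (piecewise C1 paths, so that rho-lengths are defined).\<close>
definition joining_paths :: "complex set \<Rightarrow> complex set \<Rightarrow> (real \<Rightarrow> complex) set" where
  "joining_paths A B = {g. valid_path g \<and> pathstart g \<in> A \<and> pathfinish g \<in> B \<and>
       (\<forall>t\<in>{0<..<1}. g t \<in> ball 0 1)}"

definition rho_length :: "(complex \<Rightarrow> ennreal) \<Rightarrow> (real \<Rightarrow> complex) \<Rightarrow> ennreal" where
  "rho_length \<rho> g = (\<integral>\<^sup>+ t\<in>{0..1}. \<rho> (g t) * ennreal (norm (vector_derivative g (at t))) \<partial>lborel)"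

definition rho_area :: "(complex \<Rightarrow> ennreal) \<Rightarrow> ennreal" where
  "rho_area \<rho> = (\<integral>\<^sup>+ z\<in>ball 0 1. (\<rho> z)\<^sup>2 \<partial>lborel)"

text \<open>Extremal width (= modulus = reciprocal of extremal length) of a path family.\<close>
definition extremal_width :: "(real \<Rightarrow> complex) set \<Rightarrow> ennreal" where
  "extremal_width \<Gamma> = Inf {rho_area \<rho> | \<rho>. \<rho> \<in> borel_measurable borel \<and>
       (\<forall>g\<in>\<Gamma>. 1 \<le> rho_length \<rho> g)}"

definition pair_width :: "(nat \<Rightarrow> real) \<Rightarrow> nat \<Rightarrow> nat \<Rightarrow> ereal" where
  "pair_width \<theta> m n = enn2ereal (extremal_width (joining_paths (marking_arc \<theta> m) (marking_arc \<theta> n)))"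

definition pair_weight :: "(nat \<Rightarrow> real) \<Rightarrow> nat \<Rightarrow> nat \<Rightarrow> ereal" where
  "pair_weight \<theta> m n = max (pair_width \<theta> m n - 2) 0"

definition local_width :: "nat \<Rightarrow> (nat \<Rightarrow> real) \<Rightarrow> nat \<Rightarrow> ereal" where
  "local_width p \<theta> n = enn2ereal (extremal_width (joining_paths (marking_arc \<theta> n)
      (\<Union>k\<in>{k. nonadjacent p n k}. marking_arc \<theta> k)))"

definition local_weight :: "nat \<Rightarrow> (nat \<Rightarrow> real) \<Rightarrow> nat \<Rightarrow> ereal" where
  "local_weight p \<theta> n = max (local_width p \<theta> n - 2) 0"

definition total_weight :: "nat \<Rightarrow> (nat \<Rightarrow> real) \<Rightarrow> ereal" where
  "total_weight p \<theta> = (\<Sum>n<p. local_weight p \<theta> n)"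

end

theory Submission
  imports Defs "HOL-Complex_Analysis.Conformal_Mappings"
begin

text \<open>Let \<open>L(I, J)\<close> be \<open>1 / \<pi>\<close> times the logarithm of the cross ratio of the endpoints of two disjoint
  arcs. It is exactly additive when \<open>J\<close> is subdivided, and the width \<open>W\<close> between \<open>I\<close> and \<open>J\<close> satisfies
  \<open>L \<le> W \<le> L + 2\<close>, and even \<open>W \<le> L + 1\<close> if \<open>W > 2\<close>. The lower bound is the length-area inequality in the
  coordinate that turns the disk into a half-plane and \<open>I\<close> into a half-line; the upper bound comes from
  the confocal coordinate \<open>arccos\<close>, folded along the axis of symmetry of \<open>J\<close>.
  The right-hand inequality follows since two or more pair widths exceeding 2 lose at least 2
  altogether. For the left-hand inequality it remains to bound the sum of \<open>min (L(I\<^sub>m, I\<^sub>n)) 2\<close> over all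
  pairs by a multiple of \<open>p\<close>: send an endpoint to infinity and charge each pair to the
  shorter of its two intervals.\<close>

section \<open>Conformal change of variables\<close>

text \<open>The exact width between two disjoint arcs is a quotient of elliptic integrals. Letting
  one pair of endpoints collide makes the problem elementary at the cost of infinite width, and
  cutting along the symmetry axis of the second arc restores finiteness. With
  \<open>T = exp (pi * L / 2)\<close> this gives \<open>W <= 2 * ln (4 * T + 2) / pi\<close>. The
  excess of this bound over \<open>L\<close> decreases from \<open>2 * ln 6 / pi\<close>, about
  1.14, at \<open>T = 1\<close> towards \<open>2 * ln 4 / pi\<close>, about 0.88. So it is below 1
  only for large \<open>T\<close>, and \<open>W > 2\<close> is exactly what forces \<open>T\<close>
  to be large. The cruder excess 2 is affordable for local widths, where it cancels the 2 subtracted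
  in the definition of the weight. The glued metric is controlled only in the open disk, while paths
  end on the circle, and the glued potential need not be differentiable across the cut.
  Admissibility is therefore derived from local Lipschitz bounds for a continuous potential, and the
  endpoints are reached by a limit.\<close>

lemma lborel_complex_eq_distr:
  "(lborel :: complex measure) = distr (lborel \<Otimes>\<^sub>M lborel) borel (\<lambda>(x, y). Complex x y)"
proof (rule lborel_eqI)
  fix l u :: complex
  assume le: "\<And>b. b \<in> Basis \<Longrightarrow> l \<bullet> b \<le> u \<bullet> b"
  have [measurable]: "(\<lambda>(x, y). Complex x y) \<in> borel_measurable (borel \<Otimes>\<^sub>M borel)"
    unfolding borel_prod
    by (intro borel_measurable_continuous_onI) (auto simp: case_prod_unfold complex_eq intro!: continuous_intros)
  have "(\<lambda>(x, y). Complex x y) -` box l u = {Re l<..<Re u} \<times> {Im l<..<Im u}"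
    by (auto simp: box_def Basis_complex_def)
  then have "emeasure (distr (lborel \<Otimes>\<^sub>M lborel) borel (\<lambda>(x, y). Complex x y)) (box l u) =
     emeasure (lborel \<Otimes>\<^sub>M lborel) ({Re l<..<Re u} \<times> {Im l<..<Im u})"
    by (subst emeasure_distr) (auto simp: space_pair_measure)
  also have "\<dots> = emeasure lborel {Re l<..<Re u} * emeasure lborel {Im l<..<Im u}"
    by (intro lborel.emeasure_pair_measure_Times) auto
  also have "\<dots> = (\<Prod>b\<in>Basis. (u - l) \<bullet> b)"
    using le[of 1] le[of \<i>] by (simp add: Basis_complex_def ennreal_mult)
  finally show "emeasure (distr (lborel \<Otimes>\<^sub>M lborel) borel (\<lambda>(x, y). Complex x y)) (box l u)
     = (\<Prod>b\<in>Basis. (u - l) \<bullet> b)" .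
qed simp

lemma nn_integral_complex_iterated:
  fixes F :: "complex \<Rightarrow> ennreal"
  assumes [measurable]: "F \<in> borel_measurable borel"
  shows "(\<integral>\<^sup>+ z. F z \<partial>lborel) = (\<integral>\<^sup>+ x. \<integral>\<^sup>+ y. F (Complex x y) \<partial>lborel \<partial>lborel)"
proof -
  have [measurable]: "(\<lambda>(x, y). Complex x y) \<in> borel_measurable (borel \<Otimes>\<^sub>M borel)"
    unfolding borel_prod
    by (intro borel_measurable_continuous_onI) (auto simp: case_prod_unfold complex_eq intro!: continuous_intros)
  show ?thesis
    by (subst lborel_complex_eq_distr, subst nn_integral_distr)
       (auto simp: lborel.nn_integral_fst[symmetric] case_prod_unfold)
qed

section \<open>The area formula for injective holomorphic maps\<close>

definition complex_to_vec :: "complex \<Rightarrow> real ^ 2" where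
  "complex_to_vec z = vector [Re z, Im z]"

definition vec_to_complex :: "real ^ 2 \<Rightarrow> complex" where
  "vec_to_complex v = Complex (v $ 1) (v $ 2)"

lemma vec_to_complex_inverse [simp]: "complex_to_vec (vec_to_complex v) = v"
  by (simp add: complex_to_vec_def vec_to_complex_def vec_eq_iff forall_2)

lemma complex_to_vec_inverse [simp]: "vec_to_complex (complex_to_vec z) = z"
  by (simp add: complex_to_vec_def vec_to_complex_def)

lemma bounded_linear_complex_to_vec: "bounded_linear complex_to_vec"
  by (intro linear_conv_bounded_linear[THEN iffD1] linearI)
     (simp_all add: complex_to_vec_def vec_eq_iff forall_2)

lemma bounded_linear_vec_to_complex: "bounded_linear vec_to_complex"
  by (intro linear_conv_bounded_linear[THEN iffD1] linearI)
     (simp_all add: vec_to_complex_def complex_eq_iff)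

lemma borel_measurable_vec_to_complex [measurable]: "vec_to_complex \<in> borel_measurable borel"
  by (intro borel_measurable_continuous_onI linear_continuous_on bounded_linear_vec_to_complex)

lemma lborel_complex_eq_distr_vec: "(lborel :: complex measure) = distr lborel borel vec_to_complex"
proof (rule lborel_eqI)
  fix l u :: complex
  assume le: "\<And>b. b \<in> Basis \<Longrightarrow> l \<bullet> b \<le> u \<bullet> b"
  have B: "(Basis :: (real^2) set) = {axis 1 1, axis 2 1}"
    by (auto simp: Basis_vec_def UNIV_2)
  have ne: "axis (1::2) (1::real) \<noteq> axis 2 1"
    by (simp add: axis_eq_axis)
  have "vec_to_complex -` box l u = box (complex_to_vec l) (complex_to_vec u)"
    by (auto simp: box_def Basis_complex_def B vec_to_complex_def complex_to_vec_def inner_axis)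
  then have "emeasure (distr lborel borel vec_to_complex) (box l u)
      = emeasure lborel (box (complex_to_vec l) (complex_to_vec u))"
    by (subst emeasure_distr) auto
  also have "\<dots> = (\<Prod>b\<in>Basis. (complex_to_vec u - complex_to_vec l) \<bullet> b)"
    using le[of 1] le[of \<i>] by (intro emeasure_lborel_box) (auto simp: B Basis_complex_def complex_to_vec_def inner_axis)
  also have "\<dots> = (\<Prod>b\<in>Basis. (u - l) \<bullet> b)"
    using ne by (simp add: B Basis_complex_def complex_to_vec_def inner_axis)
  finally show "emeasure (distr lborel borel vec_to_complex) (box l u) = (\<Prod>b\<in>Basis. (u - l) \<bullet> b)" .
qed simp

text \<open>The image is Borel because it is the preimage of \<open>E\<close> under the holomorphic
  inverse of \<open>f\<close>. For its measure the map is transported to \<open>real ^ 2\<close>,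
  where the Jacobian determinant of multiplication by \<open>f'\<close> is the square of its
  modulus.\<close>

lemma emeasure_holomorphic_image:
  fixes f :: "complex \<Rightarrow> complex"
  assumes S: "open S" and f: "f holomorphic_on S" and inj: "inj_on f S"
    and E: "E \<in> sets borel" "E \<subseteq> S"
  shows "f ` E \<in> sets borel"
    and "emeasure lborel (f ` E) = (\<integral>\<^sup>+ z. ennreal ((norm (deriv f z))\<^sup>2) * indicator E z \<partial>lborel)"
proof -
  obtain g where g: "g holomorphic_on (f ` S)" "\<And>z. z \<in> S \<Longrightarrow> g (f z) = z"
    using holomorphic_has_inverse[OF f S inj] by metis
  have oS: "open (f ` S)"
    using open_mapping_thm3[OF f S inj] .
  have fE: "f ` E = f ` S \<inter> g -` E"
    using g(2) E(2) by auto
  have "g \<in> borel_measurable (restrict_space borel (f ` S))"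
    by (intro borel_measurable_continuous_on_restrict holomorphic_on_imp_continuous_on g)
  then have "g -` E \<inter> space (restrict_space borel (f ` S)) \<in> sets (restrict_space borel (f ` S))"
    using E by (intro measurable_sets) auto
  then have "f ` S \<inter> g -` E \<in> sets borel"
    using oS by (auto simp: sets_restrict_space_iff space_restrict_space Int_commute)
  then show fEb: "f ` E \<in> sets borel"
    by (simp add: fE)
  define F where "F = (\<lambda>v. complex_to_vec (f (vec_to_complex v)))"
  define F' where "F' = (\<lambda>v w. complex_to_vec (deriv f (vec_to_complex v) * vec_to_complex w))"
  define EV where "EV = vec_to_complex -` E"
  have EVb [measurable]: "EV \<in> sets borel"
    using measurable_sets_borel[OF borel_measurable_vec_to_complex E(1)] by (simp add: EV_def)
  have pre: "vec_to_complex -` A = complex_to_vec ` A" for A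
  proof (intro equalityI subsetI)
    fix v assume "v \<in> vec_to_complex -` A"
    then show "v \<in> complex_to_vec ` A"
      by (intro image_eqI[of _ _ "vec_to_complex v"]) auto
  qed auto
  have FEV: "F ` EV = complex_to_vec ` f ` E"
    unfolding F_def EV_def pre by (simp add: image_image)
  have FEVb: "F ` EV \<in> sets borel"
    unfolding FEV pre[symmetric] using measurable_sets_borel[OF borel_measurable_vec_to_complex fEb] by simp
  have der: "(F has_derivative F' v) (at v within EV)" if "v \<in> EV" for v
  proof -
    have "(f has_field_derivative deriv f (vec_to_complex v)) (at (vec_to_complex v))"
      using that E(2) holomorphic_derivI[OF f S] by (auto simp: EV_def)
    then have "(f has_derivative (*) (deriv f (vec_to_complex v))) (at (vec_to_complex v))"
      by (simp add: has_field_derivative_def)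
    moreover have "(vec_to_complex has_derivative vec_to_complex) (at v)"
      by (rule bounded_linear_imp_has_derivative[OF bounded_linear_vec_to_complex])
    ultimately have "((\<lambda>v. f (vec_to_complex v)) has_derivative (\<lambda>w. deriv f (vec_to_complex v) * vec_to_complex w)) (at v)"
      using has_derivative_compose[of vec_to_complex vec_to_complex v UNIV f "(*) (deriv f (vec_to_complex v))"] by simp
    then show ?thesis
      unfolding F_def F'_def
      by (rule has_derivative_at_withinI[OF bounded_linear.has_derivative[OF bounded_linear_complex_to_vec]])
  qed
  have inv: "inj_on F EV"
  proof (rule inj_onI)
    fix v w assume "v \<in> EV" "w \<in> EV" "F v = F w"
    then have "vec_to_complex v = vec_to_complex w"
      using inj E(2) unfolding F_def EV_def inj_on_def
      by (metis complex_to_vec_inverse subsetD vimageE)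
    then show "v = w" by (metis vec_to_complex_inverse)
  qed
  have det: "\<bar>det (matrix (F' v))\<bar> = (norm (deriv f (vec_to_complex v)))\<^sup>2" for v
    by (simp add: F'_def det_2 matrix_def complex_to_vec_def vec_to_complex_def axis_def cmod_power2)
       (simp add: power2_eq_square abs_of_nonneg)
  have "deriv f \<in> borel_measurable (restrict_space borel S)"
    by (intro borel_measurable_continuous_on_restrict holomorphic_on_imp_continuous_on holomorphic_deriv f S)
  then have m1: "(\<lambda>z. norm (deriv f z)) \<in> borel_measurable (restrict_space borel S)"
    by measurable
  then have "(\<lambda>z. norm (deriv f z)) \<in> borel_measurable (restrict_space borel E)"
    using E(2) measurable_restrict_mono by blast
  then have m2 [measurable]: "(\<lambda>z. indicator E z * norm (deriv f z)) \<in> borel_measurable borel"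
    using E(1) by (subst (asm) borel_measurable_restrict_space_iff) (auto simp: mult.commute)
  define D where "D = (\<lambda>v. (indicator EV v * norm (deriv f (vec_to_complex v)))\<^sup>2)"
  have D_nonneg: "0 \<le> D v" for v
    by (simp add: D_def)
  have [measurable]: "D \<in> borel_measurable borel"
  proof -
    have "D = (\<lambda>v. ((\<lambda>z. indicator E z * norm (deriv f z)) (vec_to_complex v))\<^sup>2)"
      by (auto simp: D_def EV_def indicator_def)
    then show ?thesis by simp
  qed
  have "emeasure lborel (F ` EV) = (\<integral>\<^sup>+ v. ennreal (D v) \<partial>lborel)"
  \<comment> \<open>The change of variables speaks of finite measures. If the image has infinite
    measure, a finite integral of the Jacobian would make the image measurable with finite measure,
    so the integral is infinite as well.\<close>
  proof (cases "F ` EV \<in> lmeasurable")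
    case True
    have "((\<lambda>v. \<bar>det (matrix (F' v))\<bar>) has_integral measure lebesgue (F ` EV)) EV"
      using has_measure_differentiable_image[of EV F F' "measure lebesgue (F ` EV)"] True der inv EVb by auto
    then have "(D has_integral measure lebesgue (F ` EV)) UNIV"
      unfolding det
      by (subst (asm) has_integral_restrict_UNIV[symmetric])
         (erule has_integral_eq[rotated], auto simp: D_def indicator_def)
    then have "(\<integral>\<^sup>+ v. ennreal (D v) \<partial>lborel) = ennreal (measure lebesgue (F ` EV))"
      by (intro nn_integral_has_integral_lborel) (simp_all add: D_nonneg)
    then show ?thesis
      using emeasure_eq_measure2[OF True] FEVb by simp
  next
    case False
    then have inf: "emeasure lborel (F ` EV) = \<infinity>"
      using FEVb by (auto simp: fmeasurable_def) (metis top.not_eq_extremum)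
    have "(\<integral>\<^sup>+ v. ennreal (D v) \<partial>lborel) = \<infinity>"
    proof (rule ccontr)
      assume "(\<integral>\<^sup>+ v. ennreal (D v) \<partial>lborel) \<noteq> \<infinity>"
      then have "integrable lborel D"
        by (intro integrableI_nonneg) (simp_all add: D_nonneg top.not_eq_extremum)
      then have "D integrable_on UNIV"
        using integrable_on_lborel by blast
      then obtain m where "(D has_integral m) UNIV" by blast
      then have "((\<lambda>v. if v \<in> EV then \<bar>det (matrix (F' v))\<bar> else 0) has_integral m) UNIV"
        by (rule has_integral_eq[rotated]) (auto simp: D_def indicator_def det)
      then have "((\<lambda>v. \<bar>det (matrix (F' v))\<bar>) has_integral m) EV"
        by (simp add: has_integral_restrict_UNIV)
      then show False
        using has_measure_differentiable_image[of EV F F' m] False der inv EVb by auto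
    qed
    then show ?thesis using inf by simp
  qed
  moreover have "emeasure lborel (f ` E) = emeasure lborel (F ` EV)"
    by (subst lborel_complex_eq_distr_vec, subst emeasure_distr) (use fEb in \<open>auto simp: FEV pre\<close>)
  moreover have "(\<integral>\<^sup>+ z. ennreal ((norm (deriv f z))\<^sup>2) * indicator E z \<partial>lborel)
     = (\<integral>\<^sup>+ z. ennreal ((indicator E z * norm (deriv f z))\<^sup>2) \<partial>lborel)"
    by (intro nn_integral_cong) (auto simp: indicator_def)
  moreover have "\<dots> = (\<integral>\<^sup>+ v. ennreal (D v) \<partial>lborel)"
  proof -
    have "(\<lambda>z. ennreal ((indicator E z * norm (deriv f z))\<^sup>2)) \<in> borel_measurable borel"
      by measurable
    then show ?thesis
      by (subst lborel_complex_eq_distr_vec, subst nn_integral_distr)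
         (auto intro!: nn_integral_cong simp: D_def EV_def indicator_def)
  qed
  ultimately show "emeasure lborel (f ` E) = (\<integral>\<^sup>+ z. ennreal ((norm (deriv f z))\<^sup>2) * indicator E z \<partial>lborel)"
    by simp
qed

lemma nn_integral_conformal_substitution:
  fixes f :: "complex \<Rightarrow> complex" and h :: "complex \<Rightarrow> ennreal"
  assumes S: "open S" and f: "f holomorphic_on S" and inj: "inj_on f S"
    and h [measurable]: "h \<in> borel_measurable borel"
  shows "(\<integral>\<^sup>+ w. h w * indicator (f ` S) w \<partial>lborel)
       = (\<integral>\<^sup>+ z. h (f z) * ennreal ((norm (deriv f z))\<^sup>2) * indicator S z \<partial>lborel)"
proof -
  define M where "M = density lborel (\<lambda>z. ennreal ((norm (deriv f z))\<^sup>2) * indicator S z)"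
  \<comment> \<open>Extension by 0 gives a Borel map on the whole plane that can be pushed forward;
    the density of \<open>M\<close> vanishes where it differs from \<open>f\<close>.\<close>
  define f0 where "f0 = (\<lambda>z. if z \<in> S then f z else 0)"
  have oS: "open (f ` S)"
    using open_mapping_thm3[OF f S inj] .
  have [measurable]: "S \<in> sets borel" "f ` S \<in> sets borel"
    using S oS by auto
  have [measurable]: "f0 \<in> borel_measurable borel"
    unfolding f0_def
    by (intro borel_measurable_continuous_on_if holomorphic_on_imp_continuous_on f) auto
  have "(\<lambda>z. if z \<in> S then deriv f z else 0) \<in> borel_measurable borel"
    by (intro borel_measurable_continuous_on_if holomorphic_on_imp_continuous_on holomorphic_deriv f S) auto
  then have "(\<lambda>z. ennreal ((norm (if z \<in> S then deriv f z else 0))\<^sup>2)) \<in> borel_measurable borel"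
    by measurable
  then have dm [measurable]: "(\<lambda>z. ennreal ((norm (deriv f z))\<^sup>2) * indicator S z) \<in> borel_measurable borel"
    by (rule back_subst[of "\<lambda>u. u \<in> borel_measurable borel"]) (auto simp: fun_eq_iff)
  have dm': "(\<lambda>z. ennreal ((norm (deriv f z))\<^sup>2) * indicator S z) \<in> borel_measurable lborel"
    using dm by simp
  have hf0: "(\<lambda>z. h (if z \<in> S then f z else 0)) \<in> borel_measurable borel"
    using measurable_compose[OF \<open>f0 \<in> borel_measurable borel\<close> h] by (simp add: f0_def)
  have eq: "density lborel (indicator (f ` S)) = distr M borel f0"
  proof (rule measure_eqI)
    fix B assume "B \<in> sets (density lborel (indicator (f ` S)))"
    then have B [measurable]: "B \<in> sets borel" by simp
    define E where "E = S \<inter> f0 -` B"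
    have E: "E \<in> sets borel" "E \<subseteq> S"
      using measurable_sets_borel[OF \<open>f0 \<in> borel_measurable borel\<close> B] by (auto simp: E_def)
    have fE: "f ` E = B \<inter> f ` S"
      by (auto simp: E_def f0_def)
    have "emeasure (density lborel (indicator (f ` S))) B = emeasure lborel (f ` E)"
      unfolding fE by (simp add: emeasure_density Int_commute flip: indicator_inter_arith)
    also have "\<dots> = (\<integral>\<^sup>+ z. ennreal ((norm (deriv f z))\<^sup>2) * indicator E z \<partial>lborel)"
      using emeasure_holomorphic_image(2)[OF S f inj E] .
    also have "\<dots> = (\<integral>\<^sup>+ z. (ennreal ((norm (deriv f z))\<^sup>2) * indicator S z) * indicator (f0 -` B) z \<partial>lborel)"
      by (intro nn_integral_cong) (auto simp: E_def indicator_def)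
    also have "\<dots> = emeasure M (f0 -` B)"
      unfolding M_def using measurable_sets_borel[OF \<open>f0 \<in> borel_measurable borel\<close> B]
      by (subst emeasure_density) auto
    also have "\<dots> = emeasure (distr M borel f0) B"
      by (subst emeasure_distr) (auto simp: M_def)
    finally show "emeasure (density lborel (indicator (f ` S))) B = emeasure (distr M borel f0) B" .
  qed simp
  have "(\<integral>\<^sup>+ w. h w * indicator (f ` S) w \<partial>lborel) = (\<integral>\<^sup>+ w. h w \<partial>density lborel (indicator (f ` S)))"
    by (subst nn_integral_density) (auto simp: mult.commute)
  also have "\<dots> = (\<integral>\<^sup>+ z. h (f0 z) \<partial>M)"
    unfolding eq by (subst nn_integral_distr) (auto simp: M_def)
  also have "\<dots> = (\<integral>\<^sup>+ z. h (f z) * ennreal ((norm (deriv f z))\<^sup>2) * indicator S z \<partial>lborel)"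
    unfolding M_def
    using hf0 by (subst nn_integral_density[OF dm']) (auto intro!: nn_integral_cong simp: f0_def indicator_def mult.commute[of _ "h _"])
  finally show ?thesis .
qed

section \<open>Lengths of paths\<close>

lemma valid_path_vector_derivative:
  assumes "valid_path g"
  obtains S where "finite S"
    "\<And>t. t \<in> {0..1} - S \<Longrightarrow> (g has_vector_derivative vector_derivative g (at t)) (at t)"
    "continuous_on ({0..1} - S) (\<lambda>t. vector_derivative g (at t))"
proof -
  obtain S where S: "finite S" "g C1_differentiable_on ({0..1} - S)"
    using assms by (auto simp: valid_path_def piecewise_C1_differentiable_on_def)
  then have "(\<forall>t\<in>{0..1} - S. g differentiable at t) \<and>
      continuous_on ({0..1} - S) (\<lambda>t. vector_derivative g (at t))"
    by (simp add: C1_differentiable_on_eq)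
  then show ?thesis
    using S(1) by (intro that[of S]) (auto simp: vector_derivative_works)
qed

lemma rho_length_restrict:
  assumes "finite S"
  shows "rho_length \<rho> g =
    (\<integral>\<^sup>+ t. \<rho> (g t) * ennreal (norm (vector_derivative g (at t))) * indicator ({0<..<1} - S) t \<partial>lborel)"
  unfolding rho_length_def
proof (rule nn_integral_cong_AE)
  have "AE t in lborel. t \<notin> insert 0 (insert 1 S)"
    by (intro AE_not_in finite_imp_null_set_lborel) (use assms in auto)
  then show "AE t in lborel. \<rho> (g t) * ennreal (norm (vector_derivative g (at t))) * indicator {0..1} t =
      \<rho> (g t) * ennreal (norm (vector_derivative g (at t))) * indicator ({0<..<1} - S) t"
    by eventually_elim (auto simp: indicator_def)
qed

lemma rho_length_integrand_measurable:
  assumes \<rho> [measurable]: "\<rho> \<in> borel_measurable borel" and "open U"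
    and g: "continuous_on U g" "continuous_on U (\<lambda>t. vector_derivative g (at t))"
  shows "(\<lambda>t. \<rho> (g t) * ennreal (norm (vector_derivative g (at t))) * indicator U t) \<in> borel_measurable borel"
proof -
  have [measurable]: "U \<in> sets borel" using \<open>open U\<close> by simp
  have [measurable]: "(\<lambda>t. if t \<in> U then g t else 0) \<in> borel_measurable borel"
    "(\<lambda>t. if t \<in> U then vector_derivative g (at t) else 0) \<in> borel_measurable borel"
    using g by (auto intro!: borel_measurable_continuous_on_if)
  have "(\<lambda>t. \<rho> (if t \<in> U then g t else 0) *
      ennreal (norm (if t \<in> U then vector_derivative g (at t) else 0)) * indicator U t) \<in> borel_measurable borel"
    by measurable
  then show ?thesis
    by (rule back_subst[of "\<lambda>f. f \<in> borel_measurable borel"]) (auto simp: fun_eq_iff indicator_def)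
qed

lemma rho_length_reversepath:
  assumes "valid_path g" and \<rho>: "\<rho> \<in> borel_measurable borel"
  shows "rho_length \<rho> (reversepath g) = rho_length \<rho> g"
proof -
  obtain S where S: "finite S"
    "\<And>t. t \<in> {0..1} - S \<Longrightarrow> (g has_vector_derivative vector_derivative g (at t)) (at t)"
    "continuous_on ({0..1} - S) (\<lambda>t. vector_derivative g (at t))"
    using valid_path_vector_derivative[OF assms(1)] by blast
  define U where "U = {0<..<1} - S"
  have U: "open U" "U \<subseteq> {0..1} - S"
    using S(1) by (auto simp: U_def finite_imp_closed open_Diff)
  have gc: "continuous_on U g" "continuous_on U (\<lambda>t. vector_derivative g (at t))"
  proof -
    have "continuous_on {0..1} g"
      using assms(1) valid_path_imp_path path_def by blast
    then show "continuous_on U g"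
      using U(2) by (meson Diff_subset continuous_on_subset subset_trans)
  qed (use continuous_on_subset[OF S(3) U(2)] in auto)
  let ?f = "\<lambda>t. \<rho> (g t) * ennreal (norm (vector_derivative g (at t))) * indicator U t"
  have fm: "?f \<in> borel_measurable borel"
    by (rule rho_length_integrand_measurable[OF \<rho> U(1) gc])
  have der: "vector_derivative (reversepath g) (at t) = - vector_derivative g (at (1 - t))" if "1 - t \<in> U" for t
  proof -
    have "(g has_vector_derivative vector_derivative g (at (1 - t))) (at (1 - t))"
      using that U(2) S(2) by blast
    then have "((g \<circ> (\<lambda>t. 1 - t)) has_vector_derivative (-1) *\<^sub>R vector_derivative g (at (1 - t))) (at t)"
      by (intro vector_diff_chain_at) (auto intro!: derivative_eq_intros)
    then show ?thesis
      by (auto simp: reversepath_def o_def intro!: vector_derivative_at)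
  qed
  have "rho_length \<rho> (reversepath g) = (\<integral>\<^sup>+ t. \<rho> (reversepath g t) *
      ennreal (norm (vector_derivative (reversepath g) (at t))) * indicator ({0<..<1} - (\<lambda>t. 1 - t) ` S) t \<partial>lborel)"
    by (rule rho_length_restrict) (use S(1) in auto)
  also have "\<dots> = (\<integral>\<^sup>+ t. ?f (1 + (-1) * t) \<partial>lborel)"
  proof (intro nn_integral_cong)
    fix t :: real
    have "t \<in> {0<..<1} - (\<lambda>t. 1 - t) ` S \<longleftrightarrow> 1 - t \<in> U"
      by (auto simp: U_def image_iff)
    then show "\<rho> (reversepath g t) * ennreal (norm (vector_derivative (reversepath g) (at t)))
        * indicator ({0<..<1} - (\<lambda>t. 1 - t) ` S) t = ?f (1 + (-1) * t)"
      using der[of t] by (auto simp: reversepath_def indicator_def)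
  qed
  also have "\<dots> = (\<integral>\<^sup>+ t. ?f t \<partial>lborel)"
    using nn_integral_real_affine[OF fm, of "-1" 1] by simp
  also have "\<dots> = rho_length \<rho> g"
    unfolding U_def by (rule rho_length_restrict[symmetric, OF S(1)])
  finally show ?thesis .
qed

lemma joining_paths_reversepath:
  "g \<in> joining_paths A B \<Longrightarrow> reversepath g \<in> joining_paths B A"
  by (auto simp: joining_paths_def valid_path_imp_reverse) (simp add: reversepath_def)

text \<open>Path families are directed while the sum runs over unordered pairs; reversal of paths
  preserves lengths, hence admissible metrics.\<close>

lemma extremal_width_commute:
  "extremal_width (joining_paths A B) = extremal_width (joining_paths B A)"
proof -
  have "\<forall>g\<in>joining_paths B A. 1 \<le> rho_length \<rho> g"
    if "\<rho> \<in> borel_measurable borel" "\<forall>g\<in>joining_paths A B. 1 \<le> rho_length \<rho> g" for \<rho> and A B :: "complex set"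
    using that joining_paths_reversepath[of _ B A] rho_length_reversepath[OF _ that(1)]
    by (metis (mono_tags, lifting) joining_paths_def mem_Collect_eq)
  then have "{rho_area \<rho> | \<rho>. \<rho> \<in> borel_measurable borel \<and> (\<forall>g\<in>joining_paths A B. 1 \<le> rho_length \<rho> g)}
     = {rho_area \<rho> | \<rho>. \<rho> \<in> borel_measurable borel \<and> (\<forall>g\<in>joining_paths B A. 1 \<le> rho_length \<rho> g)}"
    by blast
  then show ?thesis
    unfolding extremal_width_def by simp
qed

lemma extremal_width_mono: "\<Gamma> \<subseteq> \<Gamma>' \<Longrightarrow> extremal_width \<Gamma> \<le> extremal_width \<Gamma>'"
  unfolding extremal_width_def by (intro Inf_superset_mono) auto

lemma joining_paths_mono: "B \<subseteq> B' \<Longrightarrow> joining_paths A B \<subseteq> joining_paths A B'"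
  by (auto simp: joining_paths_def)

text \<open>A replacement for the fundamental theorem of calculus that asks no derivative of
  \<open>u\<close>. With an error proportional to \<open>b - a\<close> the inequality is additive
  under concatenation of intervals, so by bisection it need only be checked on short intervals
  around each point.\<close>

lemma local_lipschitz_bound_integral:
  fixes u \<rho> :: "complex \<Rightarrow> real"
  assumes ab: "a \<le> b"
    and g: "\<And>t. t \<in> {a..b} \<Longrightarrow> (g has_vector_derivative g' t) (at t)"
    and k: "continuous_on {a..b} (\<lambda>t. \<rho> (g t) * norm (g' t))"
    and nn: "\<And>t. t \<in> {a..b} \<Longrightarrow> 0 \<le> \<rho> (g t)"
    and lip: "\<And>t \<epsilon>. t \<in> {a..b} \<Longrightarrow> \<epsilon> > 0 \<Longrightarrow>
       \<forall>\<^sub>F w in nhds (g t). \<bar>u w - u (g t)\<bar> \<le> (\<rho> (g t) + \<epsilon>) * norm (w - g t)"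
  shows "\<bar>u (g b) - u (g a)\<bar> \<le> integral {a..b} (\<lambda>t. \<rho> (g t) * norm (g' t))"
proof (rule field_le_epsilon)
  fix e :: real assume "0 < e"
  define \<epsilon> where "\<epsilon> = e / (b - a + 1)"
  have \<epsilon>: "0 < \<epsilon>" "\<epsilon> * (b - a) \<le> e"
    using \<open>0 < e\<close> ab by (auto simp: \<epsilon>_def field_simps)
  define K where "K = (\<lambda>t. \<rho> (g t) * norm (g' t))"
  have kint: "K integrable_on {x..y}" if "a \<le> x" "y \<le> b" for x y
    using k that unfolding K_def
    by (intro integrable_continuous_interval) (auto elim: continuous_on_subset)
  \<comment> \<open>Fixed copies of the ends: the bisection argument varies \<open>a\<close> and
    \<open>b\<close>, but the hypotheses hold only inside the original interval.\<close>
  define A where "A = a"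
  define B where "B = b"
  have "A \<le> a \<and> b \<le> B \<longrightarrow> \<bar>u (g b) - u (g a)\<bar> \<le> integral {a..b} K + \<epsilon> * (b - a)"
    using ab
  proof (induction a b rule: Bolzano)
    case (trans x y z)
    show ?case
    proof
      assume xz: "A \<le> x \<and> z \<le> B"
      have "integral {x..y} K + integral {y..z} K = integral {x..z} K"
        using xz trans unfolding A_def B_def by (intro Henstock_Kurzweil_Integration.integral_combine kint) auto
      then show "\<bar>u (g z) - u (g x)\<bar> \<le> integral {x..z} K + \<epsilon> * (z - x)"
        using trans xz by (auto simp: algebra_simps)
    qed
  next
    case (local x)
    then have x: "x \<in> {a..b}" by auto
    define R where "R = \<rho> (g x)"
    define N where "N = norm (g' x)"
    have RN: "0 \<le> R" "0 \<le> N" using nn[OF x] by (auto simp: R_def N_def)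
    \<comment> \<open>Chosen so that \<open>(R + \<eta>) * (N + \<eta>)\<close>, which is at most
      \<open>R * N + \<eta> * (R + N + 1)\<close> for \<open>\<eta> <= 1\<close>, exceeds
      \<open>R * N\<close> by no more than \<open>\<epsilon> / 2\<close>. The other half of
      \<open>\<epsilon>\<close> pays for the oscillation of \<open>K\<close>.\<close>
    define \<eta> where "\<eta> = min 1 (\<epsilon> / 2 / (R + N + 1))"
    have \<eta>: "0 < \<eta>" "\<eta> \<le> 1" using RN \<epsilon> by (auto simp: \<eta>_def)
    have "\<eta> * (R + N + 1) \<le> \<epsilon> / 2 / (R + N + 1) * (R + N + 1)"
      using RN by (intro mult_right_mono) (auto simp: \<eta>_def)
    moreover have "R + N + 1 \<noteq> 0" using RN by linarith
    ultimately have "\<eta> * (R + N + 1) \<le> \<epsilon> / 2"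
      using nonzero_eq_divide_eq[of "R + N + 1" "\<epsilon> / 2 / (R + N + 1)" "\<epsilon> / 2"] by linarith
    moreover have "\<eta> * \<eta> \<le> \<eta>" using \<eta> by (simp add: mult_left_le)
    ultimately have prod: "(R + \<eta>) * (N + \<eta>) \<le> K x + \<epsilon> / 2"
      by (simp add: K_def R_def N_def algebra_simps)
    have "\<forall>\<^sub>F y in at x. norm (g y - g x - (y - x) *\<^sub>R g' x) \<le> \<eta> * norm (y - x)"
      using g[OF x] \<open>0 < \<eta>\<close> unfolding has_vector_derivative_def has_derivative_within_alt2 by auto
    then have "\<forall>\<^sub>F y in at x. norm (g y - g x) \<le> (N + \<eta>) * \<bar>y - x\<bar>"
    proof eventually_elim
      case (elim y)
      have "norm (g y - g x) \<le> norm (g y - g x - (y - x) *\<^sub>R g' x) + norm ((y - x) *\<^sub>R g' x)"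
        by (metis diff_add_cancel norm_triangle_ineq)
      moreover have "norm ((y - x) *\<^sub>R g' x) = N * \<bar>y - x\<bar>" by (simp add: N_def mult.commute)
      ultimately show ?case using elim by (simp only: distrib_right real_norm_def)
    qed
    then have ev1: "\<forall>\<^sub>F y in nhds x. norm (g y - g x) \<le> (N + \<eta>) * \<bar>y - x\<bar>"
      by (simp add: eventually_nhds_conv_at)
    have "continuous (at x) g"
      using g[OF x] has_vector_derivative_continuous by blast
    then have "filterlim g (nhds (g x)) (nhds x)"
      by (simp add: continuous_at tendsto_nhds_iff)
    then have ev2: "\<forall>\<^sub>F y in nhds x. \<bar>u (g y) - u (g x)\<bar> \<le> (R + \<eta>) * norm (g y - g x)"
      using lip[OF x \<open>0 < \<eta>\<close>] by (auto simp: R_def dest: eventually_compose_filterlim)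
    have ev3: "\<forall>\<^sub>F y in nhds x. \<bar>u (g y) - u (g x)\<bar> \<le> (K x + \<epsilon> / 2) * \<bar>y - x\<bar>"
      using ev1 ev2
    proof eventually_elim
      case (elim y)
      have "(R + \<eta>) * norm (g y - g x) \<le> (R + \<eta>) * ((N + \<eta>) * \<bar>y - x\<bar>)"
        using elim(1) RN \<eta> by (intro mult_left_mono) auto
      also have "\<dots> \<le> (K x + \<epsilon> / 2) * \<bar>y - x\<bar>"
        using prod mult_right_mono[OF prod, of "\<bar>y - x\<bar>"] by (simp add: mult.assoc)
      finally show ?case using elim(2) by linarith
    qed
    then obtain d1 where d1: "0 < d1" "\<And>y. dist y x < d1 \<Longrightarrow> \<bar>u (g y) - u (g x)\<bar> \<le> (K x + \<epsilon> / 2) * \<bar>y - x\<bar>"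
      unfolding eventually_nhds_metric by blast
    obtain d2 where d2: "0 < d2" "\<And>y. y \<in> {a..b} \<Longrightarrow> dist y x < d2 \<Longrightarrow> dist (K y) (K x) < \<epsilon> / 2"
      using k x \<epsilon>(1) unfolding continuous_on_iff K_def by (meson half_gt_zero)
    show ?case
    proof (intro exI[of _ "min d1 d2"] conjI allI impI)
      show "0 < min d1 d2" using d1 d2 by simp
      fix y z assume yz: "y \<le> x \<and> x \<le> z \<and> z - y < min d1 d2" and in_AB: "A \<le> y \<and> z \<le> B"
      then have in_ab: "a \<le> y \<and> z \<le> b" by (simp add: A_def B_def)
      have "\<bar>u (g y) - u (g x)\<bar> \<le> (K x + \<epsilon> / 2) * (x - y)" "\<bar>u (g z) - u (g x)\<bar> \<le> (K x + \<epsilon> / 2) * (z - x)"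
        using d1(2)[of y] d1(2)[of z] yz by (auto simp: dist_real_def)
      then have "\<bar>u (g z) - u (g y)\<bar> \<le> (K x + \<epsilon> / 2) * (x - y) + (K x + \<epsilon> / 2) * (z - x)"
        by linarith
      then have "\<bar>u (g z) - u (g y)\<bar> \<le> (K x + \<epsilon> / 2) * (z - y)"
        by (simp flip: distrib_left)
      moreover have "(K x - \<epsilon> / 2) * (z - y) \<le> integral {y..z} K"
      proof -
        have "integral {y..z} (\<lambda>_. K x - \<epsilon> / 2) \<le> integral {y..z} K"
        proof (rule integral_le)
          fix t assume t: "t \<in> {y..z}"
          have "dist (K t) (K x) < \<epsilon> / 2"
            using t yz in_ab by (intro d2) (auto simp: dist_real_def)
          then show "K x - \<epsilon> / 2 \<le> K t" unfolding dist_real_def by linarith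
        qed (use in_ab kint in auto)
        then show ?thesis using yz by (simp add: mult.commute)
      qed
      moreover have "(K x + \<epsilon> / 2) * (z - y) = (K x - \<epsilon> / 2) * (z - y) + \<epsilon> * (z - y)"
        by (simp add: algebra_simps)
      ultimately show "\<bar>u (g z) - u (g y)\<bar> \<le> integral {y..z} K + \<epsilon> * (z - y)"
        by linarith
    qed
  qed
  then show "\<bar>u (g b) - u (g a)\<bar> \<le> integral {a..b} (\<lambda>t. \<rho> (g t) * norm (g' t)) + e"
    using \<epsilon> by (simp add: K_def A_def B_def)
qed

text \<open>This turns a potential into a lower bound for lengths. The Lipschitz estimate is
  available only at interior times where the path is differentiable; continuity of \<open>u\<close>
  on the whole plane bridges the finitely many other times, including both ends on the boundary of
  \<open>V\<close>.\<close>

lemma rho_length_ge_local_lipschitz: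
  fixes u \<rho> :: "complex \<Rightarrow> real"
  assumes g: "valid_path g" and gV: "\<And>t. t \<in> {0<..<1} \<Longrightarrow> g t \<in> V" and V: "open V"
    and u: "continuous_on UNIV u" and \<rho>: "continuous_on V \<rho>" "\<And>z. z \<in> V \<Longrightarrow> 0 \<le> \<rho> z"
    and lip: "\<And>z \<epsilon>. z \<in> V \<Longrightarrow> \<epsilon> > 0 \<Longrightarrow> \<forall>\<^sub>F w in nhds z. \<bar>u w - u z\<bar> \<le> (\<rho> z + \<epsilon>) * norm (w - z)"
  shows "ennreal \<bar>u (g 1) - u (g 0)\<bar> \<le> rho_length (\<lambda>z. ennreal (\<rho> z) * indicator V z) g"
proof -
  obtain S where S: "finite S"
    "\<And>t. t \<in> {0..1} - S \<Longrightarrow> (g has_vector_derivative vector_derivative g (at t)) (at t)"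
    "continuous_on ({0..1} - S) (\<lambda>t. vector_derivative g (at t))"
    using valid_path_vector_derivative[OF g] by blast
  define U where "U = {0<..<1} - S"
  have U: "open U" "U \<subseteq> {0..1} - S" "\<And>t. t \<in> U \<Longrightarrow> g t \<in> V"
    using S(1) gV by (auto simp: U_def finite_imp_closed open_Diff)
  have g01: "continuous_on {0..1} g"
    using g valid_path_imp_path path_def by blast
  have gc: "continuous_on U g" "continuous_on U (\<lambda>t. vector_derivative g (at t))"
    using continuous_on_subset[OF S(3) U(2)] continuous_on_subset[OF g01] U(2) by auto
  define K where "K = (\<lambda>t. \<rho> (g t) * norm (vector_derivative g (at t)))"
  have Kc: "continuous_on U K"
    unfolding K_def using U(3)
    by (intro continuous_intros gc continuous_on_compose2[OF \<rho>(1) gc(1)]) auto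
  define H where "H = (\<lambda>t. u (g t))"
  have Hc: "continuous_on {0..1} H"
    unfolding H_def by (intro continuous_on_compose2[OF u g01]) auto
  define N where "N = (\<lambda>a b. \<integral>\<^sup>+ t. ennreal (indicator U t * K t) * indicator {a<..<b} t \<partial>lborel)"
  have [measurable]: "(\<lambda>t. indicator U t * K t) \<in> borel_measurable borel"
    using borel_measurable_continuous_on_indicator[OF _ Kc] U(1) by simp
  have inner: "ennreal \<bar>H b - H a\<bar> \<le> N a b" if ab: "a \<le> b" "{a..b} \<subseteq> U" for a b
  proof -
    have Kab: "continuous_on {a..b} K" using Kc ab continuous_on_subset by blast
    have "\<bar>H b - H a\<bar> \<le> integral {a..b} K"
      unfolding H_def K_def
    proof (intro local_lipschitz_bound_integral)
      show "(g has_vector_derivative vector_derivative g (at t)) (at t)" if "t \<in> {a..b}" for t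
        using that ab(2) U(2) S(2) by blast
    qed (use ab Kab U(3) lip \<rho>(2) in \<open>auto simp: K_def\<close>)
    moreover have "ennreal (integral {a..b} K) = (\<integral>\<^sup>+ t. ennreal (K t) * indicator {a..b} t \<partial>lborel)"
    proof -
      have "(K has_integral integral {a..b} K) {a..b}"
        using Kab integrable_continuous_interval by blast
      then have 1: "((\<lambda>t. indicator {a..b} t * (indicator U t * K t)) has_integral integral {a..b} K) UNIV"
        by (subst (asm) has_integral_restrict_UNIV[symmetric])
           (erule has_integral_eq[rotated], use ab in \<open>auto simp: indicator_def\<close>)
      have "(\<integral>\<^sup>+ t. ennreal (indicator {a..b} t * (indicator U t * K t)) \<partial>lborel) = ennreal (integral {a..b} K)"
      proof (rule nn_integral_has_integral_lborel[OF _ _ 1])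
        show "0 \<le> indicator {a..b} t * (indicator U t * K t)" for t
          using U \<rho>(2) by (auto simp: K_def indicator_def)
      qed measurable
      moreover have "(\<integral>\<^sup>+ t. ennreal (indicator {a..b} t * (indicator U t * K t)) \<partial>lborel) =
          (\<integral>\<^sup>+ t. ennreal (K t) * indicator {a..b} t \<partial>lborel)"
        using ab by (intro nn_integral_cong) (auto simp: indicator_def)
      ultimately show ?thesis by simp
    qed
    moreover have "(\<integral>\<^sup>+ t. ennreal (K t) * indicator {a..b} t \<partial>lborel) = N a b"
      unfolding N_def
    proof (rule nn_integral_cong_AE)
      have "AE t in lborel. t \<notin> {a, b}"
        by (intro AE_not_in finite_imp_null_set_lborel) auto
      then show "AE t in lborel. ennreal (K t) * indicator {a..b} t =
          ennreal (indicator U t * K t) * indicator {a<..<b} t"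
        by eventually_elim (use ab in \<open>auto simp: indicator_def subset_iff\<close>)
    qed
    ultimately show ?thesis by (metis ennreal_leI)
  qed
  have N_mono: "N a b \<le> N a' b'" if "a' \<le> a" "b \<le> b'" for a b a' b'
    unfolding N_def using that by (intro nn_integral_mono) (auto simp: indicator_def)
  have N_add: "N a x + N x b \<le> N a b" if "a \<le> x" "x \<le> b" for a x b
  proof -
    have "N a x + N x b = (\<integral>\<^sup>+ t. ennreal (indicator U t * K t) * indicator {a<..<x} t +
        ennreal (indicator U t * K t) * indicator {x<..<b} t \<partial>lborel)"
      unfolding N_def by (subst nn_integral_add) auto
    also have "\<dots> \<le> N a b"
      unfolding N_def using that by (intro nn_integral_mono) (auto simp: indicator_def)
    finally show ?thesis .
  qed
  \<comment> \<open>Induction on a finite set containing the exceptional times inside the open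
    interval: splitting at one of them removes it from both halves.\<close>
  have "\<forall>a b. 0 \<le> a \<longrightarrow> a \<le> b \<longrightarrow> b \<le> 1 \<longrightarrow> {a<..<b} \<inter> S \<subseteq> T \<longrightarrow> ennreal \<bar>H b - H a\<bar> \<le> N a b" if "finite T" for T
    using that
  proof (induction T)
    case empty
    show ?case
    proof (intro allI impI)
      fix a b :: real assume ab: "0 \<le> a" "a \<le> b" "b \<le> 1" "{a<..<b} \<inter> S \<subseteq> {}"
      show "ennreal \<bar>H b - H a\<bar> \<le> N a b"
      proof (cases "a = b")
        case False
        \<comment> \<open>Shrinking by \<open>s n\<close> at both ends stays away from the possibly
          bad times \<open>a\<close> and \<open>b\<close>; the offset 3 keeps the shrunken interval
          nonempty from \<open>n = 0\<close> on.\<close>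
        define s where "s = (\<lambda>n. (b - a) / (real n + 3))"
        have s: "s \<longlonglongrightarrow> 0"
          unfolding s_def by real_asymp
        have s_pos: "0 < s n" "s n \<le> (b - a) / 3" for n
          using ab False divide_left_mono[of 3 "real n + 3" "b - a"] by (auto simp: s_def)
        have s01: "a + s n \<in> {0..1}" "b - s n \<in> {0..1}" for n
          using s_pos[of n] ab by auto
        have "(\<lambda>n. a + s n) \<longlonglongrightarrow> a" "(\<lambda>n. b - s n) \<longlonglongrightarrow> b"
          using tendsto_add[OF tendsto_const s, of a] tendsto_diff[OF tendsto_const s, of b] by auto
        then have "(\<lambda>n. H (a + s n)) \<longlonglongrightarrow> H a" "(\<lambda>n. H (b - s n)) \<longlonglongrightarrow> H b"
          using ab s01 by (auto intro!: continuous_on_tendsto_compose[OF Hc])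
        then have lim: "(\<lambda>n. ennreal \<bar>H (b - s n) - H (a + s n)\<bar>) \<longlonglongrightarrow> ennreal \<bar>H b - H a\<bar>"
          by (intro tendsto_ennrealI tendsto_rabs tendsto_diff)
        moreover have "ennreal \<bar>H (b - s n) - H (a + s n)\<bar> \<le> N a b" for n
        proof -
          have "{a + s n..b - s n} \<subseteq> U"
            using ab s_pos[of n] by (auto simp: U_def disjoint_iff)
          then have "ennreal \<bar>H (b - s n) - H (a + s n)\<bar> \<le> N (a + s n) (b - s n)"
            using s_pos[of n] ab by (intro inner) auto
          also have "\<dots> \<le> N a b" using s_pos[of n] by (intro N_mono) auto
          finally show ?thesis .
        qed
        ultimately show ?thesis
          by (intro LIMSEQ_le_const2[OF lim]) auto
      qed auto
    qed
  next
    case (insert x T)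
    show ?case
    proof (intro allI impI)
      fix a b :: real assume ab: "0 \<le> a" "a \<le> b" "b \<le> 1" "{a<..<b} \<inter> S \<subseteq> insert x T"
      show "ennreal \<bar>H b - H a\<bar> \<le> N a b"
      proof (cases "x \<in> {a<..<b}")
        case True
        have "ennreal \<bar>H x - H a\<bar> \<le> N a x" "ennreal \<bar>H b - H x\<bar> \<le> N x b"
        proof -
          have "{a<..<x} \<inter> S \<subseteq> T" "{x<..<b} \<inter> S \<subseteq> T"
          proof -
            have "{a<..<x} \<inter> S \<subseteq> {a<..<b} \<inter> S - {x}" "{x<..<b} \<inter> S \<subseteq> {a<..<b} \<inter> S - {x}"
              using True by auto
            then show "{a<..<x} \<inter> S \<subseteq> T" "{x<..<b} \<inter> S \<subseteq> T"
              using ab(4) by blast+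
          qed
          then show "ennreal \<bar>H x - H a\<bar> \<le> N a x" "ennreal \<bar>H b - H x\<bar> \<le> N x b"
            using True ab insert.IH by auto
        qed
        then have "ennreal \<bar>H x - H a\<bar> + ennreal \<bar>H b - H x\<bar> \<le> N a x + N x b"
          by (rule add_mono)
        also have "\<dots> \<le> N a b" using True by (intro N_add) auto
        finally have "ennreal (\<bar>H x - H a\<bar> + \<bar>H b - H x\<bar>) \<le> N a b" by simp
        moreover have "ennreal \<bar>H b - H a\<bar> \<le> ennreal (\<bar>H x - H a\<bar> + \<bar>H b - H x\<bar>)"
          by (intro ennreal_leI) auto
        ultimately show ?thesis by (rule order_trans[rotated])
      next
        case False
        then have "{a<..<b} \<inter> S \<subseteq> T" using ab(4) by blast
        then show ?thesis using ab insert.IH by auto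
      qed
    qed
  qed
  from this[OF S(1)] have "ennreal \<bar>H 1 - H 0\<bar> \<le> N 0 1" by auto
  also have "N 0 1 = rho_length (\<lambda>z. ennreal (\<rho> z) * indicator V z) g"
    unfolding N_def rho_length_restrict[OF S(1)] U_def[symmetric]
    by (intro nn_integral_cong) (use U(3) \<rho>(2) in \<open>auto simp: indicator_def K_def U_def ennreal_mult\<close>)
  finally show ?thesis by (simp add: H_def)
qed

section \<open>Two disjoint arcs\<close>

lemma cis_diff_cis: "cis s - cis t = 2 * \<i> * of_real (sin ((s - t) / 2)) * cis ((s + t) / 2)"
proof -
  have "sin ((t - s) / 2) = - sin ((s - t) / 2)"
    by (simp flip: sin_minus add: minus_divide_left)
  then show ?thesis
    by (simp add: complex_eq_iff cos_diff_cos sin_diff_sin)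
qed

lemma ex_cis_period:
  assumes "norm z = 1"
  obtains t where "\<alpha> \<le> t" "t < \<alpha> + 2 * pi" "z = cis t"
proof -
  define n where "n = \<lfloor>(Arg z - \<alpha>) / (2 * pi)\<rfloor>"
  define t where "t = Arg z - 2 * pi * n"
  have "of_int n \<le> (Arg z - \<alpha>) / (2 * pi)" "(Arg z - \<alpha>) / (2 * pi) < of_int n + 1"
    by (auto simp: n_def)
  then have "\<alpha> \<le> t" "t < \<alpha> + 2 * pi"
    by (auto simp: t_def field_simps)
  moreover have "z = cis t"
  proof -
    have "z = cis (Arg z)"
    proof -
      have "z \<noteq> 0" using assms by auto
      then have "cis (Arg z) = sgn z" by (rule cis_Arg)
      then show ?thesis using assms by (simp add: sgn_div_norm)
    qed
    also have "\<dots> = cis t * cis (2 * pi * n)"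
      unfolding cis_mult by (simp add: t_def)
    also have "cis (2 * pi * n) = 1"
      by (rule cis_multiple_2pi) auto
    finally show ?thesis by simp
  qed
  ultimately show ?thesis using that by blast
qed

locale arc_pair =
  fixes \<alpha> \<beta> \<gamma> \<delta> :: real
  assumes order: "\<alpha> < \<beta>" "\<beta> < \<gamma>" "\<gamma> < \<delta>" "\<delta> < \<alpha> + 2 * pi"
begin

text \<open>The boundary values of \<open>moeb\<close>, as a real function of the angle. On the
  circle cut at \<open>cis \<alpha>\<close> it increases, with its zero at \<beta>.\<close>

definition ratio :: "real \<Rightarrow> real" where
  "ratio t = sin ((t - \<beta>) / 2) / sin ((t - \<alpha>) / 2)"

definition half_angle :: real where "half_angle = (\<beta> - \<alpha>) / 2"

text \<open>Takes the disk to the upper half-plane, \<open>cis \<alpha>\<close> to infinity and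
  \<open>cis \<beta>\<close> to 0. The rotation by \<open>cis (- half_angle)\<close> puts the circle
  on the real line. The first arc becomes the half-line of nonpositive reals with infinity, the
  second the segment from \<open>ratio \<gamma>\<close> to \<open>ratio \<delta>\<close>.\<close>

definition moeb :: "complex \<Rightarrow> complex" where
  "moeb z = cis (- half_angle) * (z - cis \<beta>) / (z - cis \<alpha>)"

definition moeb_inv :: "complex \<Rightarrow> complex" where
  "moeb_inv w = (cis \<alpha> * w - cis (- half_angle) * cis \<beta>) / (w - cis (- half_angle))"

lemma sin_half_angle_pos: "0 < sin half_angle"
  using order by (intro sin_gt_zero) (auto simp: half_angle_def)

lemma cis_neq: "cis \<alpha> \<noteq> cis \<beta>"
proof
  assume "cis \<alpha> = cis \<beta>"
  then have "sin half_angle = 0"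
    using cis_diff_cis[of \<beta> \<alpha>] by (simp add: half_angle_def)
  then show False using sin_half_angle_pos by simp
qed

lemma sin_half_pos: "\<alpha> < t \<Longrightarrow> t < \<alpha> + 2 * pi \<Longrightarrow> 0 < sin ((t - \<alpha>) / 2)"
  by (intro sin_gt_zero) auto

lemma moeb_cis:
  assumes "\<alpha> < t" "t < \<alpha> + 2 * pi"
  shows "moeb (cis t) = of_real (ratio t)"
proof -
  have e: "cis (- half_angle) * cis ((t + \<beta>) / 2) = cis ((t + \<alpha>) / 2)"
    unfolding cis_mult half_angle_def by (rule arg_cong[of _ _ cis]) (simp add: field_simps)
  have "moeb (cis t) = of_real (sin ((t - \<beta>) / 2)) * (2 * \<i> * (cis (- half_angle) * cis ((t + \<beta>) / 2)))
      / (of_real (sin ((t - \<alpha>) / 2)) * (2 * \<i> * cis ((t + \<alpha>) / 2)))"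
    unfolding moeb_def cis_diff_cis by (simp only: mult_ac)
  also have "\<dots> = of_real (ratio t)"
    unfolding e ratio_def by simp
  finally show ?thesis .
qed

lemma ratio_diff:
  assumes "\<alpha> < s" "s < \<alpha> + 2 * pi" "\<alpha> < t" "t < \<alpha> + 2 * pi"
  shows "ratio t - ratio s = sin half_angle * sin ((t - s) / 2) / (sin ((s - \<alpha>) / 2) * sin ((t - \<alpha>) / 2))"
proof -
  define p where "p = (s - \<alpha>) / 2"
  define q where "q = (t - \<alpha>) / 2"
  have pos: "0 < sin p" "0 < sin q"
    using sin_half_pos assms by (auto simp: p_def q_def)
  have eqs: "(t - \<beta>) / 2 = q - half_angle" "(s - \<beta>) / 2 = p - half_angle" "(t - s) / 2 = q - p"
    by (auto simp: p_def q_def half_angle_def field_simps)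
  have id: "sin (q - half_angle) * sin p - sin (p - half_angle) * sin q = sin half_angle * sin (q - p)"
    by (simp add: sin_diff algebra_simps)
  have "ratio t - ratio s = (sin (q - half_angle) * sin p - sin (p - half_angle) * sin q) / (sin p * sin q)"
    using pos unfolding ratio_def eqs p_def[symmetric] q_def[symmetric] by (simp add: field_simps)
  then show ?thesis
    unfolding id eqs p_def[symmetric] q_def[symmetric] .
qed

lemma ratio_less:
  assumes "\<alpha> < s" "s < t" "t < \<alpha> + 2 * pi"
  shows "ratio s < ratio t"
proof -
  have "0 < sin ((t - s) / 2)" using assms by (intro sin_gt_zero) auto
  then have "0 < ratio t - ratio s"
    using assms sin_half_angle_pos sin_half_pos by (subst ratio_diff) auto
  then show ?thesis by simp
qed

lemma ratio_le_iff:
  assumes "\<alpha> < s" "s < \<alpha> + 2 * pi" "\<alpha> < t" "t < \<alpha> + 2 * pi"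
  shows "ratio s \<le> ratio t \<longleftrightarrow> s \<le> t"
proof (cases s t rule: linorder_cases)
  case less
  then show ?thesis using ratio_less[of s t] assms by simp
next
  case greater
  then show ?thesis using ratio_less[of t s] assms by simp
qed simp

lemma ratio_beta: "ratio \<beta> = 0"
  by (simp add: ratio_def)

lemma ratio_pos: "0 < ratio \<gamma>" "ratio \<gamma> < ratio \<delta>"
  using ratio_less[of \<beta> \<gamma>] ratio_less[of \<gamma> \<delta>] order by (auto simp: ratio_beta)

text \<open>A multiple of the Poisson kernel with pole \<open>cis \<alpha>\<close>. Its sign decides
  whether a point is inside, on or outside the circle, so the same formula later locates the values
  of \<open>moeb_inv\<close>.\<close>

lemma Im_moeb:
  assumes "z \<noteq> cis \<alpha>"
  shows "Im (moeb z) = sin half_angle * (1 - (norm z)\<^sup>2) / (norm (z - cis \<alpha>))\<^sup>2"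
proof -
  have "moeb z = cis (- half_angle) * (z - cis \<beta>) * cnj (z - cis \<alpha>) / of_real ((norm (z - cis \<alpha>))\<^sup>2)"
    unfolding moeb_def by (subst complex_div_cnj) simp
  then have 1: "Im (moeb z) = Im (cis (- half_angle) * (z - cis \<beta>) * cnj (z - cis \<alpha>)) / (norm (z - cis \<alpha>))\<^sup>2"
    by (simp only: Im_divide_of_real)
  define \<mu> where "\<mu> = (\<alpha> + \<beta>) / 2"
  have e1: "cis (- half_angle) * cis \<beta> = cis \<mu>"
    unfolding cis_mult half_angle_def \<mu>_def by (rule arg_cong[of _ _ cis]) (simp add: field_simps)
  have e2: "cis (- half_angle) * cnj (cis \<alpha>) = cnj (cis \<mu>)"
    unfolding cis_cnj cis_mult half_angle_def \<mu>_def by (rule arg_cong[of _ _ cis]) (simp add: field_simps)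
  have e3: "cis \<mu> * cnj (cis \<alpha>) = cis half_angle"
    unfolding cis_cnj cis_mult half_angle_def \<mu>_def by (rule arg_cong[of _ _ cis]) (simp add: field_simps)
  have "cis (- half_angle) * (z - cis \<beta>) * cnj (z - cis \<alpha>) =
      cis (- half_angle) * (z * cnj z) - ((cis (- half_angle) * cnj (cis \<alpha>)) * z + (cis (- half_angle) * cis \<beta>) * cnj z)
      + cis (- half_angle) * cis \<beta> * cnj (cis \<alpha>)"
    by (simp add: algebra_simps)
  also have "\<dots> = cis (- half_angle) * of_real ((norm z)\<^sup>2) - (cnj (cis \<mu>) * z + cis \<mu> * cnj z) + cis half_angle"
    unfolding e1 e2 e3 by (simp only: complex_norm_square)
  finally have "cis (- half_angle) * (z - cis \<beta>) * cnj (z - cis \<alpha>) =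
      cis (- half_angle) * of_real ((norm z)\<^sup>2) - (cnj (cis \<mu>) * z + cis \<mu> * cnj z) + cis half_angle" .
  then have "Im (cis (- half_angle) * (z - cis \<beta>) * cnj (z - cis \<alpha>)) = sin half_angle * (1 - (norm z)\<^sup>2)"
  proof -
    assume eq: "cis (- half_angle) * (z - cis \<beta>) * cnj (z - cis \<alpha>) =
      cis (- half_angle) * of_real ((norm z)\<^sup>2) - (cnj (cis \<mu>) * z + cis \<mu> * cnj z) + cis half_angle"
    have "Im (cnj (cis \<mu>) * z + cis \<mu> * cnj z) = 0"
      by simp
    moreover have "Im (cis (- half_angle) * of_real ((norm z)\<^sup>2)) = - sin half_angle * (norm z)\<^sup>2"
      by (simp del: of_real_power)
    ultimately have "Im (cis (- half_angle) * of_real ((norm z)\<^sup>2) - (cnj (cis \<mu>) * z + cis \<mu> * cnj z) + cis half_angle)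
        = sin half_angle * (1 - (norm z)\<^sup>2)"
      by (simp only: minus_complex.sel plus_complex.sel cis.sel) (simp add: algebra_simps)
    then show ?thesis unfolding eq .
  qed
  then show ?thesis using 1 by simp
qed

lemma moeb_upper: "norm z < 1 \<Longrightarrow> 0 < Im (moeb z)"
proof -
  assume z: "norm z < 1"
  then have ne: "z \<noteq> cis \<alpha>" by auto
  have "(norm z)\<^sup>2 < 1" using z by (simp add: power_less_one_iff abs_square_less_1)
  then show ?thesis
    using ne sin_half_angle_pos by (subst Im_moeb) auto
qed

text \<open>The pole \<open>cis (- half_angle)\<close> has imaginary part
  \<open>- sin half_angle\<close>. Hence \<open>moeb_inv\<close> is regular on an open half-plane
  that contains the closed upper one.\<close>

lemma moeb_inv_denom: "- sin half_angle < Im w \<Longrightarrow> w - cis (- half_angle) \<noteq> 0"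
  by auto

lemma moeb_inv_neq:
  assumes "- sin half_angle < Im w"
  shows "moeb_inv w \<noteq> cis \<alpha>"
proof
  assume "moeb_inv w = cis \<alpha>"
  then have "cis \<alpha> * w - cis (- half_angle) * cis \<beta> = cis \<alpha> * (w - cis (- half_angle))"
    using moeb_inv_denom[OF assms] by (simp add: moeb_inv_def divide_eq_eq)
  then have "cis (- half_angle) * cis \<beta> = cis (- half_angle) * cis \<alpha>"
    by (simp add: algebra_simps)
  then show False using cis_neq by simp
qed

lemma moeb_moeb_inv:
  assumes "- sin half_angle < Im w"
  shows "moeb (moeb_inv w) = w"
proof -
  define k where "k = cis (- half_angle)"
  have d: "w - k \<noteq> 0" using moeb_inv_denom[OF assms] by (simp add: k_def)
  have kab: "k * (cis \<alpha> - cis \<beta>) \<noteq> 0" using cis_neq by (simp add: k_def)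
  have diff: "moeb_inv w - p = (cis \<alpha> * w - k * cis \<beta> - p * (w - k)) / (w - k)" for p
    using d unfolding moeb_inv_def k_def[symmetric] diff_divide_distrib by simp
  have "moeb_inv w - cis \<alpha> = k * (cis \<alpha> - cis \<beta>) / (w - k)"
    unfolding diff by (rule arg_cong[of _ _ "\<lambda>x. x / (w - k)"]) (simp add: algebra_simps)
  moreover have "moeb_inv w - cis \<beta> = w * (cis \<alpha> - cis \<beta>) / (w - k)"
    unfolding diff by (rule arg_cong[of _ _ "\<lambda>x. x / (w - k)"]) (simp add: algebra_simps)
  ultimately have "moeb (moeb_inv w) = k * (w * (cis \<alpha> - cis \<beta>) / (w - k)) / (k * (cis \<alpha> - cis \<beta>) / (w - k))"
    unfolding moeb_def k_def[symmetric] by simp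
  also have "\<dots> = w" using d kab by simp
  finally show ?thesis .
qed

lemma moeb_inv_in_ball:
  assumes "0 < Im w"
  shows "norm (moeb_inv w) < 1"
proof -
  have w: "- sin half_angle < Im w" using assms sin_half_angle_pos by linarith
  have "0 < sin half_angle * (1 - (norm (moeb_inv w))\<^sup>2) / (norm (moeb_inv w - cis \<alpha>))\<^sup>2"
    using Im_moeb[OF moeb_inv_neq[OF w]] moeb_moeb_inv[OF w] assms by simp
  then have "(norm (moeb_inv w))\<^sup>2 < 1"
    using sin_half_angle_pos moeb_inv_neq[OF w] by (simp add: zero_less_divide_iff zero_less_mult_iff)
  then show ?thesis by (simp add: abs_square_less_1)
qed

lemma moeb_inv_of_real:
  obtains t where "\<alpha> < t" "t < \<alpha> + 2 * pi" "moeb_inv (of_real x) = cis t" "ratio t = x"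
proof -
  have w: "- sin half_angle < Im (of_real x)" using sin_half_angle_pos by simp
  have "sin half_angle * (1 - (norm (moeb_inv (of_real x)))\<^sup>2) / (norm (moeb_inv (of_real x) - cis \<alpha>))\<^sup>2 = 0"
    using Im_moeb[OF moeb_inv_neq[OF w]] moeb_moeb_inv[OF w] by simp
  then have "(norm (moeb_inv (of_real x)))\<^sup>2 = 1"
    using sin_half_angle_pos moeb_inv_neq[OF w] by simp
  then have "norm (moeb_inv (of_real x)) = 1" using power2_eq_iff_nonneg[of "norm (moeb_inv (of_real x))" 1] by simp
  then obtain t where t: "\<alpha> \<le> t" "t < \<alpha> + 2 * pi" "moeb_inv (of_real x) = cis t"
    using ex_cis_period[of _ \<alpha>] by metis
  then have "\<alpha> < t" using moeb_inv_neq[OF w] by (cases "t = \<alpha>") auto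
  moreover have "ratio t = x"
    using moeb_moeb_inv[OF w] moeb_cis[OF \<open>\<alpha> < t\<close> t(2)] t(3) by simp
  ultimately show ?thesis using t that by blast
qed

lemma moeb_inv_first_arc:
  assumes "x \<le> 0"
  shows "moeb_inv (of_real x) \<in> cis ` {\<alpha>..\<beta>}"
proof -
  obtain t where t: "\<alpha> < t" "t < \<alpha> + 2 * pi" "moeb_inv (of_real x) = cis t" "ratio t = x"
    using moeb_inv_of_real .
  then have "t \<le> \<beta>"
    using ratio_le_iff[of t \<beta>] order assms by (simp add: ratio_beta)
  then show ?thesis using t by auto
qed

lemma moeb_inv_second_arc:
  assumes "ratio \<gamma> \<le> x" "x \<le> ratio \<delta>"
  shows "moeb_inv (of_real x) \<in> cis ` {\<gamma>..\<delta>}"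
proof -
  obtain t where t: "\<alpha> < t" "t < \<alpha> + 2 * pi" "moeb_inv (of_real x) = cis t" "ratio t = x"
    using moeb_inv_of_real .
  then have "\<gamma> \<le> t" "t \<le> \<delta>"
    using ratio_le_iff[of t \<delta>, OF t(1,2)] ratio_le_iff[of \<gamma> t, OF _ _ t(1,2)] order assms t(4)
    by linarith+
  then show ?thesis using t by auto
qed

section \<open>The logarithmic strip\<close>

definition log_ratio :: real where "log_ratio = ln (ratio \<delta> / ratio \<gamma>) / pi"

lemma log_ratio_pos: "0 < log_ratio"
  using ratio_pos by (simp add: log_ratio_def)

lemma exp_log_ratio: "exp (pi * log_ratio) = ratio \<delta> / ratio \<gamma>"
  using ratio_pos by (simp add: log_ratio_def)

text \<open>\<open>strip\<close> maps the closed strip \<open>0 \<le> Im \<zeta> \<le> 1\<close> to the closed disk; its vertical lines are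
  the paths to which the length-area method is applied.\<close>

definition halfplane_of_strip :: "complex \<Rightarrow> complex" where
  "halfplane_of_strip \<zeta> = - of_real (ratio \<delta>) * exp (- (of_real pi * \<zeta>))"

definition strip :: "complex \<Rightarrow> complex" where
  "strip \<zeta> = moeb_inv (halfplane_of_strip \<zeta>)"

text \<open>Larger than the closed strip, so that \<open>strip\<close> is holomorphic around the
  endpoints of the vertical segments and composition gives valid paths up to the circle.\<close>

definition strip_domain :: "complex set" where
  "strip_domain = {\<zeta>. - sin half_angle < Im (halfplane_of_strip \<zeta>)}"

lemma Im_halfplane_of_strip:
  "Im (halfplane_of_strip \<zeta>) = ratio \<delta> * exp (- (pi * Re \<zeta>)) * sin (pi * Im \<zeta>)"
  by (simp add: halfplane_of_strip_def Im_exp)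

lemma halfplane_of_strip_holomorphic: "halfplane_of_strip holomorphic_on A"
  unfolding halfplane_of_strip_def by (intro holomorphic_intros)

lemma open_strip_domain: "open strip_domain"
proof -
  have "continuous_on UNIV halfplane_of_strip"
    by (intro holomorphic_on_imp_continuous_on halfplane_of_strip_holomorphic)
  then show ?thesis
    unfolding strip_domain_def by (intro open_Collect_less continuous_intros) auto
qed

lemma strip_holomorphic: "strip holomorphic_on strip_domain"
proof -
  have "moeb_inv holomorphic_on {w. - sin half_angle < Im w}"
    unfolding moeb_inv_def using moeb_inv_denom by (intro holomorphic_intros) auto
  then have "moeb_inv \<circ> halfplane_of_strip holomorphic_on strip_domain"
    by (intro holomorphic_on_compose_gen halfplane_of_strip_holomorphic) (auto simp: strip_domain_def)
  moreover have "strip = moeb_inv \<circ> halfplane_of_strip"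
    by (simp add: fun_eq_iff strip_def)
  ultimately show ?thesis by simp
qed

lemma closed_strip_subset: "0 \<le> Im \<zeta> \<Longrightarrow> Im \<zeta> \<le> 1 \<Longrightarrow> \<zeta> \<in> strip_domain"
proof -
  assume "0 \<le> Im \<zeta>" "Im \<zeta> \<le> 1"
  then have "0 \<le> sin (pi * Im \<zeta>)"
    by (intro sin_ge_zero) (auto simp: mult_le_cancel_left1)
  then have "0 \<le> Im (halfplane_of_strip \<zeta>)"
    using ratio_pos by (simp add: Im_halfplane_of_strip)
  then show ?thesis using sin_half_angle_pos by (simp add: strip_domain_def)
qed

lemma strip_in_ball: "0 < Im \<zeta> \<Longrightarrow> Im \<zeta> < 1 \<Longrightarrow> strip \<zeta> \<in> ball 0 1"
proof -
  assume "0 < Im \<zeta>" "Im \<zeta> < 1"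
  then have "0 < sin (pi * Im \<zeta>)"
    by (intro sin_gt_zero) auto
  then have "0 < Im (halfplane_of_strip \<zeta>)"
    using ratio_pos by (simp add: Im_halfplane_of_strip)
  then show ?thesis using moeb_inv_in_ball by (simp add: strip_def)
qed

definition rect :: "complex set" where
  "rect = {\<zeta>. 0 < Re \<zeta> \<and> Re \<zeta> < log_ratio \<and> 0 < Im \<zeta> \<and> Im \<zeta> < 1}"

lemma open_rect: "open rect"
  unfolding rect_def
  by (intro open_Collect_conj open_Collect_less continuous_intros)

lemma rect_subset: "rect \<subseteq> strip_domain"
  using closed_strip_subset by (auto simp: rect_def)

lemma inj_on_strip: "inj_on strip rect"
proof (rule inj_onI)
  fix z w assume zw: "z \<in> rect" "w \<in> rect" "strip z = strip w"
  then have "halfplane_of_strip z = halfplane_of_strip w"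
  proof -
    have "- sin half_angle < Im (halfplane_of_strip z)" "- sin half_angle < Im (halfplane_of_strip w)"
      using zw(1,2) rect_subset by (auto simp: strip_domain_def)
    then have "moeb (strip z) = halfplane_of_strip z" "moeb (strip w) = halfplane_of_strip w"
      by (simp_all add: strip_def moeb_moeb_inv)
    then show ?thesis using zw(3) by simp
  qed
  then have "exp (- (of_real pi * z)) = exp (- (of_real pi * w))"
    using ratio_pos by (simp add: halfplane_of_strip_def)
  moreover have "\<bar>Im (- (of_real pi * z)) - Im (- (of_real pi * w))\<bar> < 2 * pi"
  proof -
    have "\<bar>Im w - Im z\<bar> < 2" using zw by (auto simp: rect_def)
    then have "pi * \<bar>Im w - Im z\<bar> < pi * 2" by (intro mult_strict_left_mono) auto
    moreover have "\<bar>Im (- (of_real pi * z)) - Im (- (of_real pi * w))\<bar> = pi * \<bar>Im w - Im z\<bar>"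
      by (simp add: abs_mult flip: right_diff_distrib)
    ultimately show ?thesis by simp
  qed
  ultimately have "- (of_real pi * z) = - (of_real pi * w)"
    using exp_complex_eqI by blast
  then show "z = w" by simp
qed

end

section \<open>The lower bound for the width\<close>

lemma linepath_vertical: "linepath (of_real x) (of_real x + \<i>) t = Complex x t"
  by (simp add: linepath_def complex_eq_iff algebra_simps)

lemma ennreal_two_mult_le_square: "2 * a \<le> a\<^sup>2 + (1::ennreal)"
proof (cases a)
  case (real r)
  have "0 \<le> (r - 1)\<^sup>2" by simp
  then have "2 * r \<le> r\<^sup>2 + 1" by (simp add: power2_eq_square algebra_simps)
  then have "ennreal (2 * r) \<le> ennreal (r\<^sup>2 + 1)" by (rule ennreal_leI)
  then show ?thesis using real by (simp add: ennreal_mult ennreal_power)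
qed (simp add: top_power_ennreal)

text \<open>The Cauchy-Schwarz inequality on a unit interval, obtained from
  \<open>2 * f <= f\<^sup>2 + 1\<close>; this form needs no square roots and no case distinction for
  infinite integrals.\<close>

lemma length_area_fibre:
  fixes f :: "real \<Rightarrow> ennreal"
  assumes [measurable]: "(\<lambda>t. f t * indicator {0<..<1} t) \<in> borel_measurable borel"
    and "1 \<le> (\<integral>\<^sup>+ t. f t * indicator {0<..<1} t \<partial>lborel)"
  shows "1 \<le> (\<integral>\<^sup>+ t. (f t)\<^sup>2 * indicator {0<..<1} t \<partial>lborel)"
proof -
  have sq: "(f t)\<^sup>2 * indicator {0<..<1} t = (f t * indicator {0<..<1} t)\<^sup>2" for t
    by (simp add: indicator_def)
  have m [measurable]: "(\<lambda>t. (f t)\<^sup>2 * indicator {0<..<1} t) \<in> borel_measurable borel"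
    unfolding sq by measurable
  let ?X = "\<integral>\<^sup>+ t. (f t)\<^sup>2 * indicator {0<..<1} t \<partial>lborel"
  have "2 \<le> (\<integral>\<^sup>+ t. f t * indicator {0<..<1} t \<partial>lborel) + (\<integral>\<^sup>+ t. f t * indicator {0<..<1} t \<partial>lborel)"
    using add_mono[OF assms(2) assms(2)] by simp
  also have "\<dots> \<le> ?X + 1"
  proof -
    have "(\<integral>\<^sup>+ t. f t * indicator {0<..<1} t \<partial>lborel) + (\<integral>\<^sup>+ t. f t * indicator {0<..<1} t \<partial>lborel) \<le>
      (\<integral>\<^sup>+ t. f t * indicator {0<..<1} t + f t * indicator {0<..<1} t \<partial>lborel)"
      by (subst nn_integral_add) auto
    also have "\<dots> \<le> (\<integral>\<^sup>+ t. (f t)\<^sup>2 * indicator {0<..<1} t + indicator {0<..<1::real} t \<partial>lborel)"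
      using ennreal_two_mult_le_square by (intro nn_integral_mono) (auto simp: indicator_def mult_2)
    also have "\<dots> = ?X + 1"
      by (subst nn_integral_add) auto
    finally show ?thesis .
  qed
  finally have "1 + 1 \<le> 1 + ?X" by (simp only: one_add_one add.commute[of ?X 1])
  then show ?thesis by (simp only: ennreal_add_left_cancel_le) simp
qed

context arc_pair
begin

text \<open>In the half-plane picture this is the semicircle about 0 of radius
  \<open>ratio \<delta> * exp (- (pi * x))\<close>, running from the negative to the positive
  half-line. For \<open>x\<close> between 0 and \<open>log_ratio\<close> its right end lies between
  \<open>ratio \<gamma>\<close> and \<open>ratio \<delta>\<close>.\<close>

definition vline :: "real \<Rightarrow> real \<Rightarrow> complex" where
  "vline x = strip \<circ> linepath (of_real x) (of_real x + \<i>)"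

lemma vline_eq: "vline x t = strip (Complex x t)"
  by (simp add: vline_def linepath_vertical)

lemma vline_joining:
  assumes "0 < x" "x < log_ratio"
  shows "vline x \<in> joining_paths (cis ` {\<alpha>..\<beta>}) (cis ` {\<gamma>..\<delta>})"
proof -
  have "path_image (linepath (of_real x) (of_real x + \<i>)) \<subseteq> strip_domain"
    using closed_strip_subset by (auto simp: path_image_def linepath_vertical)
  then have vp: "valid_path (vline x)"
    unfolding vline_def
    by (intro valid_path_compose_holomorphic[OF valid_path_linepath strip_holomorphic open_strip_domain])
  have start: "vline x 0 \<in> cis ` {\<alpha>..\<beta>}"
  proof -
    have eq: "halfplane_of_strip (Complex x 0) = of_real (- ratio \<delta> * exp (- (pi * x)))"
      by (simp add: halfplane_of_strip_def complex_eq_iff Re_exp Im_exp)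
    moreover have "- ratio \<delta> * exp (- (pi * x)) \<le> 0" using ratio_pos by simp
    ultimately show ?thesis
      unfolding vline_eq strip_def eq by (intro moeb_inv_first_arc)
  qed
  have finish: "vline x 1 \<in> cis ` {\<gamma>..\<delta>}"
  proof -
    have eq: "halfplane_of_strip (Complex x 1) = of_real (ratio \<delta> * exp (- (pi * x)))"
      by (simp add: halfplane_of_strip_def complex_eq_iff Re_exp Im_exp)
    have "exp (pi * x) \<le> ratio \<delta> / ratio \<gamma>"
      unfolding exp_log_ratio[symmetric] using assms by simp
    then have "ratio \<gamma> * exp (pi * x) \<le> ratio \<delta>"
      using ratio_pos by (simp add: pos_le_divide_eq mult.commute)
    then have "ratio \<gamma> \<le> ratio \<delta> / exp (pi * x)"
      by (simp add: pos_le_divide_eq)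
    then have "ratio \<gamma> \<le> ratio \<delta> * exp (- (pi * x))"
      by (simp add: exp_minus divide_inverse)
    moreover have "ratio \<delta> * exp (- (pi * x)) \<le> ratio \<delta>"
      using ratio_pos assms by (simp add: mult_left_le)
    ultimately show ?thesis
      unfolding vline_eq strip_def eq by (rule moeb_inv_second_arc)
  qed
  show ?thesis
    using vp start finish strip_in_ball
    by (auto simp: joining_paths_def pathstart_def pathfinish_def vline_eq)
qed

lemma vector_derivative_vline:
  assumes "0 < t" "t < 1"
  shows "vector_derivative (vline x) (at t) = deriv strip (Complex x t) * \<i>"
proof -
  have "(strip has_field_derivative deriv strip (Complex x t)) (at (Complex x t))"
    using assms closed_strip_subset
    by (intro holomorphic_derivI[OF strip_holomorphic open_strip_domain]) auto
  then have d: "(strip has_field_derivative deriv strip (Complex x t))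
      (at (linepath (of_real x) (of_real x + \<i>) t))"
    by (simp add: linepath_vertical)
  have l: "(linepath (of_real x) (of_real x + \<i>) has_vector_derivative \<i>) (at t)"
    using has_vector_derivative_linepath_within[of "of_real x" "of_real x + \<i>" t UNIV] by simp
  have "(vline x has_vector_derivative \<i> * deriv strip (Complex x t)) (at t)"
    unfolding vline_def by (rule field_vector_diff_chain_at[OF l d])
  then show ?thesis by (simp add: vector_derivative_at mult.commute)
qed

lemma extremal_width_ge_log_ratio:
  "ennreal log_ratio \<le> extremal_width (joining_paths (cis ` {\<alpha>..\<beta>}) (cis ` {\<gamma>..\<delta>}))"
  unfolding extremal_width_def
proof (rule Inf_greatest, clarify)
  fix \<rho> :: "complex \<Rightarrow> ennreal"
  assume \<rho> [measurable]: "\<rho> \<in> borel_measurable borel"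
    and adm: "\<forall>g\<in>joining_paths (cis ` {\<alpha>..\<beta>}) (cis ` {\<gamma>..\<delta>}). 1 \<le> rho_length \<rho> g"
  have hol: "strip holomorphic_on rect"
    using strip_holomorphic rect_subset holomorphic_on_subset by blast
  define F where "F = (\<lambda>\<zeta>. \<rho> (strip \<zeta>) * ennreal (norm (deriv strip \<zeta>)) * indicator rect \<zeta>)"
  define G where "G = (\<lambda>\<zeta>. (\<rho> (strip \<zeta>))\<^sup>2 * ennreal ((norm (deriv strip \<zeta>))\<^sup>2) * indicator rect \<zeta>)"
  have GF: "G \<zeta> = (F \<zeta>)\<^sup>2" for \<zeta>
    by (simp add: F_def G_def power_mult_distrib indicator_def flip: ennreal_power)
  have [measurable]: "rect \<in> sets borel" using open_rect by simp
  have [measurable]: "(\<lambda>\<zeta>. if \<zeta> \<in> rect then strip \<zeta> else 0) \<in> borel_measurable borel"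
      "(\<lambda>\<zeta>. if \<zeta> \<in> rect then deriv strip \<zeta> else 0) \<in> borel_measurable borel"
    using hol open_rect
    by (auto intro!: borel_measurable_continuous_on_if holomorphic_on_imp_continuous_on holomorphic_deriv)
  have [measurable]: "F \<in> borel_measurable borel"
  proof -
    have "(\<lambda>\<zeta>. \<rho> (if \<zeta> \<in> rect then strip \<zeta> else 0) *
        ennreal (norm (if \<zeta> \<in> rect then deriv strip \<zeta> else 0)) * indicator rect \<zeta>) \<in> borel_measurable borel"
      by measurable
    then show ?thesis
      by (rule back_subst[of "\<lambda>f. f \<in> borel_measurable borel"]) (auto simp: fun_eq_iff indicator_def F_def)
  qed
  have [measurable]: "G \<in> borel_measurable borel"
    unfolding GF[abs_def] by measurable
  have cm [measurable]: "(\<lambda>t. Complex x t) \<in> borel_measurable borel" for x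
    by (intro borel_measurable_continuous_onI) (auto simp: complex_eq intro!: continuous_intros)
  have fibre: "indicator {0<..<log_ratio} x \<le> (\<integral>\<^sup>+ t. G (Complex x t) \<partial>lborel)" for x
  proof (cases "x \<in> {0<..<log_ratio}")
    case True
    define f where "f = (\<lambda>t. \<rho> (strip (Complex x t)) * ennreal (norm (deriv strip (Complex x t))))"
    have Ff: "F (Complex x t) = f t * indicator {0<..<1} t" for t
      using True by (simp add: F_def f_def rect_def indicator_def)
    have Gf: "G (Complex x t) = (f t)\<^sup>2 * indicator {0<..<1} t" for t
      by (simp add: GF Ff indicator_def)
    have "(\<lambda>t. F (Complex x t)) \<in> borel_measurable borel" by measurable
    then have m: "(\<lambda>t. f t * indicator {0<..<1} t) \<in> borel_measurable borel"
      by (simp only: Ff)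
    have "1 \<le> rho_length \<rho> (vline x)"
      using adm vline_joining True by auto
    also have "\<dots> = (\<integral>\<^sup>+ t. f t * indicator {0<..<1} t \<partial>lborel)"
      using rho_length_restrict[of "{}" \<rho> "vline x"]
      by (auto intro!: nn_integral_cong simp: f_def vline_eq vector_derivative_vline norm_mult indicator_def)
    finally have "1 \<le> (\<integral>\<^sup>+ t. (f t)\<^sup>2 * indicator {0<..<1} t \<partial>lborel)"
      by (rule length_area_fibre[OF m])
    then show ?thesis using True by (simp add: Gf)
  qed simp
  have "ennreal log_ratio = (\<integral>\<^sup>+ x. indicator {0<..<log_ratio} x \<partial>lborel)"
    using log_ratio_pos by simp
  also have "\<dots> \<le> (\<integral>\<^sup>+ x. \<integral>\<^sup>+ t. G (Complex x t) \<partial>lborel \<partial>lborel)"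
    by (intro nn_integral_mono fibre)
  also have "\<dots> = (\<integral>\<^sup>+ \<zeta>. G \<zeta> \<partial>lborel)"
    by (rule nn_integral_complex_iterated[symmetric]) measurable
  also have "\<dots> = (\<integral>\<^sup>+ w. (\<rho> w)\<^sup>2 * indicator (strip ` rect) w \<partial>lborel)"
    unfolding G_def
    by (rule nn_integral_conformal_substitution[OF open_rect hol inj_on_strip, symmetric]) measurable
  also have "\<dots> \<le> rho_area \<rho>"
    unfolding rho_area_def
    using strip_in_ball by (intro nn_integral_mono) (auto simp: indicator_def rect_def)
  finally show "ennreal log_ratio \<le> rho_area \<rho>" .
qed

end

section \<open>The upper bound for the width\<close>

lemma Re_Arccos_nonneg_le_pi: "0 \<le> Re (Arccos z)" "Re (Arccos z) \<le> pi"
proof -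
  define w where "w = 1 - z\<^sup>2"
  have "(norm z)\<^sup>2 \<le> norm w + 1"
    using norm_triangle_ineq4[of 1 w] by (simp add: w_def norm_power)
  \<comment> \<open>The right side is the square of \<open>Re (csqrt w)\<close>. Hence the argument
    of the logarithm that defines \<open>Arccos\<close> lies in the closed upper half-plane, for
    every \<open>z\<close>, also on the branch cuts.\<close>
  then have "(Im z)\<^sup>2 \<le> (norm w + Re w) / 2"
    by (simp add: w_def cmod_power2 Re_power2)
  then have "\<bar>Im z\<bar> \<le> Re (csqrt w)"
    by (simp add: real_le_rsqrt)
  then have "0 \<le> Im (z + \<i> * csqrt w)" by simp
  then show "0 \<le> Re (Arccos z)"
    unfolding Re_Arccos w_def[symmetric]
    using Im_Ln_pos_le[of "z + \<i> * csqrt w"] Arccos_body_lemma[of z] by (simp add: w_def)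
qed (use Re_Arccos_bounds in auto)

text \<open>The distances from \<open>cos A\<close> to the foci -1 and 1. Their sum depends only on
  \<open>Im A\<close> (confocal ellipses), their difference only on \<open>Re A\<close> (confocal
  hyperbolas).\<close>

lemma norm_cos_plus_minus_one:
  fixes A :: complex
  shows "norm (cos A + 1) = cosh (Im A) + cos (Re A)" "norm (cos A - 1) = cosh (Im A) - cos (Re A)"
proof -
  define p q where "p = Re A" and "q = Im A"
  have re: "Re (cos A) = cos p * cosh q" and im: "Im (cos A) = - sin p * sinh q"
    by (simp_all add: Re_cos Im_cos p_def q_def cosh_field_def sinh_field_def field_simps)
  have C: "(sinh q)\<^sup>2 = (cosh q)\<^sup>2 - 1" using hyperbolic_pythagoras[of q] by simp
  have S: "(sin p)\<^sup>2 = 1 - (cos p)\<^sup>2" by (simp add: sin_squared_eq)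
  have ge: "1 \<le> cosh q" by (rule cosh_real_ge_1)
  have pb: "-1 \<le> cos p" "cos p \<le> 1" by auto
  have "(norm (cos A + 1))\<^sup>2 = (cos p * cosh q + 1)\<^sup>2 + (sin p)\<^sup>2 * (sinh q)\<^sup>2"
    by (simp add: cmod_power2 re im power_mult_distrib)
  also have "\<dots> = (cosh q + cos p)\<^sup>2"
    unfolding C S by (simp add: power2_eq_square algebra_simps)
  finally have "norm (cos A + 1) = cosh q + cos p"
    by (rule power2_eq_imp_eq) (simp, use ge pb in linarith)
  then show "norm (cos A + 1) = cosh (Im A) + cos (Re A)" by (simp add: p_def q_def)
  have "(norm (cos A - 1))\<^sup>2 = (cos p * cosh q - 1)\<^sup>2 + (sin p)\<^sup>2 * (sinh q)\<^sup>2"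
    by (simp add: cmod_power2 re im power_mult_distrib)
  also have "\<dots> = (cosh q - cos p)\<^sup>2"
    unfolding C S by (simp add: power2_eq_square algebra_simps)
  finally have "norm (cos A - 1) = cosh q - cos p"
    by (rule power2_eq_imp_eq) (simp, use ge pb in linarith)
  then show "norm (cos A - 1) = cosh (Im A) - cos (Re A)" by (simp add: p_def q_def)
qed

text \<open>Maps the upper half-plane onto the lower half-strip of width 1: the half-line up to 0
  goes to the side \<open>Re = 1\<close>, the half-line from 1 on to the side \<open>Re = 0\<close>,
  and the gap between them to the end \<open>Im = 0\<close>. So its real part is the natural
  potential for paths between the two half-lines.\<close>

definition confocal :: "complex \<Rightarrow> complex" where
  "confocal y = Arccos (2 * y - 1) / of_real pi"

text \<open>The real part of \<open>confocal\<close> in a form that is visibly continuous on the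
  whole plane and invariant under conjugation, whereas \<open>Arccos\<close> itself jumps across its
  cuts.\<close>

definition confocal_angle :: "complex \<Rightarrow> real" where
  "confocal_angle y = arccos (norm y - norm (y - 1)) / pi"

lemma norm_foci:
  "norm y + norm (y - 1) = cosh (Im (Arccos (2 * y - 1)))"
  "norm y - norm (y - 1) = cos (Re (Arccos (2 * y - 1)))"
proof -
  define A where "A = Arccos (2 * y - 1)"
  have cosA: "cos A = 2 * y - 1" by (simp add: A_def)
  have "norm (2 * y) = cosh (Im A) + cos (Re A)"
    using norm_cos_plus_minus_one(1)[of A] by (simp add: cosA)
  moreover have "norm (2 * (y - 1)) = cosh (Im A) - cos (Re A)"
    using norm_cos_plus_minus_one(2)[of A] by (simp add: cosA algebra_simps)
  ultimately have "2 * norm y = cosh (Im A) + cos (Re A)" "2 * norm (y - 1) = cosh (Im A) - cos (Re A)"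
    unfolding norm_mult by simp_all
  then show "norm y + norm (y - 1) = cosh (Im (Arccos (2 * y - 1)))"
    "norm y - norm (y - 1) = cos (Re (Arccos (2 * y - 1)))"
    unfolding A_def[symmetric] by linarith+
qed

lemma Re_confocal: "Re (confocal y) = confocal_angle y"
  unfolding confocal_def confocal_angle_def norm_foci(2)
  using Re_Arccos_nonneg_le_pi by (simp add: arccos_cos)

lemma confocal_bounds:
  "0 \<le> Re (confocal y)" "Re (confocal y) \<le> 1"
  using Re_Arccos_nonneg_le_pi by (simp_all add: confocal_def)

text \<open>The ellipse through \<open>y\<close> fixes the hyperbolic cosine of the imaginary part.
  The constants come from \<open>exp q <= 2 * cosh q\<close> and
  \<open>norm (y - 1) <= norm y + 1\<close>.\<close>

lemma abs_Im_confocal: "\<bar>Im (confocal y)\<bar> \<le> ln (4 * norm y + 2) / pi"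
proof -
  define q where "q = Im (Arccos (2 * y - 1))"
  have "exp \<bar>q\<bar> \<le> 2 * cosh \<bar>q\<bar>"
    unfolding cosh_field_def by simp
  also have "\<dots> = 2 * (norm y + norm (y - 1))"
    by (simp add: norm_foci(1) q_def)
  also have "\<dots> \<le> 4 * norm y + 2"
    using norm_triangle_ineq4[of y 1] by simp
  finally have "exp \<bar>q\<bar> \<le> 4 * norm y + 2" .
  moreover have "0 < 4 * norm y + 2" by (simp add: add_nonneg_pos)
  ultimately have "\<bar>q\<bar> \<le> ln (4 * norm y + 2)"
    using ln_ge_iff by blast
  then show ?thesis
    by (simp add: confocal_def q_def divide_right_mono)
qed

text \<open>Confines the image of a half-plane to one half-strip; the bound on the absolute value
  alone would give twice the area.\<close>

lemma Im_confocal_sign: "0 < Im y \<Longrightarrow> Im (confocal y) \<le> 0" "Im y < 0 \<Longrightarrow> 0 \<le> Im (confocal y)"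
proof -
  define A where "A = Arccos (2 * y - 1)"
  have "cos A = 2 * y - 1" by (simp add: A_def)
  then have im: "2 * Im y = - sin (Re A) * sinh (Im A)"
    using arg_cong[of "cos A" "2 * y - 1" Im]
    by (simp add: Im_cos sinh_field_def field_simps)
  have s: "0 \<le> sin (Re A)"
    using Re_Arccos_nonneg_le_pi by (intro sin_ge_zero) (auto simp: A_def)
  have Imc: "Im (confocal y) = Im A / pi" by (simp add: confocal_def A_def)
  show "Im (confocal y) \<le> 0" if "0 < Im y"
  proof (rule ccontr)
    assume "\<not> ?thesis"
    then have "0 \<le> sinh (Im A)" by (simp add: Imc divide_le_0_iff)
    then have "0 \<le> sin (Re A) * sinh (Im A)" using s by simp
    then show False using im that by simp
  qed
  show "0 \<le> Im (confocal y)" if "Im y < 0"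
  proof (rule ccontr)
    assume "\<not> ?thesis"
    then have "Im A / pi < 0" by (simp add: Imc)
    then have "sinh (Im A) \<le> 0" by (simp add: divide_less_0_iff)
    then have "sin (Re A) * sinh (Im A) \<le> 0" using s by (simp add: mult_nonneg_nonpos)
    then show False using im that by simp
  qed
qed

lemma confocal_inj: "confocal x = confocal y \<Longrightarrow> x = y"
proof -
  assume "confocal x = confocal y"
  then have "cos (Arccos (2 * x - 1)) = cos (Arccos (2 * y - 1))"
    by (simp add: confocal_def)
  then show "x = y" by simp
qed

text \<open>Away from the real line no branch cut interferes. The modulus depends only on the
  distances from \<open>y\<close> to 0 and 1, hence takes equal values at conjugate points, which is
  what gluing along the cut requires.\<close>

lemma confocal_has_derivative:
  assumes "Im y \<noteq> 0"
  obtains D where "(confocal has_field_derivative D) (at y)"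
    "norm D = 1 / (pi * sqrt (norm y * norm (y - 1)))"
proof -
  define s where "s = sin (Arccos (2 * y - 1))"
  have d1: "(Arccos has_field_derivative - inverse s) (at (2 * y - 1))"
    unfolding s_def by (rule has_field_derivative_Arccos) (use assms in simp)
  have d2: "((\<lambda>y. 2 * y - 1) has_field_derivative 2) (at y)"
    by (auto intro!: derivative_eq_intros)
  have "((\<lambda>y. Arccos (2 * y - 1)) has_field_derivative - inverse s * 2) (at y)"
    using DERIV_chain2[OF d1 d2] .
  then have d: "(confocal has_field_derivative - inverse s * 2 / of_real pi) (at y)"
    unfolding confocal_def[abs_def] by (rule DERIV_cdivide)
  have "s\<^sup>2 = 1 - (2 * y - 1)\<^sup>2"
    unfolding s_def by (simp add: sin_squared_eq)
  also have "\<dots> = - 4 * (y * (y - 1))"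
    by (simp add: power2_eq_square algebra_simps)
  finally have "norm (s\<^sup>2) = 4 * (norm y * norm (y - 1))"
    by (simp add: norm_mult)
  then have "(norm s)\<^sup>2 = 2\<^sup>2 * (norm y * norm (y - 1))"
    by (simp add: norm_power)
  then have "norm s = 2 * sqrt (norm y * norm (y - 1))"
    by (metis norm_ge_zero real_sqrt_abs real_sqrt_mult abs_numeral abs_norm_cancel)
  then have "norm (- inverse s * 2 / of_real pi) = 1 / (pi * sqrt (norm y * norm (y - 1)))"
    by (simp add: norm_mult norm_divide norm_inverse divide_simps)
  then show ?thesis using d that by blast
qed

lemma confocal_angle_nonpos: "x \<le> 0 \<Longrightarrow> confocal_angle (of_real x) = 1"
proof -
  assume "x \<le> 0"
  then have "norm (complex_of_real x) - norm (complex_of_real x - 1) = -1"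
    using norm_of_real[of "x - 1", where 'a = complex] by simp
  then show ?thesis by (simp add: confocal_angle_def)
qed

lemma confocal_angle_ge_1: "1 \<le> x \<Longrightarrow> confocal_angle (of_real x) = 0"
proof -
  assume "1 \<le> x"
  then have "norm (complex_of_real x) - norm (complex_of_real x - 1) = 1"
    using norm_of_real[of "x - 1", where 'a = complex] by simp
  then show ?thesis by (simp add: confocal_angle_def)
qed

lemma continuous_on_confocal_angle: "continuous_on UNIV confocal_angle"
  unfolding confocal_angle_def
proof (intro continuous_intros ballI conjI)
  fix y :: complex
  show "- 1 \<le> norm y - norm (y - 1)" "norm y - norm (y - 1) \<le> 1"
    using norm_triangle_ineq4[of y 1] norm_triangle_ineq2[of y "y - 1"] by auto
qed auto

lemma confocal_angle_cnj: "confocal_angle (cnj y) = confocal_angle y"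
  by (metis (no_types) complex_cnj_diff complex_cnj_one complex_mod_cnj confocal_angle_def)


lemma holomorphic_local_lipschitz:
  fixes f :: "complex \<Rightarrow> complex"
  assumes "f field_differentiable (at z)" "0 < \<epsilon>"
  shows "\<forall>\<^sub>F w in nhds z. \<bar>Re (f w) - Re (f z)\<bar> \<le> (norm (deriv f z) + \<epsilon>) * norm (w - z)"
proof -
  have "(f has_derivative (*) (deriv f z)) (at z)"
    using assms(1) unfolding DERIV_deriv_iff_field_differentiable[symmetric] has_field_derivative_def .
  then have "\<forall>\<^sub>F w in at z. norm (f w - f z - deriv f z * (w - z)) \<le> \<epsilon> * norm (w - z)"
    using assms(2) unfolding has_derivative_within_alt2 by auto
  then have "\<forall>\<^sub>F w in at z. \<bar>Re (f w) - Re (f z)\<bar> \<le> (norm (deriv f z) + \<epsilon>) * norm (w - z)"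
  proof eventually_elim
    case (elim w)
    have "\<bar>Re (f w) - Re (f z)\<bar> \<le> norm (f w - f z)"
      using abs_Re_le_cmod[of "f w - f z"] by simp
    also have "\<dots> \<le> norm (f w - f z - deriv f z * (w - z)) + norm (deriv f z * (w - z))"
      using norm_triangle_ineq[of "f w - f z - deriv f z * (w - z)" "deriv f z * (w - z)"] by simp
    also have "\<dots> \<le> \<epsilon> * norm (w - z) + norm (deriv f z) * norm (w - z)"
      using elim by (simp add: norm_mult)
    finally show ?case by (simp add: distrib_right)
  qed
  then show ?thesis by (simp add: eventually_nhds_conv_at)
qed

section \<open>The metric glued from two confocal maps\<close>

context arc_pair
begin

lemma moeb_neq_center: "z \<in> ball 0 1 \<Longrightarrow> z \<noteq> cis \<alpha>"
  by auto

lemma moeb_holomorphic: "moeb holomorphic_on ball 0 1"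
  unfolding moeb_def using moeb_neq_center by (intro holomorphic_intros) auto

lemma moeb_inj:
  assumes "z \<noteq> cis \<alpha>" "w \<noteq> cis \<alpha>" "moeb z = moeb w"
  shows "z = w"
proof -
  have "cis (- half_angle) * (z - cis \<beta>) * (w - cis \<alpha>) = cis (- half_angle) * (w - cis \<beta>) * (z - cis \<alpha>)"
    using assms by (simp add: moeb_def frac_eq_eq)
  then have "(z - cis \<beta>) * (w - cis \<alpha>) = (w - cis \<beta>) * (z - cis \<alpha>)"
    by (simp add: mult.assoc)
  then have "(z - w) * (cis \<beta> - cis \<alpha>) = 0"
    by (simp add: algebra_simps)
  then show ?thesis using cis_neq by simp
qed

lemma norm_moeb: "norm (moeb z) = norm (z - cis \<beta>) / norm (z - cis \<alpha>)"
  by (simp add: moeb_def norm_divide norm_mult)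

text \<open>The semicircle of this radius is fixed by the reflection
  \<open>w \<mapsto> ratio \<gamma> * ratio \<delta> / cnj w\<close>, which exchanges
  \<open>ratio \<gamma>\<close> and \<open>ratio \<delta>\<close> and preserves the negative
  half-line.\<close>

definition mid :: real where "mid = sqrt (ratio \<gamma> * ratio \<delta>)"

text \<open>The modulus of both normalised coordinates on the cut; its logarithm is
  \<open>pi * log_ratio / 2\<close>.\<close>

definition aspect :: real where "aspect = sqrt (ratio \<delta> / ratio \<gamma>)"

lemma mid_pos: "0 < mid" and mid_square: "mid\<^sup>2 = ratio \<gamma> * ratio \<delta>"
  using ratio_pos by (auto simp: mid_def)

lemma mid_div: "mid / ratio \<gamma> = aspect" "ratio \<delta> / mid = aspect"
proof -
  define s where "s = sqrt (ratio \<gamma>)"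
  define t where "t = sqrt (ratio \<delta>)"
  have pos: "0 < s" "0 < t" using ratio_pos by (auto simp: s_def t_def)
  have "s * s = ratio \<gamma>" "t * t = ratio \<delta>" using ratio_pos by (auto simp: s_def t_def)
  then have sq: "ratio \<gamma> = s * s" "ratio \<delta> = t * t" by simp_all
  have mid: "mid = s * t" and asp: "aspect = t / s"
    by (simp_all add: mid_def aspect_def s_def t_def real_sqrt_mult real_sqrt_divide)
  show "mid / ratio \<gamma> = aspect" "ratio \<delta> / mid = aspect"
    unfolding mid asp sq using pos by simp_all
qed

text \<open>The disk is cut along the circular arc \<open>norm (moeb z) = mid\<close>, the axis of symmetry
  exchanging the endpoints of the second arc. On each side the problem is compared with the
  case in which the far endpoint has been moved to an endpoint of the first arc, which \<open>confocal\<close>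
  uniformises explicitly.\<close>

definition inner_coord :: "complex \<Rightarrow> complex" where
  "inner_coord z = moeb z / of_real (ratio \<gamma>)"

definition outer_coord :: "complex \<Rightarrow> complex" where
  "outer_coord z = of_real (ratio \<delta>) / moeb z"

definition inner_map :: "complex \<Rightarrow> complex" where
  "inner_map z = confocal (inner_coord z)"

definition outer_map :: "complex \<Rightarrow> complex" where
  "outer_map z = confocal (outer_coord z)"

lemma Im_inner_coord: "z \<in> ball 0 1 \<Longrightarrow> 0 < Im (inner_coord z)"
  using moeb_upper ratio_pos by (simp add: inner_coord_def)

lemma Im_outer_coord: "z \<in> ball 0 1 \<Longrightarrow> Im (outer_coord z) < 0"
proof -
  assume "z \<in> ball 0 1"
  then have *: "0 < Im (moeb z)" using moeb_upper by simp
  then have "0 < (Re (moeb z))\<^sup>2 + (Im (moeb z))\<^sup>2"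
    by (simp add: add_nonneg_pos)
  then have "- (ratio \<delta> * Im (moeb z)) / ((Re (moeb z))\<^sup>2 + (Im (moeb z))\<^sup>2) < 0"
    using * ratio_pos by (intro divide_neg_pos) auto
  then show ?thesis by (simp add: outer_coord_def Im_divide)
qed

lemma moeb_has_derivative:
  "z \<in> ball 0 1 \<Longrightarrow> (moeb has_field_derivative deriv moeb z) (at z)"
  by (rule holomorphic_derivI[OF moeb_holomorphic]) auto

lemma inner_map_has_derivative:
  assumes "z \<in> ball 0 1"
  shows "inner_map field_differentiable (at z)"
    and "norm (deriv inner_map z) = norm (deriv moeb z) / ratio \<gamma> /
      (pi * sqrt (norm (inner_coord z) * norm (inner_coord z - 1)))"
proof -
  obtain D where D: "(confocal has_field_derivative D) (at (inner_coord z))"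
    "norm D = 1 / (pi * sqrt (norm (inner_coord z) * norm (inner_coord z - 1)))"
    using confocal_has_derivative[of "inner_coord z"] Im_inner_coord[OF assms] by auto
  have ic: "(inner_coord has_field_derivative deriv moeb z / of_real (ratio \<gamma>)) (at z)"
    unfolding inner_coord_def[abs_def] by (rule DERIV_cdivide[OF moeb_has_derivative[OF assms]])
  have d: "(inner_map has_field_derivative D * (deriv moeb z / of_real (ratio \<gamma>))) (at z)"
    unfolding inner_map_def[abs_def] by (rule DERIV_chain2[OF D(1) ic])
  then show "inner_map field_differentiable (at z)"
    by (auto simp: field_differentiable_def)
  show "norm (deriv inner_map z) = norm (deriv moeb z) / ratio \<gamma> /
      (pi * sqrt (norm (inner_coord z) * norm (inner_coord z - 1)))"
    unfolding DERIV_imp_deriv[OF d] norm_mult D(2) using ratio_pos by (simp add: norm_divide)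
qed

lemma outer_map_has_derivative:
  assumes "z \<in> ball 0 1"
  shows "outer_map field_differentiable (at z)"
    and "norm (deriv outer_map z) = ratio \<delta> * norm (deriv moeb z) / (norm (moeb z))\<^sup>2 /
      (pi * sqrt (norm (outer_coord z) * norm (outer_coord z - 1)))"
proof -
  have nz: "moeb z \<noteq> 0" using moeb_upper[of z] assms by auto
  obtain D where D: "(confocal has_field_derivative D) (at (outer_coord z))"
    "norm D = 1 / (pi * sqrt (norm (outer_coord z) * norm (outer_coord z - 1)))"
    using confocal_has_derivative[of "outer_coord z"] Im_outer_coord[OF assms] by auto
  have oc: "(outer_coord has_field_derivative - (of_real (ratio \<delta>) * deriv moeb z / (moeb z)\<^sup>2)) (at z)"
    unfolding outer_coord_def[abs_def] using nz moeb_has_derivative[OF assms]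
    by (auto intro!: derivative_eq_intros simp: power2_eq_square)
  have d: "(outer_map has_field_derivative D * - (of_real (ratio \<delta>) * deriv moeb z / (moeb z)\<^sup>2)) (at z)"
    unfolding outer_map_def[abs_def] by (rule DERIV_chain2[OF D(1) oc])
  then show "outer_map field_differentiable (at z)"
    by (auto simp: field_differentiable_def)
  show "norm (deriv outer_map z) = ratio \<delta> * norm (deriv moeb z) / (norm (moeb z))\<^sup>2 /
      (pi * sqrt (norm (outer_coord z) * norm (outer_coord z - 1)))"
    unfolding DERIV_imp_deriv[OF d] norm_mult D(2) norm_minus_cancel
    using ratio_pos by (simp add: norm_divide norm_mult norm_power)
qed

lemma inner_map_holomorphic: "inner_map holomorphic_on ball 0 1"
  and outer_map_holomorphic: "outer_map holomorphic_on ball 0 1"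
  using inner_map_has_derivative(1) outer_map_has_derivative(1)
  by (auto simp: holomorphic_on_def intro: field_differentiable_at_within)

lemma inj_on_inner_map: "inj_on inner_map (ball 0 1)"
proof (rule inj_onI)
  fix z w assume zw: "z \<in> ball 0 1" "w \<in> ball 0 1" "inner_map z = inner_map w"
  then have "moeb z = moeb w"
    using confocal_inj[of "inner_coord z" "inner_coord w"] ratio_pos
    by (simp add: inner_map_def inner_coord_def)
  then show "z = w" using zw moeb_inj moeb_neq_center by blast
qed

lemma inj_on_outer_map: "inj_on outer_map (ball 0 1)"
proof (rule inj_onI)
  fix z w assume zw: "z \<in> ball 0 1" "w \<in> ball 0 1" "outer_map z = outer_map w"
  have "moeb z \<noteq> 0" "moeb w \<noteq> 0" using moeb_upper[of z] moeb_upper[of w] zw by auto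
  moreover have "outer_coord z = outer_coord w"
    using confocal_inj zw(3) by (simp add: outer_map_def)
  ultimately have "moeb z = moeb w"
    using ratio_pos by (simp add: outer_coord_def frac_eq_eq)
  then show "z = w" using zw moeb_inj moeb_neq_center by blast
qed

text \<open>On the cut the two coordinates are mirror images. Since \<open>confocal_angle\<close>
  and the modulus of the derivative of \<open>confocal\<close> do not see conjugation, potentials
  and metrics of both sides agree there.\<close>

lemma outer_coord_eq_cnj:
  assumes "norm (moeb z) = mid"
  shows "outer_coord z = cnj (inner_coord z)"
proof -
  have "moeb z * cnj (moeb z) = of_real (ratio \<gamma> * ratio \<delta>)"
    using assms mid_square by (metis complex_norm_square)
  moreover have "moeb z \<noteq> 0" using assms mid_pos by auto
  ultimately show ?thesis
    using ratio_pos by (simp add: outer_coord_def inner_coord_def field_simps)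
qed

lemma deriv_maps_eq:
  assumes "z \<in> ball 0 1" "norm (moeb z) = mid"
  shows "norm (deriv inner_map z) = norm (deriv outer_map z)"
proof -
  have 1: "norm (outer_coord z) = norm (inner_coord z)"
    unfolding outer_coord_eq_cnj[OF assms(2)] by simp
  have 2: "norm (outer_coord z - 1) = norm (inner_coord z - 1)"
  proof -
    have "outer_coord z - 1 = cnj (inner_coord z - 1)"
      unfolding outer_coord_eq_cnj[OF assms(2)] by simp
    then show ?thesis by (simp only: complex_mod_cnj)
  qed
  have 3: "ratio \<delta> * norm (deriv moeb z) / (norm (moeb z))\<^sup>2 = norm (deriv moeb z) / ratio \<gamma>"
    unfolding assms(2) mid_square using ratio_pos by simp
  show ?thesis
    unfolding inner_map_has_derivative(2)[OF assms(1)] outer_map_has_derivative(2)[OF assms(1)] 1 2 3 ..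
qed

definition metric :: "complex \<Rightarrow> real" where
  "metric z = (if norm (moeb z) \<le> mid then norm (deriv inner_map z) else norm (deriv outer_map z))"

text \<open>The side is chosen by an inequality without division. At \<open>cis \<alpha>\<close>,
  where \<open>moeb\<close> is infinite, it selects the outer branch; the default value 0 of
  \<open>moeb\<close> there would satisfy \<open>norm (moeb z) <= mid\<close> and select the wrong
  one.\<close>

definition potential :: "complex \<Rightarrow> real" where
  "potential z = (if norm (z - cis \<beta>) \<le> mid * norm (z - cis \<alpha>)
     then confocal_angle (inner_coord z) else confocal_angle (outer_coord z))"

lemma norm_moeb_le_mid_iff:
  "z \<noteq> cis \<alpha> \<Longrightarrow> norm (moeb z) \<le> mid \<longleftrightarrow> norm (z - cis \<beta>) \<le> mid * norm (z - cis \<alpha>)"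
  by (simp add: norm_moeb divide_le_eq)

lemma continuous_on_metric: "continuous_on (ball 0 1) metric"
  unfolding metric_def
proof (rule continuous_on_cases_le)
  show "continuous_on {t \<in> ball 0 1. norm (moeb t) \<le> mid} (\<lambda>z. norm (deriv inner_map z))"
    "continuous_on {t \<in> ball 0 1. mid \<le> norm (moeb t)} (\<lambda>z. norm (deriv outer_map z))"
  proof -
    have c: "continuous_on (ball 0 1) (\<lambda>z. norm (deriv f z))" if "f holomorphic_on ball 0 1" for f :: "complex \<Rightarrow> complex"
      by (intro continuous_on_norm holomorphic_on_imp_continuous_on holomorphic_deriv that open_ball)
    show "continuous_on {t \<in> ball 0 1. norm (moeb t) \<le> mid} (\<lambda>z. norm (deriv inner_map z))"
      by (rule continuous_on_subset[OF c[OF inner_map_holomorphic]]) auto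
    show "continuous_on {t \<in> ball 0 1. mid \<le> norm (moeb t)} (\<lambda>z. norm (deriv outer_map z))"
      by (rule continuous_on_subset[OF c[OF outer_map_holomorphic]]) auto
  qed
  show "continuous_on (ball 0 1) (\<lambda>z. norm (moeb z))"
    by (intro continuous_intros holomorphic_on_imp_continuous_on moeb_holomorphic)
qed (use deriv_maps_eq in auto)

lemma continuous_on_potential: "continuous_on UNIV potential"
proof -
  have "continuous_on UNIV (\<lambda>z. if norm (z - cis \<beta>) - mid * norm (z - cis \<alpha>) \<le> 0
      then confocal_angle (inner_coord z) else confocal_angle (outer_coord z))"
  proof (rule continuous_on_cases_le)
    have ne: "z \<noteq> cis \<alpha>" if "norm (z - cis \<beta>) - mid * norm (z - cis \<alpha>) \<le> 0" for z
      using that cis_neq by auto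
    have ne': "z \<noteq> cis \<beta>" if "0 \<le> norm (z - cis \<beta>) - mid * norm (z - cis \<alpha>)" for z
      using that cis_neq mid_pos by (auto simp: mult_le_0_iff)
    show "continuous_on {z \<in> UNIV. norm (z - cis \<beta>) - mid * norm (z - cis \<alpha>) \<le> 0}
       (\<lambda>z. confocal_angle (inner_coord z))"
      unfolding inner_coord_def moeb_def
      using ne ratio_pos
      by (intro continuous_on_compose2[OF continuous_on_confocal_angle] continuous_intros) auto
    \<comment> \<open>True also at \<open>cis \<alpha>\<close>, where both sides are 0 by division
      by zero. The right side is continuous there, so this default is the correct limit.\<close>
    have oc: "outer_coord z = of_real (ratio \<delta>) * (z - cis \<alpha>) / (cis (- half_angle) * (z - cis \<beta>))" for z
      by (simp add: outer_coord_def moeb_def)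
    show "continuous_on {z \<in> UNIV. 0 \<le> norm (z - cis \<beta>) - mid * norm (z - cis \<alpha>)}
       (\<lambda>z. confocal_angle (outer_coord z))"
      unfolding oc
      using ne'
      by (intro continuous_on_compose2[OF continuous_on_confocal_angle] continuous_intros) auto
    show "confocal_angle (inner_coord z) = confocal_angle (outer_coord z)"
      if "norm (z - cis \<beta>) - mid * norm (z - cis \<alpha>) = 0" for z
    proof -
      have "norm (moeb z) = mid"
        using that ne[of z] by (simp add: norm_moeb divide_eq_eq)
      then show ?thesis
        by (simp only: outer_coord_eq_cnj confocal_angle_cnj)
    qed
    show "continuous_on UNIV (\<lambda>z. norm (z - cis \<beta>) - mid * norm (z - cis \<alpha>))"
      by (intro continuous_intros)
  qed
  then show ?thesis by (simp add: potential_def[abs_def])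
qed

lemma metric_nonneg: "0 \<le> metric z"
  by (simp add: metric_def)

lemma potential_cases:
  assumes "z \<in> ball 0 1"
  shows "norm (moeb z) \<le> mid \<Longrightarrow> potential z = Re (inner_map z) \<and> metric z = norm (deriv inner_map z)"
    and "mid \<le> norm (moeb z) \<Longrightarrow> potential z = Re (outer_map z) \<and> metric z = norm (deriv outer_map z)"
proof -
  have ne: "z \<noteq> cis \<alpha>" using moeb_neq_center assms by blast
  show 1: "potential z = Re (inner_map z) \<and> metric z = norm (deriv inner_map z)" if "norm (moeb z) \<le> mid"
    using that norm_moeb_le_mid_iff[OF ne]
    by (simp add: potential_def metric_def inner_map_def Re_confocal)
  show "potential z = Re (outer_map z) \<and> metric z = norm (deriv outer_map z)" if "mid \<le> norm (moeb z)"
  proof (cases "norm (moeb z) = mid")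
    case True
    then show ?thesis
      using 1 deriv_maps_eq[OF assms True]
      by (simp add: inner_map_def outer_map_def Re_confocal outer_coord_eq_cnj confocal_angle_cnj)
  next
    case False
    then show ?thesis using that norm_moeb_le_mid_iff[OF ne]
      by (simp add: potential_def metric_def outer_map_def Re_confocal)
  qed
qed

lemma potential_local_lipschitz:
  assumes z: "z \<in> ball 0 1" and "0 < \<epsilon>"
  shows "\<forall>\<^sub>F w in nhds z. \<bar>potential w - potential z\<bar> \<le> (metric z + \<epsilon>) * norm (w - z)"
proof -
  have cont: "isCont (\<lambda>z. norm (moeb z)) z"
    using moeb_has_derivative[OF z] by (intro continuous_norm DERIV_isCont)
  then have tend: "((\<lambda>z. norm (moeb z)) \<longlongrightarrow> norm (moeb z)) (nhds z)"
    by (simp add: continuous_at tendsto_nhds_iff)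
  have in_ball: "\<forall>\<^sub>F w in nhds z. w \<in> ball 0 1"
    using z by (intro eventually_nhds_in_open) auto
  note inner = holomorphic_local_lipschitz[OF inner_map_has_derivative(1)[OF z] \<open>0 < \<epsilon>\<close>]
  note outer = holomorphic_local_lipschitz[OF outer_map_has_derivative(1)[OF z] \<open>0 < \<epsilon>\<close>]
  consider "norm (moeb z) < mid" | "mid < norm (moeb z)" | "norm (moeb z) = mid" by linarith
  then show ?thesis
  proof cases
    case 1
    then have "\<forall>\<^sub>F w in nhds z. norm (moeb w) < mid"
      using tend order_tendstoD by blast
    then show ?thesis using in_ball inner
    proof eventually_elim
      case (elim w)
      then show ?case using potential_cases(1)[OF z] potential_cases(1)[of w] 1 by simp
    qed
  next
    case 2
    then have "\<forall>\<^sub>F w in nhds z. mid < norm (moeb w)"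
      using tend order_tendstoD by blast
    then show ?thesis using in_ball outer
    proof eventually_elim
      case (elim w)
      then show ?case using potential_cases(2)[OF z] potential_cases(2)[of w] 2 by simp
    qed
  next
    \<comment> \<open>On the cut, nearby points may lie on either side. Both representations of the
      potential hold at \<open>z\<close> with the same value and the same metric, so each side has
      its own Lipschitz bound with a common constant.\<close>
    case 3
    show ?thesis using in_ball inner outer
    proof eventually_elim
      case (elim w)
      then show ?case
        using potential_cases[OF z] potential_cases[of w] 3
        by (cases "norm (moeb w) \<le> mid") auto
    qed
  qed
qed

lemma potential_first_arc:
  assumes "t \<in> {\<alpha>..\<beta>}"
  shows "potential (cis t) = 1"
proof (cases "t = \<alpha>")
  \<comment> \<open>Here \<open>moeb (cis \<alpha>)\<close> is 0 by default and so is
    \<open>outer_coord\<close>, again the true limit; 0 is the end of the half-line on which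
    \<open>confocal_angle\<close> is 1.\<close>
  case True
  then show ?thesis
    using cis_neq confocal_angle_nonpos[of 0]
    by (simp add: potential_def outer_coord_def moeb_def)
next
  case False
  then have t: "\<alpha> < t" "t < \<alpha> + 2 * pi" using assms order by auto
  then have "ratio t \<le> 0"
    using ratio_le_iff[of t \<beta>] assms order by (simp add: ratio_beta)
  then have "ratio t / ratio \<gamma> \<le> 0" "ratio \<delta> / ratio t \<le> 0"
    using ratio_pos by (auto simp: divide_le_0_iff)
  then show ?thesis
    using confocal_angle_nonpos[of "ratio t / ratio \<gamma>"] confocal_angle_nonpos[of "ratio \<delta> / ratio t"]
    by (simp add: potential_def outer_coord_def inner_coord_def moeb_cis[OF t])
qed

lemma potential_second_arc:
  assumes "t \<in> {\<gamma>..\<delta>}"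
  shows "potential (cis t) = 0"
proof -
  have t: "\<alpha> < t" "t < \<alpha> + 2 * pi" using assms order by auto
  then have "ratio \<gamma> \<le> ratio t" "ratio t \<le> ratio \<delta>"
    using ratio_le_iff[of \<gamma> t] ratio_le_iff[of t \<delta>] assms order by auto
  then have "1 \<le> ratio t / ratio \<gamma>" "1 \<le> ratio \<delta> / ratio t"
    using ratio_pos by auto
  then show ?thesis
    using confocal_angle_ge_1[of "ratio t / ratio \<gamma>"] confocal_angle_ge_1[of "ratio \<delta> / ratio t"]
    by (simp add: potential_def outer_coord_def inner_coord_def moeb_cis[OF t])
qed

lemma emeasure_confocal_image:
  assumes "\<And>y. y \<in> Y \<Longrightarrow> norm y \<le> aspect" and "(\<forall>y\<in>Y. 0 < Im y) \<or> (\<forall>y\<in>Y. Im y < 0)"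
  shows "emeasure lborel (confocal ` Y) \<le> ennreal (ln (4 * aspect + 2) / pi)"
proof -
  define X where "X = ln (4 * aspect + 2) / pi"
  have asp: "0 < aspect" using ratio_pos by (simp add: aspect_def)
  then have X: "0 \<le> X" by (simp add: X_def)
  have im: "\<bar>Im (confocal y)\<bar> \<le> X" if "y \<in> Y" for y
  proof -
    have "ln (4 * norm y + 2) \<le> ln (4 * aspect + 2)"
      using assms(1)[OF that] asp by (intro ln_mono) (auto simp: add_nonneg_pos)
    then have "ln (4 * norm y + 2) / pi \<le> X"
      by (simp add: X_def divide_right_mono)
    then show ?thesis
      using abs_Im_confocal[of y] by linarith
  qed
  obtain l :: real where l: "confocal ` Y \<subseteq> cbox (Complex 0 l) (Complex 1 (l + X))"
    using assms(2)
  proof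
    assume "\<forall>y\<in>Y. 0 < Im y"
    then have "confocal ` Y \<subseteq> cbox (Complex 0 (- X)) (Complex 1 (- X + X))"
      using im Im_confocal_sign(1) confocal_bounds by (force simp: in_cbox_complex_iff abs_le_iff)
    then show ?thesis using that by blast
  next
    assume "\<forall>y\<in>Y. Im y < 0"
    then have "confocal ` Y \<subseteq> cbox (Complex 0 0) (Complex 1 (0 + X))"
      using im Im_confocal_sign(2) confocal_bounds by (force simp: in_cbox_complex_iff abs_le_iff)
    then show ?thesis using that by blast
  qed
  then have "emeasure lborel (confocal ` Y) \<le> emeasure lborel (cbox (Complex 0 l) (Complex 1 (l + X)))"
    by (intro emeasure_mono) auto
  also have "\<dots> = ennreal X"
    using X by (subst emeasure_lborel_cbox) (auto simp: Basis_complex_def)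
  finally show ?thesis by (simp add: X_def)
qed

text \<open>The area of the metric is the Euclidean area of the images of the two sides under their
  confocal maps. Each image fits in a box of width 1 whose height is governed by
  \<open>aspect\<close>.\<close>

lemma rho_area_metric:
  "rho_area (\<lambda>z. ennreal (metric z) * indicator (ball 0 1) z) \<le> ennreal (2 * (ln (4 * aspect + 2) / pi))"
proof -
  define D1 where "D1 = {z \<in> ball 0 1. norm (z - cis \<beta>) \<le> mid * norm (z - cis \<alpha>)}"
  define D2 where "D2 = ball 0 1 - D1"
  have "closed {z. norm (z - cis \<beta>) \<le> mid * norm (z - cis \<alpha>)}"
    by (intro closed_Collect_le continuous_intros)
  moreover have "D1 = ball 0 1 \<inter> {z. norm (z - cis \<beta>) \<le> mid * norm (z - cis \<alpha>)}"
    by (auto simp: D1_def)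
  ultimately have D: "D1 \<in> sets borel" "D2 \<in> sets borel" "D1 \<subseteq> ball 0 1" "D2 \<subseteq> ball 0 1"
    by (auto simp: D2_def)
  have D1: "norm (moeb z) \<le> mid" if "z \<in> D1" for z
    using that norm_moeb_le_mid_iff[of z] moeb_neq_center[of z] by (auto simp: D1_def)
  have D2: "mid \<le> norm (moeb z)" if "z \<in> D2" for z
    using that norm_moeb_le_mid_iff[of z] moeb_neq_center[of z] by (auto simp: D1_def D2_def)
  define X where "X = ln (4 * aspect + 2) / pi"
  have "0 < aspect" using ratio_pos by (simp add: aspect_def)
  then have X: "0 \<le> X" by (simp add: X_def)
  have 1: "(\<integral>\<^sup>+ z. ennreal ((norm (deriv inner_map z))\<^sup>2) * indicator D1 z \<partial>lborel) \<le> ennreal X"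
  proof -
    have "norm (inner_coord z) \<le> aspect" if "z \<in> D1" for z
      using D1[OF that] ratio_pos unfolding mid_div(1)[symmetric]
      by (simp add: inner_coord_def norm_divide divide_right_mono)
    then have "emeasure lborel (confocal ` inner_coord ` D1) \<le> ennreal X"
      unfolding X_def using Im_inner_coord D(3) by (intro emeasure_confocal_image) auto
    then show ?thesis
      using emeasure_holomorphic_image(2)[OF open_ball inner_map_holomorphic inj_on_inner_map D(1,3)]
      by (simp add: image_image inner_map_def[abs_def])
  qed
  have 2: "(\<integral>\<^sup>+ z. ennreal ((norm (deriv outer_map z))\<^sup>2) * indicator D2 z \<partial>lborel) \<le> ennreal X"
  proof -
    have "norm (outer_coord z) \<le> aspect" if "z \<in> D2" for z
    proof -
      have "ratio \<delta> / norm (moeb z) \<le> ratio \<delta> / mid"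
        using D2[OF that] ratio_pos mid_pos by (intro divide_left_mono mult_pos_pos) linarith+
      then show ?thesis
        unfolding mid_div(2)[symmetric] using ratio_pos by (simp add: outer_coord_def norm_divide)
    qed
    then have "emeasure lborel (confocal ` outer_coord ` D2) \<le> ennreal X"
      unfolding X_def using Im_outer_coord D(4) by (intro emeasure_confocal_image) auto
    then show ?thesis
      using emeasure_holomorphic_image(2)[OF open_ball outer_map_holomorphic inj_on_outer_map D(2,4)]
      by (simp add: image_image outer_map_def[abs_def])
  qed
  have m: "(\<lambda>z. ennreal ((norm (deriv f z))\<^sup>2) * indicator E z) \<in> borel_measurable borel"
    if "f holomorphic_on ball 0 1" "E \<in> sets borel" "E \<subseteq> ball 0 1" for f :: "complex \<Rightarrow> complex" and E
  proof -
    note [measurable] = that(2)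
    have [measurable]: "(\<lambda>z. if z \<in> ball 0 1 then deriv f z else 0) \<in> borel_measurable borel"
      using that(1)
      by (intro borel_measurable_continuous_on_if holomorphic_on_imp_continuous_on holomorphic_deriv) auto
    have "(\<lambda>z. ennreal ((norm (if z \<in> ball 0 1 then deriv f z else 0))\<^sup>2) * indicator E z) \<in> borel_measurable borel"
      by measurable
    then show ?thesis
      by (rule back_subst[of "\<lambda>h. h \<in> borel_measurable borel"])
         (use that(3) in \<open>auto simp: fun_eq_iff indicator_def\<close>)
  qed
  have "rho_area (\<lambda>z. ennreal (metric z) * indicator (ball 0 1) z) =
    (\<integral>\<^sup>+ z. ennreal ((norm (deriv inner_map z))\<^sup>2) * indicator D1 z +
       ennreal ((norm (deriv outer_map z))\<^sup>2) * indicator D2 z \<partial>lborel)"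
    unfolding rho_area_def
  proof (intro nn_integral_cong)
    fix z
    show "(ennreal (metric z) * indicator (ball 0 1) z)\<^sup>2 * indicator (ball 0 1) z =
      ennreal ((norm (deriv inner_map z))\<^sup>2) * indicator D1 z + ennreal ((norm (deriv outer_map z))\<^sup>2) * indicator D2 z"
    proof (cases "z \<in> ball 0 1")
      case True
      show ?thesis
      proof (cases "z \<in> D1")
        case z: True
        then have "metric z = norm (deriv inner_map z)" "z \<notin> D2"
          using potential_cases(1)[OF True D1] by (auto simp: D2_def)
        then show ?thesis using True z by (simp add: ennreal_power)
      next
        case z: False
        then have z2: "z \<in> D2" using True by (simp add: D2_def)
        then have "metric z = norm (deriv outer_map z)"
          using potential_cases(2)[OF True D2] by auto
        then show ?thesis using True z z2 by (simp add: ennreal_power)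
      qed
    next
      case False
      then have "z \<notin> D1" "z \<notin> D2" using D by auto
      then show ?thesis using False by simp
    qed
  qed
  also have "\<dots> = (\<integral>\<^sup>+ z. ennreal ((norm (deriv inner_map z))\<^sup>2) * indicator D1 z \<partial>lborel) +
      (\<integral>\<^sup>+ z. ennreal ((norm (deriv outer_map z))\<^sup>2) * indicator D2 z \<partial>lborel)"
    using m[OF inner_map_holomorphic D(1,3)] m[OF outer_map_holomorphic D(2,4)]
    by (intro nn_integral_add) auto
  also have "\<dots> \<le> ennreal X + ennreal X"
    by (intro add_mono 1 2)
  also have "\<dots> = ennreal (2 * X)"
    using X by (simp flip: ennreal_plus)
  finally show ?thesis by (simp add: X_def)
qed

lemma extremal_width_le:
  "extremal_width (joining_paths (cis ` {\<alpha>..\<beta>}) (cis ` {\<gamma>..\<delta>})) \<le> ennreal (2 * (ln (4 * aspect + 2) / pi))"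
proof -
  define \<rho> where "\<rho> = (\<lambda>z. ennreal (metric z) * indicator (ball 0 1) z)"
  have "(\<lambda>z. indicator (ball 0 1) z * metric z) \<in> borel_measurable borel"
    using borel_measurable_continuous_on_indicator[OF _ continuous_on_metric] by simp
  then have "(\<lambda>z. ennreal (indicator (ball 0 1) z * metric z)) \<in> borel_measurable borel"
    by measurable
  then have m: "\<rho> \<in> borel_measurable borel"
    by (rule back_subst[of "\<lambda>h. h \<in> borel_measurable borel"]) (auto simp: fun_eq_iff indicator_def \<rho>_def)
  have adm: "1 \<le> rho_length \<rho> g" if "g \<in> joining_paths (cis ` {\<alpha>..\<beta>}) (cis ` {\<gamma>..\<delta>})" for g
  proof -
    have g: "valid_path g" "\<And>t. t \<in> {0<..<1} \<Longrightarrow> g t \<in> ball 0 1"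
      "g 0 \<in> cis ` {\<alpha>..\<beta>}" "g 1 \<in> cis ` {\<gamma>..\<delta>}"
      using that by (auto simp: joining_paths_def pathstart_def pathfinish_def)
    then have "potential (g 0) = 1" "potential (g 1) = 0"
      using potential_first_arc potential_second_arc by auto
    then have "1 = ennreal \<bar>potential (g 1) - potential (g 0)\<bar>" by simp
    also have "\<dots> \<le> rho_length \<rho> g"
      unfolding \<rho>_def
      by (intro rho_length_ge_local_lipschitz g(1) g(2) open_ball continuous_on_potential
          continuous_on_metric metric_nonneg potential_local_lipschitz)
    finally show ?thesis .
  qed
  have "extremal_width (joining_paths (cis ` {\<alpha>..\<beta>}) (cis ` {\<gamma>..\<delta>})) \<le> rho_area \<rho>"
    unfolding extremal_width_def using m adm by (intro Inf_lower) auto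
  also have "\<dots> \<le> ennreal (2 * (ln (4 * aspect + 2) / pi))"
    unfolding \<rho>_def by (rule rho_area_metric)
  finally show ?thesis .
qed

end

section \<open>Cross ratios\<close>

text \<open>Half the Euclidean distance between \<open>cis s\<close> and \<open>cis t\<close>. The
  absolute value removes the sign changes of the sine under swapping the points or shifting one by a
  full turn.\<close>

definition chord :: "real \<Rightarrow> real \<Rightarrow> real" where
  "chord s t = \<bar>sin ((s - t) / 2)\<bar>"

definition log_cross_ratio :: "real \<Rightarrow> real \<Rightarrow> real \<Rightarrow> real \<Rightarrow> real" where
  "log_cross_ratio \<alpha> \<beta> \<gamma> \<delta> = ln (chord \<delta> \<beta> * chord \<gamma> \<alpha> / (chord \<delta> \<alpha> * chord \<gamma> \<beta>)) / pi"

lemma chord_commute: "chord s t = chord t s"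
proof -
  have "sin ((t - s) / 2) = - sin ((s - t) / 2)"
    by (simp flip: sin_minus add: minus_divide_left)
  then show ?thesis by (simp add: chord_def)
qed

lemma chord_eq_sin: "t < s \<Longrightarrow> s < t + 2 * pi \<Longrightarrow> chord s t = sin ((s - t) / 2)"
proof -
  assume "t < s" "s < t + 2 * pi"
  then have "0 < sin ((s - t) / 2)" by (intro sin_gt_zero) auto
  then show ?thesis by (simp add: chord_def)
qed

lemma chord_pos: "t < s \<Longrightarrow> s < t + 2 * pi \<Longrightarrow> 0 < chord s t"
proof -
  assume *: "t < s" "s < t + 2 * pi"
  then have "0 < sin ((s - t) / 2)" by (intro sin_gt_zero) auto
  then show ?thesis by (simp add: chord_eq_sin *)
qed

lemma chord_add_2pi: "chord (s + 2 * pi) t = chord s t"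
proof -
  have "(s + 2 * pi - t) / 2 = (s - t) / 2 + pi" by (simp add: field_simps)
  then show ?thesis unfolding chord_def by (simp only: sin_periodic_pi abs_minus_cancel)
qed

lemma log_cross_ratio_commute: "log_cross_ratio \<alpha> \<beta> \<gamma> \<delta> = log_cross_ratio \<gamma> \<delta> \<alpha> \<beta>"
  unfolding log_cross_ratio_def
  by (simp add: chord_commute[of \<delta> \<beta>] chord_commute[of \<gamma> \<alpha>] chord_commute[of \<delta> \<alpha>]
      chord_commute[of \<gamma> \<beta>] mult.commute)

lemma log_cross_ratio_add_2pi:
  "log_cross_ratio \<alpha> \<beta> (\<gamma> + 2 * pi) (\<delta> + 2 * pi) = log_cross_ratio \<alpha> \<beta> \<gamma> \<delta>"
  by (simp add: log_cross_ratio_def chord_add_2pi)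

text \<open>Only the first index \<open>m\<close> in \<open>A\<close> is paid with the bound 2. Past
  it the distance has grown by at least \<open>a\<close>, so \<open>d (Suc m) >= a\<close>. By
  monotonicity the skipped indices may be added back, and the telescoped sum is at most
  \<open>a / d (Suc m) <= 1\<close>.\<close>

lemma telescope_charge:
  fixes d :: "nat \<Rightarrow> real"
  assumes A: "A \<subseteq> {l..<r}" and pos: "\<And>n. l \<le> n \<Longrightarrow> n \<le> r \<Longrightarrow> 0 < d n"
    and mono: "\<And>n. l \<le> n \<Longrightarrow> n < r \<Longrightarrow> d n \<le> d (Suc n)"
    and a: "0 < a" and gap: "\<And>n. n \<in> A \<Longrightarrow> a \<le> d (Suc n) - d n"
    and c: "0 \<le> c" and f2: "\<And>n. n \<in> A \<Longrightarrow> f n \<le> 2"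
    and f: "\<And>n. n \<in> A \<Longrightarrow> f n \<le> c * (a * (1 / d n - 1 / d (Suc n)))"
  shows "sum f A \<le> 2 + c"
proof (cases "A = {}")
  case True
  then show ?thesis using c by simp
next
  case False
  have fin: "finite A" using A finite_subset by blast
  define m where "m = Min A"
  have m: "m \<in> A" using False fin by (simp add: m_def)
  have lm: "l \<le> m" "m < r" using A m by auto
  have term_nonneg: "0 \<le> c * (a * (1 / d n - 1 / d (Suc n)))" if "n \<in> {Suc m..<r}" for n
    using that lm a c mono[of n] pos[of n] pos[of "Suc n"]
    by (intro mult_nonneg_nonneg) (auto intro!: divide_left_mono)
  have "sum f (A - {m}) \<le> (\<Sum>n\<in>A - {m}. c * (a * (1 / d n - 1 / d (Suc n))))"
    by (intro sum_mono f) auto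
  also have "\<dots> \<le> (\<Sum>n\<in>{Suc m..<r}. c * (a * (1 / d n - 1 / d (Suc n))))"
  proof (rule sum_mono2)
    have "m < n" if "n \<in> A - {m}" for n
      using Min_le[OF fin, of n] that by (auto simp: m_def)
    moreover have "n < r" if "n \<in> A - {m}" for n
      using that A by auto
    ultimately show "A - {m} \<subseteq> {Suc m..<r}"
      by (metis Suc_le_eq atLeastLessThan_iff subsetI)
  qed (use term_nonneg in auto)
  also have "\<dots> = c * (a * (\<Sum>n\<in>{Suc m..<r}. 1 / d n - 1 / d (Suc n)))"
    by (simp only: sum_distrib_left)
  also have "(\<Sum>n\<in>{Suc m..<r}. 1 / d n - 1 / d (Suc n)) = 1 / d (Suc m) - 1 / d r"
    using sum_Suc_diff'[of "Suc m" r "\<lambda>n. - (1 / d n)"] lm by (simp add: Suc_le_eq)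
  also have "c * (a * (1 / d (Suc m) - 1 / d r)) \<le> c * 1"
  proof (intro mult_left_mono c)
    have "a * (1 / d (Suc m) - 1 / d r) \<le> a * (1 / d (Suc m))"
      using a pos[of r] lm by (intro mult_left_mono) auto
    also have "\<dots> \<le> 1"
      using gap[OF m] pos[of m] pos[of "Suc m"] lm by simp
    finally show "a * (1 / d (Suc m) - 1 / d r) \<le> 1" .
  qed
  finally have "sum f (A - {m}) \<le> c" by simp
  moreover have "sum f A = f m + sum f (A - {m})"
    using fin m by (simp add: sum.remove)
  ultimately show ?thesis using f2[OF m] by simp
qed

text \<open>The cross ratio equals \<open>1 + u * v / ((d + u + v) * d)\<close>. Beyond
  \<open>ln (1 + x) <= x\<close>, dropping \<open>u\<close> from the denominator makes the bound
  telescope as consecutive intervals of length \<open>v\<close> are passed, with \<open>u\<close>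
  fixed.\<close>

lemma ln_cross_ratio_le:
  fixes d u v :: real
  assumes "0 < d" "0 < u" "0 < v"
  shows "ln ((d + v) * (d + u) / ((d + u + v) * d)) \<le> u * (1 / d - 1 / (d + v))"
proof -
  have "(d + v) * (d + u) = (d + u + v) * d + u * v"
    by (simp add: algebra_simps)
  moreover have "(d + u + v) * d \<noteq> 0"
    using assms by simp
  ultimately have "(d + v) * (d + u) / ((d + u + v) * d) = 1 + u * v / ((d + u + v) * d)"
    by (simp only: add_divide_distrib divide_self not_False_eq_True)
  also have "ln \<dots> \<le> u * v / ((d + u + v) * d)"
    using assms by (intro ln_add_one_self_le_self) auto
  also have "\<dots> \<le> u * v / ((d + v) * d)"
    using assms by (intro divide_left_mono mult_right_mono mult_pos_pos) auto
  also have "\<dots> = u * (1 / d - 1 / (d + v))"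
    using assms by (simp add: divide_simps)
  finally show ?thesis .
qed

lemma sum_Un_le_nonneg:
  fixes g :: "'a \<Rightarrow> real"
  assumes "finite A" "finite B" "\<And>x. x \<in> A \<inter> B \<Longrightarrow> 0 \<le> g x"
  shows "sum g (A \<union> B) \<le> sum g A + sum g B"
  using sum.union_inter[OF assms(1,2), of g] sum_nonneg[of "A \<inter> B" g] assms(3) by simp

text \<open>Each pair is charged to the shorter of its two intervals. Seen from that interval, at most
  one longer interval is nearer than its own length, and the contributions of the others telescope.\<close>

lemma sum_min_line:
  fixes x :: "nat \<Rightarrow> real" and lc :: "nat \<Rightarrow> nat \<Rightarrow> real"
  assumes inc: "\<And>i j. a \<le> i \<Longrightarrow> i < j \<Longrightarrow> j \<le> b \<Longrightarrow> x i < x j"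
    and lc: "\<And>m n. a \<le> m \<Longrightarrow> m + 2 \<le> n \<Longrightarrow> n < b \<Longrightarrow> lc m n =
      ln ((x (Suc n) - x (Suc m)) * (x n - x m) / ((x (Suc n) - x m) * (x n - x (Suc m)))) / pi"
    and nonneg: "\<And>m n. a \<le> m \<Longrightarrow> m + 2 \<le> n \<Longrightarrow> n < b \<Longrightarrow> 0 \<le> lc m n"
  shows "(\<Sum>(m, n)\<in>{(m, n). a \<le> m \<and> m + 2 \<le> n \<and> n < b}. min (lc m n) 2) \<le> 6 * real b"
proof -
  define len where "len = (\<lambda>i. x (Suc i) - x i)"
  define P where "P = {(m, n). a \<le> m \<and> m + 2 \<le> n \<and> n < b}"
  define A where "A = (\<lambda>m. {n. (m, n) \<in> P \<and> len m \<le> len n})"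
  define B where "B = (\<lambda>n. {m. (m, n) \<in> P \<and> len n \<le> len m})"
  define g where "g = (\<lambda>(m, n). min (lc m n) 2)"
  have fin: "finite (A m)" "finite (B m)" for m
    by (rule finite_subset[of _ "{..<b}"]; auto simp: A_def B_def P_def)+
  have len_pos: "0 < len i" if "a \<le> i" "i < b" for i
    using inc[of i "Suc i"] that by (simp add: len_def)
  have right: "lc m n \<le> 1 / pi * (len m * (1 / (x n - x (Suc m)) - 1 / (x (Suc n) - x (Suc m))))"
    and left: "lc m n \<le> 1 / pi * (len n * (1 / (x n - x (Suc m)) - 1 / (x n - x m)))"
    if mn: "a \<le> m" "m + 2 \<le> n" "n < b" for m n
  proof -
    define d where "d = x n - x (Suc m)"
    have d: "0 < d" using inc[of "Suc m" n] mn by (simp add: d_def)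
    have l: "0 < len m" "0 < len n" using len_pos mn by auto
    have eqs: "x (Suc n) - x (Suc m) = d + len n" "x n - x m = d + len m" "x n - x (Suc m) = d"
      by (simp_all add: d_def len_def)
    have D: "x (Suc n) - x m = d + len m + len n" by (simp add: d_def len_def)
    have e: "lc m n = ln ((d + len n) * (d + len m) / ((d + len m + len n) * d)) / pi"
      using lc[OF mn] unfolding eqs D .
    show "lc m n \<le> 1 / pi * (len m * (1 / (x n - x (Suc m)) - 1 / (x (Suc n) - x (Suc m))))"
      unfolding eqs e using ln_cross_ratio_le[OF d l] by (simp add: divide_right_mono)
    have "lc m n = ln ((d + len m) * (d + len n) / ((d + len n + len m) * d)) / pi"
      unfolding e by (simp only: ac_simps)
    then show "lc m n \<le> 1 / pi * (len n * (1 / (x n - x (Suc m)) - 1 / (x n - x m)))"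
      unfolding eqs using ln_cross_ratio_le[OF d l(2,1)] by (simp add: divide_right_mono)
  qed
  have pi1: "1 / pi \<le> 1" using pi_ge_two by simp
  have sumA: "(\<Sum>n\<in>A m. g (m, n)) \<le> 3" for m
  proof (cases "a \<le> m \<and> m + 2 < b")
    case True
    have "(\<Sum>n\<in>A m. g (m, n)) \<le> 2 + 1 / pi"
    proof (rule telescope_charge[where d = "\<lambda>n. x n - x (Suc m)" and a = "len m" and l = "m + 2" and r = b])
      show "A m \<subseteq> {m + 2..<b}" by (auto simp: A_def P_def)
      show "0 < x n - x (Suc m)" if "m + 2 \<le> n" "n \<le> b" for n
        using inc[of "Suc m" n] that True by simp
      show "x n - x (Suc m) \<le> x (Suc n) - x (Suc m)" if "m + 2 \<le> n" "n < b" for n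
        using inc[of n "Suc n"] that True by simp
      show "0 < len m" using len_pos True by simp
      show "len m \<le> x (Suc n) - x (Suc m) - (x n - x (Suc m))" if "n \<in> A m" for n
        using that by (simp add: A_def len_def)
      show "g (m, n) \<le> 1 / pi * (len m * (1 / (x n - x (Suc m)) - 1 / (x (Suc n) - x (Suc m))))"
        if "n \<in> A m" for n
      proof -
        have "g (m, n) \<le> lc m n" by (simp add: g_def)
        also have "\<dots> \<le> 1 / pi * (len m * (1 / (x n - x (Suc m)) - 1 / (x (Suc n) - x (Suc m))))"
          using that by (intro right) (auto simp: A_def P_def)
        finally show ?thesis .
      qed
    qed (auto simp: g_def)
    then show ?thesis using pi1 by linarith
  next
    case False
    then have "A m = {}" by (auto simp: A_def P_def)
    then show ?thesis by simp
  qed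
  have sumB: "(\<Sum>m\<in>B n. g (m, n)) \<le> 3" for n
  proof (cases "a + 2 \<le> n \<and> n < b")
    case True
    \<comment> \<open>Leftward neighbours are renumbered by \<open>i = n - 1 - m\<close>, so that
      the distance increases with \<open>i\<close>: \<open>n - i\<close> is the near end
      \<open>Suc m\<close> of interval \<open>m\<close> and \<open>n - Suc i\<close> is its far end
      \<open>m\<close>.\<close>
    have bij: "bij_betw (\<lambda>m. n - 1 - m) (B n) ((\<lambda>m. n - 1 - m) ` B n)"
      by (intro inj_on_imp_bij_betw inj_onI) (auto simp: B_def P_def)
    have "(\<Sum>m\<in>B n. g (m, n)) = (\<Sum>i\<in>(\<lambda>m. n - 1 - m) ` B n. g (n - 1 - i, n))"
      by (subst sum.reindex_bij_betw[OF bij, symmetric])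
         (auto intro!: sum.cong arg_cong[of _ _ g] simp: B_def P_def)
    also have "\<dots> \<le> 2 + 1 / pi"
    proof (rule telescope_charge[where d = "\<lambda>i. x n - x (n - i)" and a = "len n" and l = 1 and r = "n - a"])
      show "(\<lambda>m. n - 1 - m) ` B n \<subseteq> {1..<n - a}" by (auto simp: B_def P_def)
      show "0 < x n - x (n - i)" if "1 \<le> i" "i \<le> n - a" for i
        using inc[of "n - i" n] that True by simp
      show "x n - x (n - i) \<le> x n - x (n - Suc i)" if "1 \<le> i" "i < n - a" for i
      proof -
        have "x (n - Suc i) < x (n - i)" using that True by (intro inc) auto
        then show ?thesis by simp
      qed
      show "0 < len n" using len_pos True by simp
      fix i assume "i \<in> (\<lambda>m. n - 1 - m) ` B n"
      then obtain m where m: "m \<in> B n" "i = n - 1 - m" by auto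
      then have mn: "a \<le> m" "m + 2 \<le> n" "n < b" "len n \<le> len m" by (auto simp: B_def P_def)
      have idx: "n - 1 - i = m" "n - i = Suc m" "n - Suc i = m" using m(2) mn by auto
      show "len n \<le> x n - x (n - Suc i) - (x n - x (n - i))"
        using mn(4) unfolding idx by (simp add: len_def)
      show "g (n - 1 - i, n) \<le> 1 / pi * (len n * (1 / (x n - x (n - i)) - 1 / (x n - x (n - Suc i))))"
        unfolding idx using left[OF mn(1-3)] by (simp add: g_def)
    qed (auto simp: g_def)
    finally show ?thesis using pi1 by linarith
  next
    case False
    then have "B n = {}" by (auto simp: B_def P_def)
    then show ?thesis by simp
  qed
  \<comment> \<open>Pairs of equal lengths belong to both families; as their terms are nonnegative,
    the double count only increases the bound.\<close>
  define SA where "SA = Sigma {..<b} A"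
  define SB where "SB = (\<lambda>(n, m). (m, n)) ` Sigma {..<b} B"
  have "P \<subseteq> SA \<union> SB" "SA \<union> SB \<subseteq> P"
    by (fastforce simp: SA_def SB_def A_def B_def P_def image_iff)+
  then have "sum g P = sum g (SA \<union> SB)" by (simp add: subset_antisym)
  also have "\<dots> \<le> sum g SA + sum g SB"
  proof (rule sum_Un_le_nonneg)
    show "0 \<le> g z" if "z \<in> SA \<inter> SB" for z
      using that nonneg by (auto simp: SA_def A_def P_def g_def)
  qed (auto simp: SA_def SB_def fin)
  also have "sum g SA = (\<Sum>m<b. \<Sum>n\<in>A m. g (m, n))"
    unfolding SA_def using fin by (subst sum.Sigma) (auto simp: case_prod_unfold)
  also have "sum g SB = (\<Sum>n<b. \<Sum>m\<in>B n. g (m, n))"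
    unfolding SB_def using fin
    by (subst sum.reindex) (auto simp: inj_on_def sum.Sigma case_prod_unfold)
  also have "(\<Sum>m<b. \<Sum>n\<in>A m. g (m, n)) + (\<Sum>n<b. \<Sum>m\<in>B n. g (m, n)) \<le> (\<Sum>m<b. 3) + (\<Sum>n<b. 3)"
    by (intro add_mono sum_mono sumA sumB)
  also have "\<dots> = 6 * real b" by simp
  finally show ?thesis by (simp add: P_def g_def)
qed

section \<open>Ideal markings\<close>

text \<open>The number 20 serves twice: \<open>4 * T + 2 <= 20\<close> for \<open>T <= 9/2\<close>
  forces width at most 2, and \<open>(40/9)\<^sup>2 <= 20\<close> forces excess at most 1 beyond.
  The eighth root makes a quadratic Taylor bound precise enough.\<close>

lemma exp_pi_ge_20: "20 \<le> exp pi"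
proof -
  have "(39/100 :: real) \<le> pi / 8" using pi_approx by simp
  then have "exp (39/100 :: real) \<le> exp (pi / 8)" by simp
  moreover have "1 + 39/100 + (39/100)\<^sup>2 / 2 \<le> exp (39/100 :: real)"
    by (rule exp_lower_Taylor_quadratic) simp
  moreover have "73/50 \<le> 1 + 39/100 + (39/100 :: real)\<^sup>2 / 2" by (simp add: power2_eq_square)
  ultimately have "73/50 \<le> exp (pi / 8)" by linarith
  then have "(73/50) ^ 8 \<le> exp (pi / 8) ^ 8"
    by (intro power_mono) auto
  also have "exp (pi / 8) ^ 8 = exp pi"
    by (simp flip: exp_of_nat_mult)
  finally have "(73/50) ^ 8 \<le> exp pi" .
  moreover have "20 \<le> (73/50 :: real) ^ 8" by (simp add: power_divide)
  ultimately show ?thesis by linarith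
qed

context arc_pair
begin

lemma log_ratio_eq: "log_ratio = log_cross_ratio \<alpha> \<beta> \<gamma> \<delta>"
proof -
  have "chord \<delta> \<beta> = sin ((\<delta> - \<beta>) / 2)" "chord \<gamma> \<alpha> = sin ((\<gamma> - \<alpha>) / 2)"
    "chord \<delta> \<alpha> = sin ((\<delta> - \<alpha>) / 2)" "chord \<gamma> \<beta> = sin ((\<gamma> - \<beta>) / 2)"
    using order by (auto intro!: chord_eq_sin)
  then show ?thesis
    by (simp add: log_ratio_def log_cross_ratio_def ratio_def divide_divide_times_eq)
qed

lemma ln_aspect: "ln aspect = pi * log_ratio / 2"
  using ratio_pos by (simp add: aspect_def log_ratio_def ln_sqrt)

lemma aspect_ge_1: "1 \<le> aspect"
  using ratio_pos by (simp add: aspect_def)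

lemma extremal_width_real:
  defines "w \<equiv> extremal_width (joining_paths (cis ` {\<alpha>..\<beta>}) (cis ` {\<gamma>..\<delta>}))"
  shows "w = ennreal (enn2real w)" "log_ratio \<le> enn2real w" "enn2real w \<le> log_ratio + 2"
    "2 < enn2real w \<Longrightarrow> enn2real w \<le> log_ratio + 1"
proof -
  define T where "T = aspect"
  have T: "1 \<le> T" "ln T = pi * log_ratio / 2" using ln_aspect aspect_ge_1 by (auto simp: T_def)
  have fin: "w < top"
    using extremal_width_le unfolding w_def by (rule le_less_trans) simp
  then show wr: "w = ennreal (enn2real w)" by simp
  have "ennreal log_ratio \<le> ennreal (enn2real w)"
    using extremal_width_ge_log_ratio wr by (simp add: w_def)
  then show "log_ratio \<le> enn2real w" by simp
  have ln20: "ln 20 \<le> pi"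
    using ln_mono[OF exp_pi_ge_20] by simp
  have "0 < 4 * T + 2" using T by simp
  then have pos: "0 \<le> 2 * (ln (4 * T + 2) / pi)" using T by simp
  have "ennreal (enn2real w) \<le> ennreal (2 * (ln (4 * T + 2) / pi))"
    using extremal_width_le wr by (simp add: w_def T_def)
  then have up: "enn2real w \<le> 2 * (ln (4 * T + 2) / pi)"
    using pos by simp
  \<comment> \<open>A bound \<open>q * T\<close> in place of \<open>4 * T + 2\<close> turns the
    estimate into \<open>log_ratio\<close> plus a constant: \<open>q = 6\<close> is valid for all
    \<open>T >= 1\<close>, and \<open>q = 40/9\<close> from \<open>T = 9/2\<close> on.\<close>
  have scaled: "2 * (ln (4 * T + 2) / pi) \<le> log_ratio + 2 * ln q / pi" if "0 < q" "4 * T + 2 \<le> q * T" for q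
  proof -
    have "ln (4 * T + 2) \<le> ln (q * T)"
      using that T by (intro ln_mono) auto
    also have "\<dots> = ln q + pi * log_ratio / 2"
      using that T by (simp add: ln_mult)
    finally have "2 * (ln (4 * T + 2) / pi) \<le> 2 * ((ln q + pi * log_ratio / 2) / pi)"
      by (intro mult_left_mono divide_right_mono) auto
    also have "\<dots> = log_ratio + 2 * ln q / pi"
      by (simp add: add_divide_distrib)
    finally show ?thesis .
  qed
  have "ln 6 \<le> ln (20 :: real)" by (intro ln_mono) auto
  then have "ln 6 \<le> pi" using ln20 by linarith
  then have "2 * ln 6 / pi \<le> 2" by (simp add: divide_le_eq)
  then show "enn2real w \<le> log_ratio + 2"
    using up scaled[of 6] T by simp
  show "enn2real w \<le> log_ratio + 1" if "2 < enn2real w"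
  \<comment> \<open>For small \<open>T\<close> the upper bound is at most 2, against the hypothesis;
    at \<open>T = 9/2\<close> it is \<open>2 * ln 20 / pi\<close>.\<close>
  proof (cases "T \<le> 9 / 2")
    case True
    then have "ln (4 * T + 2) \<le> ln 20" using T by (intro ln_mono) auto
    then have "ln (4 * T + 2) \<le> pi" using ln20 by linarith
    then have "2 * (ln (4 * T + 2) / pi) \<le> 2" by (simp add: divide_le_eq)
    then show ?thesis using that up by linarith
  next
    case False
    have "2 * ln (40 / 9) = ln ((40 / 9)\<^sup>2 :: real)" by (simp add: ln_realpow)
    also have "\<dots> \<le> ln 20" by (intro ln_mono) (auto simp: power2_eq_square)
    finally have "2 * ln (40 / 9) / pi \<le> 1" using ln20 by (simp add: divide_le_eq)
    moreover have "2 * (ln (4 * T + 2) / pi) \<le> log_ratio + 2 * ln (40 / 9) / pi"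
      using False by (intro scaled) auto
    ultimately show ?thesis using up by linarith
  qed
qed

end

lemma Union_consecutive:
  fixes f :: "nat \<Rightarrow> real"
  assumes "\<And>i j. i \<le> j \<Longrightarrow> f i \<le> f j" "a < b"
  shows "(\<Union>j\<in>{a..<b}. {f j..f (Suc j)}) = {f a..f b}"
proof -
  have "(\<Union>j\<in>{a..<Suc (a + d)}. {f j..f (Suc j)}) = {f a..f (Suc (a + d))}" for d
  proof (induction d)
    case (Suc d)
    have "{a..<Suc (a + Suc d)} = insert (Suc (a + d)) {a..<Suc (a + d)}" by auto
    then show ?case
      using Suc ivl_disj_un_two_touch(4)[of "f a" "f (Suc (a + d))" "f (Suc (a + Suc d))"] assms(1)
      by (simp add: Un_commute)
  qed simp
  from this[of "b - Suc a"] show ?thesis using assms(2) by simp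
qed

section \<open>Cyclic indices and their lift to the line\<close>

locale marking =
  fixes p :: nat and \<theta> :: "nat \<Rightarrow> real"
  assumes p_ge_4: "4 \<le> p" and marking: "ideal_marking p \<theta>"
begin

text \<open>The marking points continued over further turns, a strictly increasing sequence.
  Starting from any \<open>n\<close> the arcs \<open>n + j\<close> are then in linear order, with no
  case distinction where the indices wrap around.\<close>

definition angle :: "nat \<Rightarrow> real" where
  "angle k = \<theta> (k mod p) + 2 * pi * real (k div p)"

lemma angle_eq: "k \<le> p \<Longrightarrow> angle k = \<theta> k"
  using marking p_ge_4 by (cases "k = p") (auto simp: angle_def ideal_marking_def)

lemma angle_Suc: "angle (Suc k) = \<theta> (Suc (k mod p)) + 2 * pi * real (k div p)"
proof (cases "Suc (k mod p) = p")
  case True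
  then have "Suc k mod p = 0" "Suc k div p = Suc (k div p)"
    by (auto simp: mod_Suc div_Suc)
  then show ?thesis using True marking by (simp add: angle_def ideal_marking_def algebra_simps)
next
  case False
  then have "Suc k mod p = Suc (k mod p)" "Suc k div p = k div p"
    by (auto simp: mod_Suc div_Suc)
  then show ?thesis by (simp add: angle_def)
qed

lemma angle_add: "angle (k + p) = angle k + 2 * pi"
  using p_ge_4 by (simp add: angle_def algebra_simps)

lemma angle_less: "i < j \<Longrightarrow> angle i < angle j"
proof (rule lift_Suc_mono_less[of angle])
  fix k
  have "k mod p < p" using p_ge_4 by simp
  then have "\<theta> (k mod p) < \<theta> (Suc (k mod p))" using marking by (simp add: ideal_marking_def)
  then show "angle k < angle (Suc k)" unfolding angle_Suc by (simp add: angle_def)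
qed

lemma marking_arc_mod: "marking_arc \<theta> (k mod p) = cis ` {angle k..angle (Suc k)}"
proof -
  define c where "c = 2 * pi * real (k div p)"
  have c: "cis (t + c) = cis t" for t
  proof -
    have "cis c = 1" unfolding c_def using cis_multiple_2pi[of "real (k div p)"] by simp
    then show ?thesis by (simp flip: cis_mult)
  qed
  have "cis ` {angle k..angle (Suc k)} = cis ` (\<lambda>t. t + c) ` {\<theta> (k mod p)..\<theta> (Suc (k mod p))}"
    unfolding image_add_atLeastAtMost' angle_Suc angle_def[of k] c_def ..
  also have "\<dots> = marking_arc \<theta> (k mod p)"
    by (simp only: image_image c marking_arc_def)
  finally show ?thesis by simp
qed

lemma nonadjacent_eq:
  assumes "n < p"
  shows "{k. nonadjacent p n k} = (\<lambda>j. (n + j) mod p) ` {2..<p - 1}"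
proof (intro equalityI subsetI)
  fix k assume "k \<in> {k. nonadjacent p n k}"
  then have k: "k < p" "n \<noteq> k" "Suc n mod p \<noteq> k" "Suc k mod p \<noteq> n"
    by (auto simp: nonadjacent_def)
  show "k \<in> (\<lambda>j. (n + j) mod p) ` {2..<p - 1}"
  proof (cases "n < k")
    case True
    then have "Suc n \<noteq> k" using k by auto
    moreover have "k - n \<noteq> p - 1"
    proof
      assume "k - n = p - 1"
      then have "k = p - 1" "n = 0" using k True by auto
      then show False using k(4) p_ge_4 by simp
    qed
    ultimately have "k - n \<in> {2..<p - 1}" using True k by auto
    moreover have "k = (n + (k - n)) mod p" using True k by simp
    ultimately show ?thesis by (rule rev_image_eqI)
  next
    case False
    then have "k < n" using k by simp
    have "Suc k \<noteq> n" using k(4) assms by auto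
    moreover have "p + k - n \<noteq> 1"
    proof
      assume "p + k - n = 1"
      then have "n = p - 1" "k = 0" using assms by auto
      then show False using k(3) p_ge_4 by simp
    qed
    ultimately have "p + k - n \<in> {2..<p - 1}" using \<open>k < n\<close> assms by auto
    moreover have "k = (n + (p + k - n)) mod p" using \<open>k < n\<close> k assms by simp
    ultimately show ?thesis by (rule rev_image_eqI)
  qed
next
  fix k assume "k \<in> (\<lambda>j. (n + j) mod p) ` {2..<p - 1}"
  then obtain j where j: "2 \<le> j" "j < p - 1" "k = (n + j) mod p" by auto
  show "k \<in> {k. nonadjacent p n k}"
  proof (cases "n + j < p")
    case True
    then show ?thesis using j assms by (auto simp: nonadjacent_def mod_Suc)
  next
    case False
    then have "k = n + j - p" using j assms by (simp add: mod_if)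
    then show ?thesis using j assms False by (auto simp: nonadjacent_def mod_Suc)
  qed
qed

lemma inj_on_shift: "inj_on (\<lambda>j. (n + j) mod p) {2..<p - 1}" if "n < p"
proof (rule inj_onI)
  fix i j assume ij: "i \<in> {2..<p - 1}" "j \<in> {2..<p - 1}" "(n + i) mod p = (n + j) mod p"
  then show "i = j" using that by (auto simp: mod_if split: if_splits)
qed

lemma sum_nonadjacent:
  fixes F :: "nat \<Rightarrow> real"
  assumes "n < p"
  shows "(\<Sum>k\<in>{k. nonadjacent p n k}. F k) = (\<Sum>j\<in>{2..<p - 1}. F ((n + j) mod p))"
  unfolding nonadjacent_eq[OF assms] by (subst sum.reindex[OF inj_on_shift[OF assms]]) (simp add: o_def)

lemma arc_pair_shift:
  assumes "2 \<le> i" "i < j" "j \<le> p - 1"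
  shows "arc_pair (angle n) (angle (Suc n)) (angle (n + i)) (angle (n + j))"
proof
  show "angle (n + j) < angle n + 2 * pi"
    unfolding angle_add[symmetric] using assms p_ge_4 by (intro angle_less) auto
qed (use assms in \<open>auto intro!: angle_less\<close>)

text \<open>The quantity \<open>L\<close> for two marking arcs. It uses the original indices to be
  symmetric in the pair; periodicity of the chords reconciles it with the lifted angles.\<close>

definition pair_log :: "nat \<Rightarrow> nat \<Rightarrow> real" where
  "pair_log m n = log_cross_ratio (\<theta> m) (\<theta> (Suc m)) (\<theta> n) (\<theta> (Suc n))"

definition width_real :: "nat \<Rightarrow> nat \<Rightarrow> real" where
  "width_real m n = enn2real (extremal_width (joining_paths (marking_arc \<theta> m) (marking_arc \<theta> n)))"

lemma pair_log_commute: "pair_log m n = pair_log n m"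
  unfolding pair_log_def by (rule log_cross_ratio_commute)

lemma width_real_commute: "width_real m n = width_real n m"
  unfolding width_real_def by (subst extremal_width_commute) simp

lemma pair_log_shift:
  assumes "n < p" "2 \<le> j" "j < p - 1"
  shows "log_cross_ratio (angle n) (angle (Suc n)) (angle (n + j)) (angle (n + Suc j)) = pair_log n ((n + j) mod p)"
proof (cases "n + j < p")
  case True
  then show ?thesis using assms by (simp add: pair_log_def angle_eq)
next
  case False
  define k where "k = n + j - p"
  have k: "k < p" "(n + j) mod p = k" "n + j = k + p" "n + Suc j = Suc k + p"
    using False assms by (auto simp: k_def mod_if)
  have "angle (k + p) = \<theta> k + 2 * pi" "angle (Suc k + p) = \<theta> (Suc k) + 2 * pi"
    unfolding angle_add using k by (auto simp: angle_eq)
  moreover have "angle n = \<theta> n" "angle (Suc n) = \<theta> (Suc n)"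
    using assms by (auto simp: angle_eq)
  ultimately have "log_cross_ratio (angle n) (angle (Suc n)) (angle (k + p)) (angle (Suc k + p)) = pair_log n k"
    by (simp only: pair_log_def log_cross_ratio_add_2pi)
  then show ?thesis unfolding k(2) by (simp only: k(3,4))
qed

lemma pair_bounds:
  assumes "nonadjacent p n k"
  shows "extremal_width (joining_paths (marking_arc \<theta> n) (marking_arc \<theta> k)) = ennreal (width_real n k)"
    "0 < pair_log n k" "pair_log n k \<le> width_real n k" "2 < width_real n k \<Longrightarrow> width_real n k \<le> pair_log n k + 1"
proof -
  have n: "n < p" using assms by (simp add: nonadjacent_def)
  obtain j where j: "2 \<le> j" "j < p - 1" "k = (n + j) mod p"
  proof -
    have "k \<in> {k. nonadjacent p n k}" using assms by simp
    then show thesis unfolding nonadjacent_eq[OF n] using that by auto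
  qed
  interpret arc_pair "angle n" "angle (Suc n)" "angle (n + j)" "angle (n + Suc j)"
    using j by (intro arc_pair_shift) auto
  have arcs: "marking_arc \<theta> n = cis ` {angle n..angle (Suc n)}" "marking_arc \<theta> k = cis ` {angle (n + j)..angle (n + Suc j)}"
    using marking_arc_mod[of n] marking_arc_mod[of "n + j"] n j(3) by simp_all
  have lr: "log_ratio = pair_log n k"
    unfolding log_ratio_eq j(3) by (rule pair_log_shift[OF n j(1,2)])
  show "extremal_width (joining_paths (marking_arc \<theta> n) (marking_arc \<theta> k)) = ennreal (width_real n k)"
    "0 < pair_log n k" "pair_log n k \<le> width_real n k" "2 < width_real n k \<Longrightarrow> width_real n k \<le> pair_log n k + 1"
    using extremal_width_real log_ratio_pos unfolding width_real_def arcs lr by auto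
qed

definition target :: "nat \<Rightarrow> complex set" where
  "target n = (\<Union>k\<in>{k. nonadjacent p n k}. marking_arc \<theta> k)"

definition local_width_real :: "nat \<Rightarrow> real" where
  "local_width_real n = enn2real (extremal_width (joining_paths (marking_arc \<theta> n) (target n)))"

lemma target_eq:
  assumes "n < p"
  shows "target n = cis ` {angle (n + 2)..angle (n + (p - 1))}"
proof -
  have "target n = (\<Union>j\<in>{2..<p - 1}. cis ` {angle (n + j)..angle (n + Suc j)})"
    unfolding target_def nonadjacent_eq[OF assms] by (simp add: marking_arc_mod)
  also have "\<dots> = cis ` (\<Union>j\<in>{2..<p - 1}. {angle (n + j)..angle (n + Suc j)})"
    by (simp add: image_UN)
  also have "(\<Union>j\<in>{2..<p - 1}. {angle (n + j)..angle (n + Suc j)}) = {angle (n + 2)..angle (n + (p - 1))}"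
    using p_ge_4 angle_less by (intro Union_consecutive) (auto simp: le_less)
  finally show ?thesis .
qed

lemma local_log_ratio:
  assumes "n < p"
  shows "log_cross_ratio (angle n) (angle (Suc n)) (angle (n + 2)) (angle (n + (p - 1))) =
    (\<Sum>k\<in>{k. nonadjacent p n k}. pair_log n k)"
proof -
  \<comment> \<open>This is the logarithm of the boundary coordinate of the point
    \<open>n + j\<close>, divided by \<open>pi\<close>. The log cross ratio is its difference
    between the two ends of the second arc, hence additive.\<close>
  define f where "f = (\<lambda>j. ln (chord (angle (n + j)) (angle (Suc n)) / chord (angle (n + j)) (angle n)) / pi)"
  have split: "log_cross_ratio (angle n) (angle (Suc n)) (angle (n + i)) (angle (n + j)) = f j - f i"
    if "2 \<le> i" "i \<le> p - 1" "2 \<le> j" "j \<le> p - 1" for i j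
  proof -
    have pos: "0 < chord (angle (n + i)) (angle n)" "0 < chord (angle (n + i)) (angle (Suc n))"
      if "2 \<le> i" "i \<le> p - 1" for i
    proof -
      have "angle (n + i) < angle (n + p)" using that p_ge_4 by (intro angle_less) auto
      moreover have "angle n < angle (Suc n)" "angle (Suc n) < angle (n + i)" using that by (auto intro!: angle_less)
      ultimately show "0 < chord (angle (n + i)) (angle n)" "0 < chord (angle (n + i)) (angle (Suc n))"
        by (auto intro!: chord_pos simp: angle_add)
    qed
    show ?thesis
      using pos[OF that(1,2)] pos[OF that(3,4)]
      by (simp add: log_cross_ratio_def f_def ln_div ln_mult diff_divide_distrib[symmetric])
  qed
  have "(\<Sum>k\<in>{k. nonadjacent p n k}. pair_log n k) = (\<Sum>j\<in>{2..<p - 1}. pair_log n ((n + j) mod p))"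
    by (rule sum_nonadjacent[OF assms])
  also have "\<dots> = (\<Sum>j\<in>{2..<p - 1}. f (Suc j) - f j)"
  proof (rule sum.cong)
    fix j assume "j \<in> {2..<p - 1}"
    then have j: "2 \<le> j" "j < p - 1" by auto
    show "pair_log n ((n + j) mod p) = f (Suc j) - f j"
      unfolding pair_log_shift[OF assms j, symmetric] using j by (intro split) auto
  qed simp
  also have "\<dots> = f (p - 1) - f 2"
    using p_ge_4 by (intro sum_Suc_diff') auto
  also have "\<dots> = log_cross_ratio (angle n) (angle (Suc n)) (angle (n + 2)) (angle (n + (p - 1)))"
    using p_ge_4 by (intro split[symmetric]) auto
  finally show ?thesis by simp
qed

text \<open>The nonadjacent arcs fill one connected arc, so the local family is again of the two-arc
  type, and additivity identifies its log cross ratio.\<close>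

lemma local_bounds:
  assumes "n < p"
  defines "\<Lambda> \<equiv> \<Sum>k\<in>{k. nonadjacent p n k}. pair_log n k"
  shows "extremal_width (joining_paths (marking_arc \<theta> n) (target n)) = ennreal (local_width_real n)"
    "\<Lambda> \<le> local_width_real n" "local_width_real n \<le> \<Lambda> + 2" "0 \<le> \<Lambda>"
proof -
  interpret arc_pair "angle n" "angle (Suc n)" "angle (n + 2)" "angle (n + (p - 1))"
    using p_ge_4 by (intro arc_pair_shift) auto
  have arc: "marking_arc \<theta> n = cis ` {angle n..angle (Suc n)}"
    using marking_arc_mod[of n] assms by simp
  have lr: "log_ratio = \<Lambda>"
    unfolding log_ratio_eq \<Lambda>_def by (rule local_log_ratio[OF assms(1)])
  show "extremal_width (joining_paths (marking_arc \<theta> n) (target n)) = ennreal (local_width_real n)"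
    "\<Lambda> \<le> local_width_real n" "local_width_real n \<le> \<Lambda> + 2" "0 \<le> \<Lambda>"
    using extremal_width_real log_ratio_pos unfolding local_width_real_def arc target_eq[OF assms(1)] lr by auto
qed

lemma width_le_local_width:
  assumes "nonadjacent p n k"
  shows "width_real n k \<le> local_width_real n"
proof -
  have n: "n < p" using assms by (simp add: nonadjacent_def)
  have "joining_paths (marking_arc \<theta> n) (marking_arc \<theta> k) \<subseteq> joining_paths (marking_arc \<theta> n) (target n)"
    using assms by (intro joining_paths_mono) (auto simp: target_def)
  then have "ennreal (width_real n k) \<le> ennreal (local_width_real n)"
    unfolding pair_bounds(1)[OF assms, symmetric] local_bounds(1)[OF n, symmetric]
    by (rule extremal_width_mono)
  moreover have "0 \<le> local_width_real n" by (simp add: local_width_real_def)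
  ultimately show ?thesis by simp
qed

lemma finite_nonadjacent: "finite {k. nonadjacent p n k}"
  by (rule finite_subset[of _ "{..<p}"]) (auto simp: nonadjacent_def)

text \<open>If at least two pair widths exceed 2, then each of them loses at least 1 against its log cross
  ratio, so the total loss covers the 2 subtracted from the local width; a single one is handled by
  monotonicity.\<close>

lemma sum_pair_le_local:
  assumes n: "n < p"
  shows "(\<Sum>k\<in>{k. nonadjacent p n k}. max (width_real n k - 2) 0) \<le> max (local_width_real n - 2) 0"
proof -
  let ?N = "{k. nonadjacent p n k}"
  define B where "B = {k \<in> ?N. 2 < width_real n k}"
  have B: "finite B" "B \<subseteq> ?N" using finite_nonadjacent by (auto simp: B_def)
  have eq: "(\<Sum>k\<in>?N. max (width_real n k - 2) 0) = (\<Sum>k\<in>B. width_real n k - 2)"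
    by (rule sum.mono_neutral_cong_right) (use finite_nonadjacent in \<open>auto simp: B_def\<close>)
  consider "card B = 0" | "card B = 1" | "2 \<le> card B" by linarith
  then show ?thesis
  proof cases
    case 1
    then show ?thesis using B by (simp add: eq)
  next
    case 2
    then obtain k where k: "B = {k}" by (meson card_1_singletonE)
    then have "nonadjacent p n k" using B by auto
    then show ?thesis using width_le_local_width[of n k] by (simp add: eq k)
  next
    case 3
    have "(\<Sum>k\<in>B. width_real n k - 2) \<le> (\<Sum>k\<in>B. pair_log n k - 1)"
    proof (rule sum_mono)
      fix k assume "k \<in> B"
      then show "width_real n k - 2 \<le> pair_log n k - 1"
        using pair_bounds(4)[of n k] by (auto simp: B_def)
    qed
    also have "\<dots> = (\<Sum>k\<in>B. pair_log n k) - real (card B)"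
      by (simp add: sum_subtractf)
    also have "(\<Sum>k\<in>B. pair_log n k) \<le> (\<Sum>k\<in>?N. pair_log n k)"
      using B finite_nonadjacent pair_bounds(2) by (intro sum_mono2) (auto intro: less_imp_le)
    also have "\<dots> \<le> local_width_real n" by (rule local_bounds(2)[OF n])
    finally show ?thesis using 3 by (simp add: eq)
  qed
qed

text \<open>The error 2 of the upper bound is cancelled by the 2 in the local weight, leaving the
  sum of the \<open>pair_log n k\<close>. In each term the part above 2 is covered by the pair
  weight, because \<open>pair_log\<close> bounds the width from below.\<close>

lemma local_le_sum_pair:
  assumes n: "n < p"
  shows "max (local_width_real n - 2) 0 \<le> (\<Sum>k\<in>{k. nonadjacent p n k}. max (width_real n k - 2) 0)
      + (\<Sum>k\<in>{k. nonadjacent p n k}. min (pair_log n k) 2)"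
proof -
  have "max (local_width_real n - 2) 0 \<le> (\<Sum>k\<in>{k. nonadjacent p n k}. pair_log n k)"
    using local_bounds(3,4)[OF n] by simp
  also have "\<dots> \<le> (\<Sum>k\<in>{k. nonadjacent p n k}. max (width_real n k - 2) 0 + min (pair_log n k) 2)"
  proof (rule sum_mono)
    fix k assume "k \<in> {k. nonadjacent p n k}"
    then show "pair_log n k \<le> max (width_real n k - 2) 0 + min (pair_log n k) 2"
      using pair_bounds(3)[of n k] by auto
  qed
  finally show ?thesis by (simp add: sum.distrib)
qed

section \<open>Summation over unordered pairs\<close>

definition pairs :: "(nat \<times> nat) set" where
  "pairs = {(m, n). m < n \<and> nonadjacent p m n}"

lemma finite_pairs: "finite pairs"
  by (rule finite_subset[of _ "{..<p} \<times> {..<p}"]) (auto simp: pairs_def nonadjacent_def)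

lemma sum_symmetric:
  fixes F :: "nat \<Rightarrow> nat \<Rightarrow> real"
  assumes sym: "\<And>m n. F m n = F n m"
  shows "(\<Sum>n<p. \<Sum>k\<in>{k. nonadjacent p n k}. F n k) = 2 * (\<Sum>(m, n)\<in>pairs. F m n)"
proof -
  have Q: "Sigma {..<p} (\<lambda>n. {k. nonadjacent p n k}) = pairs \<union> prod.swap ` pairs"
    by (auto simp: pairs_def nonadjacent_def image_iff)
  have "(\<Sum>n<p. \<Sum>k\<in>{k. nonadjacent p n k}. F n k) = (\<Sum>(n, k)\<in>pairs \<union> prod.swap ` pairs. F n k)"
    using finite_nonadjacent by (simp add: sum.Sigma Q)
  also have "\<dots> = (\<Sum>(m, n)\<in>pairs. F m n) + (\<Sum>(m, n)\<in>prod.swap ` pairs. F m n)"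
    using finite_pairs by (intro sum.union_disjoint) (auto simp: pairs_def)
  also have "(\<Sum>(m, n)\<in>prod.swap ` pairs. F m n) = (\<Sum>(m, n)\<in>pairs. F n m)"
    by (subst sum.reindex) (auto simp: case_prod_unfold)
  also have "\<dots> = (\<Sum>(m, n)\<in>pairs. F m n)"
    by (intro sum.cong refl) (auto simp: sym)
  finally show ?thesis by simp
qed

text \<open>The coordinate on the circle with \<open>cis (\<theta> 0)\<close> at infinity. It is
  meaningful for indices from 1 to \<open>p - 1\<close>, which bound the arcs 1 to
  \<open>p - 2\<close>.\<close>

definition line_coord :: "nat \<Rightarrow> real" where
  "line_coord k = - cot ((\<theta> k - \<theta> 0) / 2)"

lemma line_coord_diff:
  assumes "1 \<le> i" "i < p" "1 \<le> j" "j < p"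
  shows "line_coord j - line_coord i = sin ((\<theta> j - \<theta> i) / 2) / (sin ((\<theta> i - \<theta> 0) / 2) * sin ((\<theta> j - \<theta> 0) / 2))"
    and "0 < sin ((\<theta> i - \<theta> 0) / 2)"
proof -
  have pos: "0 < sin ((\<theta> k - \<theta> 0) / 2)" if "1 \<le> k" "k < p" for k
  proof -
    have "\<theta> 0 < \<theta> k" "\<theta> k < \<theta> 0 + 2 * pi"
      using angle_less[of 0 k] angle_less[of k "0 + p"] that angle_add[of 0] by (simp_all add: angle_eq)
    then show ?thesis by (intro sin_gt_zero) auto
  qed
  then show "0 < sin ((\<theta> i - \<theta> 0) / 2)" using assms by simp
  define a b where "a = (\<theta> i - \<theta> 0) / 2" and "b = (\<theta> j - \<theta> 0) / 2"
  have ab: "0 < sin a" "0 < sin b" using pos assms by (auto simp: a_def b_def)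
  have e: "(\<theta> j - \<theta> i) / 2 = b - a" by (simp add: a_def b_def field_simps)
  have "cot a - cot b = sin (b - a) / (sin a * sin b)"
    using ab by (simp add: cot_def sin_diff diff_frac_eq)
  then show "line_coord j - line_coord i = sin ((\<theta> j - \<theta> i) / 2) / (sin ((\<theta> i - \<theta> 0) / 2) * sin ((\<theta> j - \<theta> 0) / 2))"
    unfolding e line_coord_def a_def[symmetric] b_def[symmetric] by simp
qed

lemma theta_less: "i < j \<Longrightarrow> j \<le> p \<Longrightarrow> \<theta> i < \<theta> j"
  using angle_less[of i j] by (simp add: angle_eq)

lemma theta_less_2pi: "0 < i \<Longrightarrow> j \<le> p \<Longrightarrow> i \<le> p \<Longrightarrow> \<theta> j < \<theta> i + 2 * pi"
  using theta_less[of 0 i] theta_less[of j p] marking by (cases "j = p") (auto simp: ideal_marking_def)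

text \<open>The arcs 0 and \<open>p - 1\<close> touch the point at infinity and are unbounded on the
  line. Each is in at most \<open>p\<close> pairs of cost at most 2, which gives
  \<open>4 * p\<close>; the line estimate contributes the remaining \<open>6 * p\<close>.\<close>

lemma sum_min_pairs: "(\<Sum>(m, n)\<in>pairs. min (pair_log m n) 2) \<le> 10 * real p"
proof -
  define g where "g = (\<lambda>(m, n). min (pair_log m n) 2)"
  define P0 where "P0 = {(m, n). 1 \<le> m \<and> m + 2 \<le> n \<and> n < p - 1}"
  define Z1 where "Z1 = pairs \<inter> {0} \<times> {..<p}"
  define Z2 where "Z2 = pairs \<inter> {..<p} \<times> {p - 1}"
  have P0: "P0 \<subseteq> pairs"
  proof clarify
    fix m n assume "(m, n) \<in> P0"
    then have mn: "1 \<le> m" "m + 2 \<le> n" "n < p - 1" by (auto simp: P0_def)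
    then have "Suc m mod p = Suc m" "Suc n mod p = Suc n" by auto
    then show "(m, n) \<in> pairs" using mn by (auto simp: pairs_def nonadjacent_def)
  qed
  have split: "pairs = P0 \<union> (Z1 \<union> Z2)"
  proof
    show "pairs \<subseteq> P0 \<union> (Z1 \<union> Z2)"
    proof (rule subsetI, rule ccontr)
      fix z assume z: "z \<in> pairs" "z \<notin> P0 \<union> (Z1 \<union> Z2)"
      obtain m n where "z = (m, n)" by force
      then have mn: "(m, n) \<in> pairs" "(m, n) \<notin> Z1 \<union> Z2" "(m, n) \<notin> P0" using z by auto
      then have 1: "m < n" "n < p" "Suc m mod p \<noteq> n" "m \<noteq> 0" "n \<noteq> p - 1"
        by (auto simp: pairs_def nonadjacent_def Z1_def Z2_def)
      then have "Suc m \<noteq> n" by auto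
      then show False using mn(3) 1 by (auto simp: P0_def)
    qed
  qed (use P0 in \<open>auto simp: Z1_def Z2_def\<close>)
  have fin: "finite P0" "finite Z1" "finite Z2"
    using finite_pairs P0 by (auto simp: Z1_def Z2_def intro: finite_subset)
  have nonneg: "0 \<le> g z" if "z \<in> pairs" for z
    using that pair_bounds(2) by (force simp: pairs_def g_def intro: less_imp_le)
  have "sum g pairs \<le> sum g P0 + sum g (Z1 \<union> Z2)"
    using fin nonneg P0 by (subst split, intro sum_Un_le_nonneg) auto
  moreover have "sum g (Z1 \<union> Z2) \<le> sum g Z1 + sum g Z2"
    using fin nonneg by (intro sum_Un_le_nonneg) (auto simp: Z1_def)
  moreover have "sum g Z1 \<le> 2 * real p"
  proof -
    have "card Z1 \<le> card ({0::nat} \<times> {..<p})" by (intro card_mono) (auto simp: Z1_def)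
    moreover have "sum g Z1 \<le> real (card Z1) * 2" by (intro sum_bounded_above) (auto simp: g_def)
    ultimately show ?thesis by (simp add: card_cartesian_product)
  qed
  moreover have "sum g Z2 \<le> 2 * real p"
  proof -
    have "card Z2 \<le> card ({..<p} \<times> {p - 1})" by (intro card_mono) (auto simp: Z2_def)
    moreover have "sum g Z2 \<le> real (card Z2) * 2" by (intro sum_bounded_above) (auto simp: g_def)
    ultimately show ?thesis by (simp add: card_cartesian_product)
  qed
  moreover have "sum g P0 \<le> 6 * real (p - 1)"
    unfolding g_def P0_def
  proof (rule sum_min_line[where x = line_coord])
    fix i j :: nat assume ij: "1 \<le> i" "i < j" "j \<le> p - 1"
    then have "i < p" "1 \<le> j" "j < p" using p_ge_4 by auto
    moreover have "0 < sin ((\<theta> j - \<theta> i) / 2)"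
    proof -
      have "j \<le> p" using ij by simp
      then have "\<theta> i < \<theta> j" "\<theta> j < \<theta> i + 2 * pi"
        using ij by (auto intro!: theta_less theta_less_2pi)
      then show ?thesis by (intro sin_gt_zero) auto
    qed
    ultimately have "0 < line_coord j - line_coord i"
      using ij line_coord_diff[of i j] line_coord_diff(2)[of j i] by simp
    then show "line_coord i < line_coord j" by simp
  next
    fix m n :: nat assume mn: "1 \<le> m" "m + 2 \<le> n" "n < p - 1"
    have "(m, n) \<in> pairs" using mn P0 by (auto simp: P0_def)
    then show "0 \<le> pair_log m n" using pair_bounds(2) by (auto simp: pairs_def intro: less_imp_le)
    \<comment> \<open>A chord is the difference of coordinates times a factor for each endpoint.
      Every marking point occurs once above and once below the fraction bar of the cross ratio, so
      the factors cancel.\<close>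
    define s where "s = (\<lambda>k. sin ((\<theta> k - \<theta> 0) / 2))"
    have ch: "chord (\<theta> j) (\<theta> i) = (line_coord j - line_coord i) * (s i * s j)"
      if "1 \<le> i" "i < j" "j < p" for i j
    proof -
      have "chord (\<theta> j) (\<theta> i) = sin ((\<theta> j - \<theta> i) / 2)"
        using that theta_less[of i j] theta_less_2pi[of i j] by (intro chord_eq_sin) auto
      then show ?thesis
        using that line_coord_diff[of i j] line_coord_diff(2)[of j i] by (simp add: s_def)
    qed
    have s: "0 < s m" "0 < s (Suc m)" "0 < s n" "0 < s (Suc n)"
      using line_coord_diff(2)[of _ 1] mn by (auto simp: s_def)
    have "chord (\<theta> (Suc n)) (\<theta> (Suc m)) * chord (\<theta> n) (\<theta> m) / (chord (\<theta> (Suc n)) (\<theta> m) * chord (\<theta> n) (\<theta> (Suc m)))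
      = ((line_coord (Suc n) - line_coord (Suc m)) * (line_coord n - line_coord m)) * (s m * s (Suc m) * s n * s (Suc n)) /
       (((line_coord (Suc n) - line_coord m) * (line_coord n - line_coord (Suc m))) * (s m * s (Suc m) * s n * s (Suc n)))"
      using mn by (simp only: ch[of "Suc m" "Suc n"] ch[of m n] ch[of m "Suc n"] ch[of "Suc m" n] ac_simps)
    also have "\<dots> = (line_coord (Suc n) - line_coord (Suc m)) * (line_coord n - line_coord m) / ((line_coord (Suc n) - line_coord m) * (line_coord n - line_coord (Suc m)))"
      using s by (intro mult_divide_mult_cancel_right) auto
    finally show "pair_log m n = ln ((line_coord (Suc n) - line_coord (Suc m)) * (line_coord n - line_coord m) /
        ((line_coord (Suc n) - line_coord m) * (line_coord n - line_coord (Suc m)))) / pi"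
      by (simp add: pair_log_def log_cross_ratio_def)
  qed
  ultimately have "sum g pairs \<le> 10 * real p" using p_ge_4 by (simp add: of_nat_diff)
  then show ?thesis by (simp add: g_def)
qed

lemma total_weight_eq: "total_weight p \<theta> = ereal (\<Sum>n<p. max (local_width_real n - 2) 0)"
proof -
  have "local_weight p \<theta> n = ereal (max (local_width_real n - 2) 0)" if "n < p" for n
  proof -
    have "0 \<le> local_width_real n" by (simp add: local_width_real_def)
    then have "local_width p \<theta> n = ereal (local_width_real n)"
      using local_bounds(1)[OF that] by (simp add: local_width_def target_def)
    then show ?thesis by (simp add: local_weight_def max_def zero_ereal_def numeral_eq_ereal)
  qed
  then have "total_weight p \<theta> = (\<Sum>n<p. ereal (max (local_width_real n - 2) 0))"
    unfolding total_weight_def by (intro sum.cong) auto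
  then show ?thesis by (simp only: sum_ereal)
qed

lemma pair_sum_eq:
  "(\<Sum>(m, n)\<in>pairs. pair_weight \<theta> m n) = ereal (\<Sum>(m, n)\<in>pairs. max (width_real m n - 2) 0)"
proof -
  have "pair_weight \<theta> m n = ereal (max (width_real m n - 2) 0)" if "(m, n) \<in> pairs" for m n
  proof -
    have "0 \<le> width_real m n" by (simp add: width_real_def)
    then have "pair_width \<theta> m n = ereal (width_real m n)"
      using pair_bounds(1)[of m n] that by (simp add: pair_width_def pairs_def)
    then show ?thesis by (simp add: pair_weight_def max_def zero_ereal_def numeral_eq_ereal)
  qed
  then have "(\<Sum>(m, n)\<in>pairs. pair_weight \<theta> m n) = (\<Sum>(m, n)\<in>pairs. ereal (max (width_real m n - 2) 0))"
    by (intro sum.cong) auto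
  then show ?thesis by (simp only: case_prod_unfold sum_ereal)
qed

text \<open>The constant is 20 because the sum of local errors meets every unordered pair twice, and
  the bound for pairs is \<open>10 * p\<close>.\<close>

lemma weight_comparison:
  "total_weight p \<theta> - ereal (20 * real p) \<le> 2 * (\<Sum>(m, n)\<in>pairs. pair_weight \<theta> m n)"
  "2 * (\<Sum>(m, n)\<in>pairs. pair_weight \<theta> m n) \<le> total_weight p \<theta>"
proof -
  define S where "S = (\<Sum>(m, n)\<in>pairs. max (width_real m n - 2) 0)"
  define W where "W = (\<Sum>n<p. max (local_width_real n - 2) 0)"
  have S: "(\<Sum>n<p. \<Sum>k\<in>{k. nonadjacent p n k}. max (width_real n k - 2) 0) = 2 * S"
    unfolding S_def using width_real_commute by (intro sum_symmetric) simp
  have M: "(\<Sum>n<p. \<Sum>k\<in>{k. nonadjacent p n k}. min (pair_log n k) 2) = 2 * (\<Sum>(m, n)\<in>pairs. min (pair_log m n) 2)"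
    using pair_log_commute by (intro sum_symmetric) simp
  have "2 * S \<le> W"
    unfolding S[symmetric] W_def by (intro sum_mono sum_pair_le_local) auto
  moreover have "W - 20 * real p \<le> 2 * S"
  proof -
    have "W \<le> (\<Sum>n<p. (\<Sum>k\<in>{k. nonadjacent p n k}. max (width_real n k - 2) 0)
        + (\<Sum>k\<in>{k. nonadjacent p n k}. min (pair_log n k) 2))"
      unfolding W_def by (rule sum_mono) (rule local_le_sum_pair, simp)
    also have "\<dots> = 2 * S + 2 * (\<Sum>(m, n)\<in>pairs. min (pair_log m n) 2)"
      by (subst sum.distrib) (simp only: S M)
    finally show ?thesis using sum_min_pairs by linarith
  qed
  moreover have "2 * (\<Sum>(m, n)\<in>pairs. pair_weight \<theta> m n) = ereal (2 * S)"
    by (simp add: pair_sum_eq S_def numeral_eq_ereal)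
  moreover have "total_weight p \<theta> = ereal W"
    by (simp add: total_weight_eq W_def)
  ultimately show "total_weight p \<theta> - ereal (20 * real p) \<le> 2 * (\<Sum>(m, n)\<in>pairs. pair_weight \<theta> m n)"
    "2 * (\<Sum>(m, n)\<in>pairs. pair_weight \<theta> m n) \<le> total_weight p \<theta>"
    by simp_all
qed

end

theorem theorem3p7:
  shows "\<exists>C::real. \<forall>p::nat. \<forall>\<theta>. p \<ge> 4 \<longrightarrow> ideal_marking p \<theta> \<longrightarrow>
     total_weight p \<theta> - ereal (C * real p)
        \<le> 2 * (\<Sum>(m,n)\<in>{(m,n). m < n \<and> nonadjacent p m n}. pair_weight \<theta> m n)
   \<and> 2 * (\<Sum>(m,n)\<in>{(m,n). m < n \<and> nonadjacent p m n}. pair_weight \<theta> m n)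
        \<le> total_weight p \<theta>"
proof (intro exI allI impI)
  fix p :: nat and \<theta> :: "nat \<Rightarrow> real"
  assume "4 \<le> p" "ideal_marking p \<theta>"
  then interpret marking p \<theta> by unfold_locales
  show "total_weight p \<theta> - ereal (20 * real p)
        \<le> 2 * (\<Sum>(m,n)\<in>{(m,n). m < n \<and> nonadjacent p m n}. pair_weight \<theta> m n)
   \<and> 2 * (\<Sum>(m,n)\<in>{(m,n). m < n \<and> nonadjacent p m n}. pair_weight \<theta> m n)
        \<le> total_weight p \<theta>"
    using weight_comparison by (simp add: pairs_def)
qed

end
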